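(* Let $A_0,\dots,A_l$, $l\le k$, be finite non-empty sets in $\mathbb Z^k$. Then the reduced discriminant $D^{red}_{A_0,\dots,A_l}$ equals (up to a non-zero constant factor) the product of the reduced discriminants $D^{red}_{A_J}$ over all non-empty subsets $J\subset\{0,\dots,l\}$ such that $\mathrm{codim}\,J\le\mathrm{codim}\,J'$ for every $J'$ with $J\subset J'\subset\{0,\dots,l\}$.
   Context: For a finite set $A\subset\mathbb Z^k$, $\mathbb C[A]$ is the space of Laurent polynomials $\sum_{a\in A}c_ay^a$ on $(\mathbb C\setminus0)^k$. Let $\Sigma_{A_0,\dots,A_l}\subset\mathbb C[A_0]\oplus\dots\oplus\mathbb C[A_l]$ be the set of all collections $(\varphi_0,\dots,\varphi_l)$ whose differentials are linearly dependent at some point of $\{y\in(\mathbb C\setminus0)^k\mid\varphi_0(y)=\dots=\varphi_l(y)=0\}$. $D^{red}_{A_0,\dots,A_l}$ is the square-free polynomial on $\mathbb C[A_0]\oplus\dots\oplus\mathbb C[A_l]$ whose zero set is the union of the codimension 1 components of the closure of $\Sigma_{A_0,\dots,A_l}$ (it equals $1$ if there are none); it is defined up to a non-zero constant. In particular for one set $A$ (in any lattice $\mathbb Z^N$), $D^{red}_A$ is the square-free equation of the closure of $\Sigma_A=\{\varphi\in\mathbb C[A]\mid\varphi(y)=0,\ d\varphi(y)=0\text{ for some }y\in(\mathbb C\setminus 0)^N\}$ if this closure is a hypersurface, and $1$ otherwise. For $J\subset\{0,\dots,l\}$, $\mathrm{codim}\,J:=\dim\sum_{j\in J}A_j-|J|$,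 where the dimension of a finite set is the dimension of its convex hull and the sum is the Minkowski sum. Let $e_0,\dots,e_l$ be the standard basis of $\mathbb Z^{l+1}$ and $A_J=\bigcup_{j\in J}A_j\times\{e_j\}\subset\mathbb Z^k\oplus\mathbb Z^{l+1}$. The space $\bigoplus_{j\in J}\mathbb C[A_j]$ is identified with $\mathbb C[A_J]$ by $(\varphi_j)_{j\in J}\mapsto\sum_{j\in J}\lambda_j\varphi_j$, where $\lambda_0,\dots,\lambda_l$ are the coordinates on $(\mathbb C\setminus0)^{l+1}$; in this way $D^{red}_{A_J}$ is regarded as a polynomial on $\mathbb C[A_0]\oplus\dots\oplus\mathbb C[A_l]$ (depending only on the components with indices in $J$). *)

theory Defs
  imports
    "HOL-Analysis.Analysis"
    "HOL-Library.Poly_Mapping"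
    "HOL-Library.Function_Algebras"
    "HOL-Library.Set_Algebras"
    "HOL-Library.Extended_Nat"
    "HOL-Computational_Algebra.Squarefree"
begin

section \<open>Polynomials and affine space over a set of coordinates\<close>

text \<open>A polynomial is a finitely supported function from monomials (finitely supported exponent
  functions) to complex coefficients. Multiplication is convolution.\<close>

type_synonym 'v mpoly = "('v \<Rightarrow>\<^sub>0 nat) \<Rightarrow>\<^sub>0 complex"

definition polys_on :: "'v set \<Rightarrow> 'v mpoly set" where
  "polys_on V = {p. \<forall>m\<in>Poly_Mapping.keys p. Poly_Mapping.keys m \<subseteq> V}"

definition monom_eval :: "('v \<Rightarrow>\<^sub>0 nat) \<Rightarrow> ('v \<Rightarrow> complex) \<Rightarrow> complex" where
  "monom_eval m x = (\<Prod>v\<in>Poly_Mapping.keys m. x v ^ Poly_Mapping.lookup m v)"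

definition poly_eval :: "'v mpoly \<Rightarrow> ('v \<Rightarrow> complex) \<Rightarrow> complex" where
  "poly_eval p x = (\<Sum>m\<in>Poly_Mapping.keys p. Poly_Mapping.lookup p m * monom_eval m x)"

definition const_poly :: "complex \<Rightarrow> 'v mpoly" where
  "const_poly c = Poly_Mapping.single 0 c"

definition rename_vars :: "('v \<Rightarrow> 'w) \<Rightarrow> 'v mpoly \<Rightarrow> 'w mpoly" where
  "rename_vars f p = (\<Sum>m\<in>Poly_Mapping.keys p.
     Poly_Mapping.single
       (\<Sum>v\<in>Poly_Mapping.keys m. Poly_Mapping.single (f v) (Poly_Mapping.lookup m v))
       (Poly_Mapping.lookup p m))"

text \<open>The vector space of complex-valued functions on \<open>V\<close>, extended by zero outside \<open>V\<close>.\<close>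

definition affine_space :: "'v set \<Rightarrow> ('v \<Rightarrow> complex) set" where
  "affine_space V = {x. \<forall>v. v \<notin> V \<longrightarrow> x v = 0}"

definition zero_set :: "'v set \<Rightarrow> 'v mpoly set \<Rightarrow> ('v \<Rightarrow> complex) set" where
  "zero_set V P = {x \<in> affine_space V. \<forall>p\<in>P. poly_eval p x = 0}"

definition zariski :: "'v set \<Rightarrow> ('v \<Rightarrow> complex) topology" where
  "zariski V = topology (\<lambda>U. \<exists>P \<subseteq> polys_on V. U = affine_space V - zero_set V P)"

lemma poly_eval_superset:
  assumes "finite S" "Poly_Mapping.keys p \<subseteq> S"
  shows "poly_eval p x = (\<Sum>m\<in>S. Poly_Mapping.lookup p m * monom_eval m x)"
  unfolding poly_eval_def
  by (rule sum.mono_neutral_left) (use assms in \<open>auto simp: in_keys_iff\<close>)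

lemma poly_eval_0 [simp]: "poly_eval 0 x = 0"
  by (simp add: poly_eval_def)

lemma poly_eval_add: "poly_eval (p + q) x = poly_eval p x + poly_eval q x"
proof -
  let ?S = "Poly_Mapping.keys p \<union> Poly_Mapping.keys q"
  have "finite ?S" "Poly_Mapping.keys (p + q) \<subseteq> ?S"
    by (simp_all add: Poly_Mapping.keys_add)
  then show ?thesis
    by (simp add: poly_eval_superset[of ?S] lookup_add distrib_right sum.distrib)
qed

lemma poly_eval_sum: "poly_eval (sum f S) x = (\<Sum>s\<in>S. poly_eval (f s) x)"
  by (induction S rule: infinite_finite_induct) (auto simp: poly_eval_add)

lemma poly_eval_single [simp]: "poly_eval (Poly_Mapping.single m c) x = c * monom_eval m x"
  by (cases "c = 0") (auto simp: poly_eval_def)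

lemma monom_eval_superset:
  assumes "finite S" "Poly_Mapping.keys m \<subseteq> S"
  shows "monom_eval m x = (\<Prod>v\<in>S. x v ^ Poly_Mapping.lookup m v)"
  unfolding monom_eval_def
  by (rule prod.mono_neutral_left) (use assms in \<open>auto simp: in_keys_iff\<close>)

lemma monom_eval_0 [simp]: "monom_eval 0 x = 1"
  by (simp add: monom_eval_def)

lemma monom_eval_add: "monom_eval (m + n) x = monom_eval m x * monom_eval n x"
proof -
  let ?S = "Poly_Mapping.keys m \<union> Poly_Mapping.keys n"
  have "finite ?S" "Poly_Mapping.keys (m + n) \<subseteq> ?S"
    by (simp_all add: Poly_Mapping.keys_add)
  then show ?thesis
    by (simp add: monom_eval_superset[of ?S] lookup_add power_add prod.distrib)
qed

lemma mpoly_sum_monomials: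
  fixes p :: "'v mpoly"
  shows "p = (\<Sum>m\<in>Poly_Mapping.keys p. Poly_Mapping.single m (Poly_Mapping.lookup p m))"
proof (rule poly_mapping_eqI)
  fix k
  show "Poly_Mapping.lookup p k = Poly_Mapping.lookup
      (\<Sum>m\<in>Poly_Mapping.keys p. Poly_Mapping.single m (Poly_Mapping.lookup p m)) k"
    by (cases "k \<in> Poly_Mapping.keys p")
      (auto simp: lookup_sum lookup_single when_def in_keys_iff)
qed

lemma poly_eval_mult: "poly_eval (p * q) x = poly_eval p x * poly_eval q x"
proof -
  have "p * q = (\<Sum>m\<in>Poly_Mapping.keys p. \<Sum>n\<in>Poly_Mapping.keys q.
      Poly_Mapping.single (m + n) (Poly_Mapping.lookup p m * Poly_Mapping.lookup q n))"
    by (subst mpoly_sum_monomials[of p], subst mpoly_sum_monomials[of q])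
      (simp add: sum_product mult_single)
  then show ?thesis
    by (simp add: poly_eval_sum monom_eval_add sum_product poly_eval_def[of p]
        poly_eval_def[of q] mult_ac)
qed

lemma polys_on_mult:
  assumes "p \<in> polys_on V" "q \<in> polys_on V"
  shows "p * q \<in> polys_on V"
  unfolding polys_on_def
proof safe
  fix m v assume m: "m \<in> Poly_Mapping.keys (p * q)" and v: "v \<in> Poly_Mapping.keys m"
  from m keys_mult[of p q] obtain a b
    where "m = a + b" "a \<in> Poly_Mapping.keys p" "b \<in> Poly_Mapping.keys q" by blast
  moreover from this v have "v \<in> Poly_Mapping.keys a \<union> Poly_Mapping.keys b"
    using Poly_Mapping.keys_add[of a b] by blast
  ultimately show "v \<in> V" using assms by (auto simp: polys_on_def)
qed

lemma zero_set_Un: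
  "zero_set V P \<union> zero_set V Q = zero_set V {p * q | p q. p \<in> P \<and> q \<in> Q}"
proof -
  have "x \<in> zero_set V Q"
    if x: "x \<in> zero_set V {p * q | p q. p \<in> P \<and> q \<in> Q}" and nP: "x \<notin> zero_set V P" for x
  proof -
    from x nP obtain p where p: "p \<in> P" "poly_eval p x \<noteq> 0" by (auto simp: zero_set_def)
    have "poly_eval q x = 0" if "q \<in> Q" for q
    proof -
      have "poly_eval (p * q) x = 0" using x p that by (auto simp: zero_set_def)
      with p show ?thesis by (simp add: poly_eval_mult)
    qed
    with x show ?thesis by (auto simp: zero_set_def)
  qed
  then show ?thesis by (auto simp: zero_set_def poly_eval_mult)
qed

lemma istopology_zariski:
  "istopology (\<lambda>U. \<exists>P \<subseteq> polys_on V. U = affine_space V - zero_set V P)"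
  unfolding istopology_def
proof safe
  fix P Q :: "'a mpoly set"
  assume "P \<subseteq> polys_on V" "Q \<subseteq> polys_on V"
  then show "\<exists>R \<subseteq> polys_on V. (affine_space V - zero_set V P) \<inter> (affine_space V - zero_set V Q)
      = affine_space V - zero_set V R"
    by (intro exI[of _ "{p * q | p q. p \<in> P \<and> q \<in> Q}"])
      (auto simp: zero_set_Un[symmetric] intro: polys_on_mult)
next
  fix \<U> :: "('a \<Rightarrow> complex) set set"
  assume "\<forall>U\<in>\<U>. \<exists>P \<subseteq> polys_on V. U = affine_space V - zero_set V P"
  then obtain P where P: "\<And>U. U \<in> \<U> \<Longrightarrow> P U \<subseteq> polys_on V"
    "\<And>U. U \<in> \<U> \<Longrightarrow> U = affine_space V - zero_set V (P U)" by metis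
  have "x \<in> \<Union>\<U> \<longleftrightarrow> x \<in> affine_space V - zero_set V (\<Union>(P ` \<U>))" for x
  proof -
    have "x \<in> \<Union>\<U> \<longleftrightarrow> (\<exists>U\<in>\<U>. x \<in> affine_space V - zero_set V (P U))"
      using P(2) by blast
    also have "\<dots> \<longleftrightarrow> x \<in> affine_space V - zero_set V (\<Union>(P ` \<U>))"
      by (auto simp: zero_set_def)
    finally show ?thesis .
  qed
  then have "\<Union>\<U> = affine_space V - zero_set V (\<Union>(P ` \<U>))" by blast
  with P(1) show "\<exists>R \<subseteq> polys_on V. \<Union>\<U> = affine_space V - zero_set V R"
    by (intro exI[of _ "\<Union>(P ` \<U>)"]) blast
qed

lemma openin_zariski:
  "openin (zariski V) U \<longleftrightarrow> (\<exists>P \<subseteq> polys_on V. U = affine_space V - zero_set V P)"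
  unfolding zariski_def by (subst topology_inverse'[OF istopology_zariski]) (rule refl)

lemma topspace_zariski [simp]: "topspace (zariski V) = affine_space V"
proof
  show "topspace (zariski V) \<subseteq> affine_space V"
    by (metis Diff_subset openin_topspace openin_zariski)
  have "1 \<in> polys_on V" by (auto simp: polys_on_def)
  moreover have "zero_set V {1} = {}"
    by (auto simp: zero_set_def poly_eval_single[of 0 1, simplified])
  ultimately have "openin (zariski V) (affine_space V)"
    unfolding openin_zariski by (intro exI[of _ "{1}"]) auto
  then show "affine_space V \<subseteq> topspace (zariski V)" by (rule openin_subset)
qed

lemma closedin_zariski:
  "closedin (zariski V) Z \<longleftrightarrow> (\<exists>P \<subseteq> polys_on V. Z = zero_set V P)"
proof -
  have sub: "zero_set V P \<subseteq> affine_space V" for P by (auto simp: zero_set_def)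
  then show ?thesis
    unfolding closedin_def openin_zariski topspace_zariski
    by (metis double_diff order_refl)
qed


section \<open>Irreducible components and codimension\<close>

definition irreducible_closed :: "'a topology \<Rightarrow> 'a set \<Rightarrow> bool" where
  "irreducible_closed X Z \<longleftrightarrow> closedin X Z \<and> Z \<noteq> {} \<and>
     (\<forall>C D. closedin X C \<and> closedin X D \<and> Z \<subseteq> C \<union> D \<longrightarrow> Z \<subseteq> C \<or> Z \<subseteq> D)"

definition irreducible_components :: "'a topology \<Rightarrow> 'a set \<Rightarrow> 'a set set" where
  "irreducible_components X W = {Z. irreducible_closed X Z \<and> Z \<subseteq> W \<and>
     (\<forall>Y. irreducible_closed X Y \<and> Z \<subseteq> Y \<and> Y \<subseteq> W \<longrightarrow> Y = Z)}"

text \<open>Krull codimension: the supremum of the lengths of chains of irreducible closed sets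
  that start at \<open>Z\<close>.\<close>

definition codimension :: "'a topology \<Rightarrow> 'a set \<Rightarrow> enat" where
  "codimension X Z = Sup {enat n | n. \<exists>C :: nat \<Rightarrow> 'a set. C 0 = Z \<and>
     (\<forall>i\<le>n. irreducible_closed X (C i)) \<and> (\<forall>i<n. C i \<subset> C (Suc i))}"


section \<open>Laurent polynomials and reduced discriminants\<close>

text \<open>The coordinates of a lattice are indexed by a finite set \<open>K\<close>, which may be empty.\<close>

definition lattice :: "'k set \<Rightarrow> ('k \<Rightarrow> int) set" where
  "lattice K = {a. \<forall>t. t \<notin> K \<longrightarrow> a t = 0}"

definition torus :: "'k set \<Rightarrow> ('k \<Rightarrow> complex) set" where
  "torus K = {y \<in> affine_space K. \<forall>t\<in>K. y t \<noteq> 0}"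

definition laurent :: "'k set \<Rightarrow> ('k \<Rightarrow> int) set \<Rightarrow> (('k \<Rightarrow> int) \<Rightarrow> complex) \<Rightarrow> ('k \<Rightarrow> complex) \<Rightarrow> complex"
  where "laurent K A c y = (\<Sum>a\<in>A. c a * (\<Prod>t\<in>K. y t powi a t))"

definition partial_deriv :: "'k \<Rightarrow> (('k \<Rightarrow> complex) \<Rightarrow> complex) \<Rightarrow> ('k \<Rightarrow> complex) \<Rightarrow> complex" where
  "partial_deriv t f y = deriv (\<lambda>z. f (y(t := z))) (y t)"

text \<open>A collection of Laurent polynomials with supports \<open>A i\<close>, \<open>i \<in> I\<close>, is given by its
  coefficients, the coefficient of the monomial \<open>a\<close> in the polynomial number \<open>i\<close> being
  \<open>x (i, a)\<close>.\<close>

definition singular_systems ::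
  "'k set \<Rightarrow> 'i set \<Rightarrow> ('i \<Rightarrow> ('k \<Rightarrow> int) set) \<Rightarrow> ('i \<times> ('k \<Rightarrow> int) \<Rightarrow> complex) set" where
  "singular_systems K I A = {x \<in> affine_space (Sigma I A). \<exists>y\<in>torus K.
     (\<forall>i\<in>I. laurent K (A i) (\<lambda>a. x (i, a)) y = 0) \<and>
     (\<exists>\<mu> :: 'i \<Rightarrow> complex. (\<exists>i\<in>I. \<mu> i \<noteq> 0) \<and>
        (\<forall>t\<in>K. (\<Sum>i\<in>I. \<mu> i * partial_deriv t (laurent K (A i) (\<lambda>a. x (i, a))) y) = 0))}"

text \<open>The closure is taken in the Zariski topology. For this set, which is constructible, it is the
  same as the closure in the Euclidean topology.\<close>

definition is_reduced_discriminant ::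
  "'k set \<Rightarrow> 'i set \<Rightarrow> ('i \<Rightarrow> ('k \<Rightarrow> int) set) \<Rightarrow> ('i \<times> ('k \<Rightarrow> int)) mpoly \<Rightarrow> bool" where
  "is_reduced_discriminant K I A D \<longleftrightarrow>
     (let X = zariski (Sigma I A) in
       D \<in> polys_on (Sigma I A) \<and> squarefree D \<and>
       zero_set (Sigma I A) {D} =
         \<Union>{Z \<in> irreducible_components X (X closure_of singular_systems K I A).
             codimension X Z = 1})"

text \<open>The discriminant is only defined up to a non-zero constant factor; this picks one
  representative. If there are no components of codimension one, the zero set is empty, and the
  representative is a non-zero constant.\<close>

definition reduced_discriminant ::
  "'k set \<Rightarrow> 'i set \<Rightarrow> ('i \<Rightarrow> ('k \<Rightarrow> int) set) \<Rightarrow> ('i \<times> ('k \<Rightarrow> int)) mpoly" where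
  "reduced_discriminant K I A = (SOME D. is_reduced_discriminant K I A D)"


section \<open>The sets \<open>A\<^sub>J\<close>\<close>

text \<open>\<open>cayley_point (j, a)\<close> is the point \<open>(a, e\<^sub>j)\<close> of the direct sum of two lattices, whose
  coordinates are indexed by a disjoint sum. The map is injective.\<close>

fun cayley_point :: "'i \<times> ('k \<Rightarrow> int) \<Rightarrow> ('k + 'i \<Rightarrow> int)" where
  "cayley_point (j, a) = case_sum a (\<lambda>i. of_bool (i = j))"

lemma inj_cayley_point: "inj cayley_point"
proof (rule injI)
  fix u v :: "'i \<times> ('k \<Rightarrow> int)"
  assume eq: "cayley_point u = cayley_point v"
  obtain j a i b where uv: "u = (j, a)" "v = (i, b)" by (metis surj_pair)
  have "a t = b t" for t using fun_cong[OF eq, of "Inl t"] by (simp add: uv)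
  moreover have "j = i" using fun_cong[OF eq, of "Inr j"] by (auto simp: uv split: if_splits)
  ultimately show "u = v" by (auto simp: uv)
qed

definition cayley_set :: "('i \<Rightarrow> ('k \<Rightarrow> int) set) \<Rightarrow> 'i set \<Rightarrow> ('k + 'i \<Rightarrow> int) set" where
  "cayley_set A J = cayley_point ` Sigma J A"

text \<open>The discriminant of the single set \<open>A\<^sub>J\<close>, as a polynomial in the coefficients of the
  original collection: the coefficient of the monomial \<open>(a, e\<^sub>j)\<close> is the coefficient of the
  monomial \<open>a\<close> of the polynomial number \<open>j\<close>.\<close>

definition cayley_discriminant ::
  "'k set \<Rightarrow> 'i set \<Rightarrow> ('i \<Rightarrow> ('k \<Rightarrow> int) set) \<Rightarrow> 'i set \<Rightarrow> ('i \<times> ('k \<Rightarrow> int)) mpoly" where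
  "cayley_discriminant K I A J =
     rename_vars (\<lambda>(_, b). inv cayley_point b)
       (reduced_discriminant (K <+> I) {()} (\<lambda>_. cayley_set A J))"


section \<open>Codimension of a collection of sets\<close>

instantiation "fun" :: (type, real_vector) real_vector
begin

definition scaleR_fun :: "real \<Rightarrow> ('a \<Rightarrow> 'b) \<Rightarrow> 'a \<Rightarrow> 'b" where
  "scaleR_fun r f = (\<lambda>x. r *\<^sub>R f x)"

instance
  by standard (auto simp: scaleR_fun_def fun_eq_iff scaleR_add_right scaleR_add_left)

end

text \<open>The dimension of a convex set is the dimension of the linear space spanned by
  the differences of its points.\<close>

definition lattice_dim :: "('k \<Rightarrow> int) set \<Rightarrow> nat" where
  "lattice_dim S =
     (let C = convex hull ((\<lambda>a t. real_of_int (a t)) ` S) in dim {x - y | x y. x \<in> C \<and> y \<in> C})"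

definition codim :: "('i \<Rightarrow> ('k \<Rightarrow> int) set) \<Rightarrow> 'i set \<Rightarrow> int" where
  "codim A J = int (lattice_dim (\<Sum>j\<in>J. A j)) - int (card J)"

end

(* Let T J be the set of systems whose members with index in J have a common zero at which their
   differentials satisfy a linear relation without zero coefficients (dependent_systems J J, the
   singular locus of the Cayley set of J), and let S J be its subset where all polynomials vanish at
   that point (dependent_systems J I). The singular systems are the union of the S J.
   If codim J' < codim J for some J' containing J, then the differentials with index in J' are
   dependent modulo the directions of J, and a small perturbation shows that S J lies in the union
   of the closures of the S J'' with J'' strictly containing J. If there is no such J', then Rado's
   theorem provides enough independent directions to solve the remaining equations on the torus
   orbit of the degenerate zero, so that S J is dense in T J. Hence the closure of the singular
   systems is the union of the irreducible closures of the T J over the J of the product.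
   The equations of those T J that are hypersurfaces are pairwise coprime, because such an equation
   involves exactly the coefficients with index in J. This fact and the properness of T J follow by
   extending derivations from the coefficients to the incidence variety. *)
theory Submission
  imports
    Defs
    "HOL-Complex_Analysis.Complex_Analysis"
    "HOL-Computational_Algebra.Fundamental_Theorem_Algebra"
begin

section \<open>Polynomials\<close>

text \<open>The condition on \<open>codim\<close> is Rado's rank condition in disguise: for P
  disjoint from J, codim J <= codim (J \<union> P) says that the directions of the sets with index
  in P have rank at least |P| modulo those of J. Minimality of J is thus what an independent
  transversal modulo J requires. Closures are handled through the polynomials that vanish on a set,
  and statements about these are reduced to one complex variable by restricting to entire curves and
  using the identity theorem. This is why torus points are written through logarithms, which can be
  moved linearly without leaving the torus. Relations without zero coefficients make T J a singular
  locus: their coefficients are the torus coordinates \<lambda>_j of the Cayley set. Inclusions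
  among the closures of the T J are harmless: an irreducible proper closed set that contains an
  irreducible hypersurface equals it, so every T J of the product that is a hypersurface is
  automatically dense in a component, and only repetitions have to be excluded.\<close>

definition poly_var :: "'v \<Rightarrow> 'v mpoly" where
  "poly_var v = Poly_Mapping.single (Poly_Mapping.single v 1) 1"

lemma monom_eval_single [simp]: "monom_eval (Poly_Mapping.single v n) x = x v ^ n"
  by (cases "n = 0") (simp_all add: monom_eval_def)

lemma poly_eval_var [simp]: "poly_eval (poly_var v) x = x v"
  by (simp add: poly_var_def)

lemma poly_eval_const [simp]: "poly_eval (const_poly c) x = c"
  by (simp add: const_poly_def)

lemma poly_eval_1 [simp]: "poly_eval 1 x = 1"
  using poly_eval_single[of 0 1 x] by simp

lemma poly_eval_uminus [simp]: "poly_eval (- p) x = - poly_eval p x"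
proof -
  have "poly_eval (- p + p) x = 0" by simp
  then show ?thesis by (simp only: poly_eval_add add_eq_0_iff2)
qed

lemma poly_eval_diff: "poly_eval (p - q) x = poly_eval p x - poly_eval q x"
  using poly_eval_add[of p "- q" x] by simp

lemma poly_eval_prod: "poly_eval (prod f S) x = (\<Prod>s\<in>S. poly_eval (f s) x)"
  by (induction S rule: infinite_finite_induct) (auto simp: poly_eval_mult)

lemma poly_eval_power: "poly_eval (p ^ n) x = poly_eval p x ^ n"
  by (induction n) (auto simp: poly_eval_mult)

lemma const_poly_0 [simp]: "const_poly 0 = 0"
  by (simp add: const_poly_def)

lemma const_poly_1 [simp]: "const_poly 1 = 1"
  by (simp add: const_poly_def)

lemma const_poly_mult: "const_poly (a * b) = const_poly a * const_poly b"
  by (simp add: const_poly_def mult_single)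

lemma const_poly_eq_0_iff [simp]: "const_poly c = 0 \<longleftrightarrow> c = 0"
  by (metis const_poly_0 poly_eval_const)

lemma const_poly_unit: "c \<noteq> 0 \<Longrightarrow> const_poly c dvd 1"
  by (metis const_poly_1 const_poly_mult dvd_triv_left right_inverse)

lemma poly_var_power: "poly_var w ^ n = Poly_Mapping.single (Poly_Mapping.single w n) 1"
  by (induction n) (simp_all add: poly_var_def mult_single single_add[symmetric])

lemma polys_on_0 [simp]: "0 \<in> polys_on V"
  by (simp add: polys_on_def)

lemma polys_on_const [simp]: "const_poly c \<in> polys_on V"
  by (simp add: polys_on_def const_poly_def)

lemma polys_on_1 [simp]: "1 \<in> polys_on V"
  by (simp add: polys_on_def)

lemma polys_on_var [simp]: "poly_var v \<in> polys_on V \<longleftrightarrow> v \<in> V"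
  by (simp add: polys_on_def poly_var_def)

lemma polys_on_mono: "p \<in> polys_on V \<Longrightarrow> V \<subseteq> W \<Longrightarrow> p \<in> polys_on W"
  by (auto simp: polys_on_def)

lemma polys_on_UNIV [simp]: "p \<in> polys_on UNIV"
  by (simp add: polys_on_def)

lemma polys_on_add: "p \<in> polys_on V \<Longrightarrow> q \<in> polys_on V \<Longrightarrow> p + q \<in> polys_on V"
  using Poly_Mapping.keys_add[of p q] by (fastforce simp: polys_on_def)

lemma polys_on_uminus: "p \<in> polys_on V \<Longrightarrow> - p \<in> polys_on V"
  by (simp add: polys_on_def in_keys_iff)

lemma polys_on_diff: "p \<in> polys_on V \<Longrightarrow> q \<in> polys_on V \<Longrightarrow> p - q \<in> polys_on V"
  using polys_on_add[of p V "- q"] polys_on_uminus[of q V] by simp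

lemma polys_on_sum: "(\<And>s. s \<in> S \<Longrightarrow> f s \<in> polys_on V) \<Longrightarrow> sum f S \<in> polys_on V"
  by (induction S rule: infinite_finite_induct) (auto intro: polys_on_add)

lemma polys_on_prod: "(\<And>s. s \<in> S \<Longrightarrow> f s \<in> polys_on V) \<Longrightarrow> prod f S \<in> polys_on V"
  by (induction S rule: infinite_finite_induct) (auto intro: polys_on_mult)

lemma polys_on_power: "p \<in> polys_on V \<Longrightarrow> p ^ n \<in> polys_on V"
  by (induction n) (auto intro: polys_on_mult)

lemma ex_finite_polys_on: "\<exists>V. finite V \<and> p \<in> polys_on V"
  by (rule exI[of _ "\<Union>(Poly_Mapping.keys ` Poly_Mapping.keys p)"]) (auto simp: polys_on_def)

lemma ex_finite_polys_on2: "\<exists>V. finite V \<and> p \<in> polys_on V \<and> q \<in> polys_on V"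
proof -
  obtain V W where "finite V" "p \<in> polys_on V" "finite W" "q \<in> polys_on W"
    using ex_finite_polys_on by metis
  then show ?thesis by (intro exI[of _ "V \<union> W"]) (auto intro: polys_on_mono)
qed

lemma polys_on_empty:
  assumes p: "p \<in> polys_on {}"
  shows "p = const_poly (Poly_Mapping.lookup p 0)"
proof -
  have *: "Poly_Mapping.lookup p k = (Poly_Mapping.lookup p 0 when 0 = k)" for k
  proof (cases "k = 0")
    case False
    then have "Poly_Mapping.keys k \<noteq> {}" by (metis keys_eq_empty)
    with p have "k \<notin> Poly_Mapping.keys p" by (auto simp: polys_on_def)
    with False show ?thesis by (simp add: in_keys_iff)
  qed auto
  show ?thesis unfolding const_poly_def
    by (rule poly_mapping_eqI, subst lookup_single, rule *)
qed

lemma poly_eval_cong: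
  assumes "p \<in> polys_on V" "\<And>v. v \<in> V \<Longrightarrow> x v = y v"
  shows "poly_eval p x = poly_eval p y"
proof -
  have "x v = y v" if "m \<in> Poly_Mapping.keys p" "v \<in> Poly_Mapping.keys m" for m v
    using assms that by (auto simp: polys_on_def)
  then show ?thesis by (simp add: poly_eval_def monom_eval_def)
qed

lemma poly_eval_poly:
  "poly_eval (poly P q) x = poly (map_poly (\<lambda>c. poly_eval c x) P) (poly_eval q x)"
  by (induction P) (auto simp: map_poly_pCons poly_eval_add poly_eval_mult)

section \<open>Polynomials as univariate polynomials in one distinguished variable\<close>

lemma ex_as_poly:
  assumes "p \<in> polys_on V"
  shows "\<exists>P. (\<forall>i. coeff P i \<in> polys_on (V - {w})) \<and> poly P (poly_var w) = p"
proof -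
  define red where "red m = m - Poly_Mapping.single w (Poly_Mapping.lookup m w)" for m :: "'a \<Rightarrow>\<^sub>0 nat"
  have m: "m = red m + Poly_Mapping.single w (Poly_Mapping.lookup m w)" for m
    by (rule poly_mapping_eqI) (auto simp: red_def lookup_add lookup_minus lookup_single when_def)
  have keys: "Poly_Mapping.keys (red m) = Poly_Mapping.keys m - {w}" for m
    by (auto simp: red_def in_keys_iff lookup_minus lookup_single when_def split: if_splits)
  define P where "P = (\<Sum>m\<in>Poly_Mapping.keys p.
    monom (Poly_Mapping.single (red m) (Poly_Mapping.lookup p m)) (Poly_Mapping.lookup m w))"
  have "poly P (poly_var w) = (\<Sum>m\<in>Poly_Mapping.keys p. Poly_Mapping.single m (Poly_Mapping.lookup p m))"
    unfolding P_def poly_sum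
    by (intro sum.cong refl) (simp add: poly_monom poly_var_power mult_single m[symmetric])
  then have "poly P (poly_var w) = p"
    using mpoly_sum_monomials[of p] by simp
  moreover have "coeff P i \<in> polys_on (V - {w})" for i
    unfolding P_def coeff_sum
  proof (rule polys_on_sum)
    fix m assume "m \<in> Poly_Mapping.keys p"
    then have "Poly_Mapping.single (red m) (Poly_Mapping.lookup p m) \<in> polys_on (V - {w})"
      using assms by (auto simp: polys_on_def keys)
    then show "coeff (monom (Poly_Mapping.single (red m) (Poly_Mapping.lookup p m))
        (Poly_Mapping.lookup m w)) i \<in> polys_on (V - {w})" by simp
  qed
  ultimately show ?thesis by blast
qed

lemma poly_eval_update:
  assumes "\<And>i. coeff P i \<in> polys_on (- {w})"
  shows "poly_eval (poly P (poly_var w)) (x(w := z)) = poly (map_poly (\<lambda>c. poly_eval c x) P) z"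
proof -
  have "map_poly (\<lambda>c. poly_eval c (x(w := z))) P = map_poly (\<lambda>c. poly_eval c x) P"
    by (rule poly_eqI) (simp add: coeff_map_poly, rule poly_eval_cong[OF assms], auto)
  then show ?thesis by (simp add: poly_eval_poly)
qed

text \<open>Only the line through \<open>x\<close> in direction \<open>w\<close> is used, so the
  lemma also applies at a point of a set that is invariant under changing the coordinate
  \<open>w\<close>; a univariate complex polynomial that vanishes identically has zero
  coefficients.\<close>

lemma poly_eval_coeff_0:
  assumes "\<And>i. coeff P i \<in> polys_on (- {w})" "\<And>z. poly_eval (poly P (poly_var w)) (x(w := z)) = 0"
  shows "poly_eval (coeff P i) x = 0"
proof -
  have "poly (map_poly (\<lambda>c. poly_eval c x) P) z = 0" for z
    using assms(2)[of z] by (simp only: poly_eval_update[OF assms(1)])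
  then have "map_poly (\<lambda>c. poly_eval c x) P = 0" using poly_all_0_iff_0 by blast
  then show ?thesis by (metis coeff_0 coeff_map_poly poly_eval_0)
qed

lemma poly_identity_finite:
  assumes "finite V" "p \<in> polys_on V" "\<And>x. poly_eval p x = 0"
  shows "p = 0"
  using assms
proof (induction V arbitrary: p rule: finite_induct)
  case empty
  then show ?case by (metis polys_on_empty poly_eval_const const_poly_0)
next
  case (insert w V)
  obtain P where P: "\<And>i. coeff P i \<in> polys_on V" "poly P (poly_var w) = p"
    using ex_as_poly[OF insert.prems(1), of w] insert.hyps(2) by auto
  have "coeff P i = 0" for i
  proof (rule insert.IH[OF P(1)])
    show "poly_eval (coeff P i) x = 0" for x
      using P insert.prems(2) insert.hyps(2)
      by (intro poly_eval_coeff_0[of P w]) (auto intro: polys_on_mono)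
  qed
  then have "P = 0" by (simp add: poly_eqI)
  with P(2) show ?case by simp
qed

lemma poly_identity: "(\<And>x. poly_eval p x = 0) \<Longrightarrow> p = 0"
  using ex_finite_polys_on poly_identity_finite by metis

lemma mpoly_eqI: "(\<And>x. poly_eval p x = poly_eval q x) \<Longrightarrow> p = q"
  using poly_identity[of "p - q"] by (simp add: poly_eval_diff)

lemma as_poly_unique:
  assumes "\<And>i. coeff P i \<in> polys_on (- {w})" "poly P (poly_var w) = 0"
  shows "P = 0"
proof -
  have "coeff P i = 0" for i
    by (rule poly_identity) (use assms poly_eval_coeff_0[of P w] in auto)
  then show ?thesis by (simp add: poly_eqI)
qed

text \<open>The restriction on the coefficients makes the representation unique; without it
  \<open>[:p:]\<close> would qualify as well.\<close>

definition as_poly :: "'v \<Rightarrow> 'v mpoly \<Rightarrow> 'v mpoly poly" where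
  "as_poly w p = (THE P. (\<forall>i. coeff P i \<in> polys_on (- {w})) \<and> poly P (poly_var w) = p)"

definition deg_in :: "'v \<Rightarrow> 'v mpoly \<Rightarrow> nat" where
  "deg_in w p = degree (as_poly w p)"

lemma as_poly_eqI:
  assumes "\<And>i. coeff P i \<in> polys_on (- {w})" "poly P (poly_var w) = p"
  shows "as_poly w p = P"
  unfolding as_poly_def
proof (rule the_equality)
  fix Q assume Q: "(\<forall>i. coeff Q i \<in> polys_on (- {w})) \<and> poly Q (poly_var w) = p"
  have "Q - P = 0"
    by (rule as_poly_unique[of _ w]) (use Q assms in \<open>auto intro!: polys_on_diff\<close>)
  then show "Q = P" by simp
qed (use assms in auto)

lemma as_poly_coeff:
  assumes "p \<in> polys_on V"
  shows "coeff (as_poly w p) i \<in> polys_on (V - {w})"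
proof -
  obtain P where P: "\<And>i. coeff P i \<in> polys_on (V - {w})" "poly P (poly_var w) = p"
    using ex_as_poly[OF assms] by metis
  moreover have "as_poly w p = P"
    by (rule as_poly_eqI) (use P in \<open>auto intro: polys_on_mono\<close>)
  ultimately show ?thesis by simp
qed

lemma as_poly_coeff_free: "coeff (as_poly w p) i \<in> polys_on (- {w})"
  using as_poly_coeff[of p UNIV] by (simp add: Compl_eq_Diff_UNIV)

lemma poly_as_poly [simp]: "poly (as_poly w p) (poly_var w) = p"
proof -
  obtain P where P: "\<And>i. coeff P i \<in> polys_on (UNIV - {w})" "poly P (poly_var w) = p"
    using ex_as_poly[of p UNIV] by auto
  then have "as_poly w p = P" by (intro as_poly_eqI) (auto simp: Compl_eq_Diff_UNIV)
  with P show ?thesis by simp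
qed

lemma as_poly_free: "p \<in> polys_on (- {w}) \<Longrightarrow> as_poly w p = [:p:]"
  by (rule as_poly_eqI) (auto simp: coeff_pCons split: nat.splits)

lemma as_poly_0 [simp]: "as_poly w 0 = 0"
  by (simp add: as_poly_free)

lemma as_poly_eq_0_iff [simp]: "as_poly w p = 0 \<longleftrightarrow> p = 0"
  by (metis as_poly_0 poly_as_poly poly_0)

lemma as_poly_diff: "as_poly w (p - q) = as_poly w p - as_poly w q"
  by (rule as_poly_eqI) (auto intro: polys_on_diff as_poly_coeff_free)

lemma as_poly_mult: "as_poly w (p * q) = as_poly w p * as_poly w q"
  by (rule as_poly_eqI) (auto simp: coeff_mult intro!: polys_on_sum polys_on_mult as_poly_coeff_free)

lemma as_poly_var_power_mult: "p \<in> polys_on (- {w}) \<Longrightarrow> as_poly w (p * poly_var w ^ n) = monom p n"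
  by (rule as_poly_eqI) (auto simp: poly_monom)

lemma deg_in_free: "p \<in> polys_on (- {w}) \<Longrightarrow> deg_in w p = 0"
  by (simp add: deg_in_def as_poly_free)

lemma deg_in_0_imp: "deg_in w p = 0 \<Longrightarrow> p \<in> polys_on V \<Longrightarrow> p \<in> polys_on (V - {w})"
proof -
  assume "deg_in w p = 0" and p: "p \<in> polys_on V"
  then obtain c where c: "as_poly w p = [:c:]" unfolding deg_in_def by (auto elim: degree_eq_zeroE)
  then have "p = c" using poly_as_poly[of w p] by simp
  with c as_poly_coeff[OF p, of w 0] show ?thesis by simp
qed

text \<open>Induction on the variables: the leading coefficients with respect to \<open>w\<close>
  involve fewer variables, and their product is a coefficient of the zero product.\<close>

lemma mpoly_no_zero_divisors_finite:
  assumes "finite V" "p \<in> polys_on V" "q \<in> polys_on V" "p * q = 0"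
  shows "p = 0 \<or> q = 0"
  using assms
proof (induction V arbitrary: p q rule: finite_induct)
  case empty
  then obtain a b where "p = const_poly a" "q = const_poly b" by (metis polys_on_empty)
  with empty show ?case by (auto simp: const_poly_mult[symmetric])
next
  case (insert w V)
  let ?P = "as_poly w p" and ?Q = "as_poly w q"
  have "?P * ?Q = 0" using insert.prems(3) by (simp add: as_poly_mult[symmetric])
  then have "lead_coeff ?P * lead_coeff ?Q = 0"
    by (metis coeff_0 coeff_mult_degree_sum)
  then have "lead_coeff ?P = 0 \<or> lead_coeff ?Q = 0"
    using insert.hyps(2) as_poly_coeff[OF insert.prems(1), of w] as_poly_coeff[OF insert.prems(2), of w]
    by (intro insert.IH) auto
  then show ?case by simp
qed

lemma mpoly_mult_eq_0_iff [simp]: "p * q = 0 \<longleftrightarrow> p = 0 \<or> q = 0" for p q :: "'v mpoly"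
  using ex_finite_polys_on2[of p q] mpoly_no_zero_divisors_finite[of _ p q] by auto

lemma mpoly_mult_cancel: "p * q = p * r \<longleftrightarrow> p = 0 \<or> q = r" for p q r :: "'v mpoly"
  using mpoly_mult_eq_0_iff[of p "q - r"] by (auto simp: right_diff_distrib)

lemma mpoly_prod_eq_0_iff: "finite S \<Longrightarrow> prod f S = 0 \<longleftrightarrow> (\<exists>s\<in>S. f s = (0 :: 'v mpoly))"
  by (induction S rule: finite_induct) auto

lemma mpoly_power_eq_0_iff [simp]: "p ^ n = 0 \<longleftrightarrow> p = 0 \<and> n \<noteq> 0" for p :: "'v mpoly"
  by (induction n) auto

lemma mpoly_poly_mult_lead:
  fixes P Q :: "'v mpoly poly"
  assumes "P \<noteq> 0" "Q \<noteq> 0"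
  shows "degree (P * Q) = degree P + degree Q" "P * Q \<noteq> 0"
proof -
  have "coeff (P * Q) (degree P + degree Q) \<noteq> 0"
    using assms by (simp add: coeff_mult_degree_sum)
  then show "P * Q \<noteq> 0" "degree (P * Q) = degree P + degree Q"
    by (auto intro!: antisym degree_mult_le le_degree)
qed

lemma deg_in_mult:
  assumes "p \<noteq> 0" "q \<noteq> 0"
  shows "deg_in w (p * q) = deg_in w p + deg_in w q"
  unfolding deg_in_def as_poly_mult by (rule mpoly_poly_mult_lead) (use assms in auto)

lemma factor_in_polys_on:
  assumes "p * q \<in> polys_on V" "p * q \<noteq> 0"
  shows "p \<in> polys_on V"
proof -
  obtain W where W: "finite W" "p \<in> polys_on W" using ex_finite_polys_on by metis
  have free: "p \<in> polys_on (U - {w})" if "p \<in> polys_on U" "w \<notin> V" for U w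
  proof -
    have "p * q \<in> polys_on (- {w})" using assms(1) by (rule polys_on_mono) (use that in auto)
    then have "deg_in w (p * q) = 0" by (rule deg_in_free)
    then show ?thesis using assms(2) that(1) by (intro deg_in_0_imp) (auto simp: deg_in_mult)
  qed
  have "p \<in> polys_on (W - F)" if "finite F" "F \<inter> V = {}" for F
    using that
  proof (induction F rule: finite_induct)
    case (insert x F)
    then have "p \<in> polys_on (W - F - {x})" by (intro free) auto
    then show ?case by (simp add: Diff_insert[symmetric])
  qed (use W in simp)
  from this[of "W - V"] show ?thesis using W by (auto intro: polys_on_mono)
qed

lemma dvd_in_polys_on: "p dvd q \<Longrightarrow> q \<in> polys_on V \<Longrightarrow> q \<noteq> 0 \<Longrightarrow> p \<in> polys_on V"
  by (auto simp: dvd_def intro: factor_in_polys_on)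

lemma mpoly_unit_iff: "p dvd 1 \<longleftrightarrow> (\<exists>c. c \<noteq> 0 \<and> p = const_poly c)"
proof
  assume "p dvd 1"
  then have "p \<in> polys_on {}" by (rule dvd_in_polys_on) auto
  then show "\<exists>c. c \<noteq> 0 \<and> p = const_poly c"
    using polys_on_empty \<open>p dvd 1\<close> by (metis const_poly_0 dvd_0_left zero_neq_one)
qed (auto intro: const_poly_unit)

lemma nonconst_deg_in_pos:
  assumes "p \<noteq> 0" "\<not> p dvd 1" "p \<in> polys_on V" "finite V"
  shows "\<exists>w\<in>V. deg_in w p > 0"
proof (rule ccontr)
  assume none: "\<not> ?thesis"
  have "p \<in> polys_on (V - F)" if "finite F" "F \<subseteq> V" for F
    using that
  proof (induction F rule: finite_induct)
    case (insert x F)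
    then have "p \<in> polys_on (V - F - {x})" using none by (intro deg_in_0_imp) auto
    then show ?case by (simp add: Diff_insert[symmetric])
  qed (use assms in simp)
  from this[of V] have "p \<in> polys_on {}" using assms by simp
  then obtain c where "p = const_poly c" using polys_on_empty by blast
  with assms show False by (auto simp: mpoly_unit_iff)
qed

section \<open>Unique factorisation and the Nullstellensatz for hypersurfaces\<close>

text \<open>The leading coefficient \<open>lc\<close> cannot be inverted, so every cancellation of
  the top term of \<open>f\<close> costs one factor \<open>lc\<close>; \<open>n\<close> counts the
  cancellations.\<close>

lemma pseudo_division:
  fixes d f :: "'v mpoly" and w :: 'v
  defines "lc \<equiv> lead_coeff (as_poly w d)"
  assumes "d \<noteq> 0" "d \<in> polys_on V" "f \<in> polys_on V" "w \<in> V"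
  shows "\<exists>n q r. lc ^ n * f = q * d + r \<and> q \<in> polys_on V \<and> r \<in> polys_on V \<and>
    (r = 0 \<or> deg_in w r < deg_in w d)"
  using assms(4)
proof (induction "deg_in w f" arbitrary: f rule: less_induct)
  case less
  show ?case
  proof (cases "f = 0 \<or> deg_in w f < deg_in w d")
    case True
    then show ?thesis using less.prems by (intro exI[of _ 0] exI[of _ f]) auto
  next
    case False
    let ?F = "as_poly w f" and ?D = "as_poly w d"
    define k where "k = deg_in w f - deg_in w d"
    define g where "g = lead_coeff ?F * poly_var w ^ k"
    define f' where "f' = lc * f - g * d"
    have lc: "lc \<in> polys_on (V - {w})" and lf: "lead_coeff ?F \<in> polys_on (V - {w})"
      unfolding lc_def by (intro as_poly_coeff assms less.prems)+
    then have lc': "lc \<in> polys_on V" "lead_coeff ?F \<in> polys_on V" by (auto intro: polys_on_mono)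
    then have g: "g \<in> polys_on V"
      unfolding g_def using assms by (intro polys_on_mult polys_on_power) auto
    then have f': "f' \<in> polys_on V"
      unfolding f'_def using lc' assms less.prems by (intro polys_on_diff polys_on_mult) auto
    have "as_poly w lc = [:lc:]"
      by (rule as_poly_free) (use lc in \<open>auto intro: polys_on_mono\<close>)
    moreover have "as_poly w g = monom (lead_coeff ?F) k"
      unfolding g_def by (rule as_poly_var_power_mult) (rule as_poly_coeff_free)
    ultimately have F': "as_poly w f' = smult lc ?F - monom (lead_coeff ?F) k * ?D"
      by (simp add: f'_def as_poly_diff as_poly_mult)
    have "coeff (as_poly w f') i = 0" if "i \<ge> deg_in w f" for i
    proof (cases "i = deg_in w f")
      case True
      then have "i - k = degree ?D" "k \<le> i" using False by (auto simp: k_def deg_in_def)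
      then show ?thesis
        using True by (simp add: F' coeff_monom_mult lc_def deg_in_def mult.commute[of "lead_coeff ?D"])
    next
      case False': False
      with that False have "i > degree ?F" "i - k > degree ?D" by (auto simp: k_def deg_in_def)
      then show ?thesis by (simp add: F' coeff_monom_mult coeff_eq_0)
    qed
    then have "f' = 0 \<or> deg_in w f' < deg_in w f"
      using leading_coeff_0_iff[of "as_poly w f'"] unfolding deg_in_def
        by (metis as_poly_eq_0_iff not_le)
    then have "\<exists>n q r. lc ^ n * f' = q * d + r \<and> q \<in> polys_on V \<and> r \<in> polys_on V \<and>
      (r = 0 \<or> deg_in w r < deg_in w d)"
    proof
      assume "f' = 0"
      then show ?thesis by (intro exI[of _ 0]) auto
    qed (use less.hyps f' in blast)
    then obtain n q r where *: "lc ^ n * f' = q * d + r" "q \<in> polys_on V" "r \<in> polys_on V"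
      "r = 0 \<or> deg_in w r < deg_in w d" by blast
    have "lc ^ Suc n * f = (q + lc ^ n * g) * d + r"
      using *(1) by (simp add: f'_def algebra_simps)
    moreover have "q + lc ^ n * g \<in> polys_on V"
      using * lc' g by (intro polys_on_add polys_on_mult polys_on_power)
    ultimately show ?thesis using * by blast
  qed
qed

text \<open>The existence part of factorisation, as an induction rule that peels off one irreducible
  factor at a time. It terminates because the sum of the degrees in the finitely many variables
  strictly drops from a product of two non-units to either factor.\<close>

lemma mpoly_irreducible_decomp [consumes 1, case_names unit mult]:
  fixes p :: "'v mpoly"
  assumes "p \<noteq> 0"
    and unit: "\<And>u. u dvd 1 \<Longrightarrow> Q u"
    and mult: "\<And>q r. irreducible q \<Longrightarrow> r \<noteq> 0 \<Longrightarrow> Q r \<Longrightarrow> Q (q * r)"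
  shows "Q p"
proof -
  obtain V where V: "finite V" "p \<in> polys_on V" using ex_finite_polys_on by metis
  define \<delta> where "\<delta> p = (\<Sum>v\<in>V. deg_in v p)" for p :: "'v mpoly"
  have \<delta>_less: "\<delta> a < \<delta> (a * b)" "\<delta> b < \<delta> (a * b)"
    if "a * b \<in> polys_on V" "a * b \<noteq> 0" "\<not> a dvd 1" "\<not> b dvd 1" for a b
  proof -
    have "a \<in> polys_on V" "b \<in> polys_on V"
      using that factor_in_polys_on[of a b] factor_in_polys_on[of b a] by (auto simp: mult.commute)
    then have "\<exists>w\<in>V. deg_in w a > 0" "\<exists>w\<in>V. deg_in w b > 0"
      using that V by (auto intro!: nonconst_deg_in_pos)
    then have "\<delta> a > 0" "\<delta> b > 0" using V(1) by (auto simp: \<delta>_def sum_pos2)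
    moreover have "\<delta> (a * b) = \<delta> a + \<delta> b"
      using that by (simp add: \<delta>_def deg_in_mult sum.distrib)
    ultimately show "\<delta> a < \<delta> (a * b)" "\<delta> b < \<delta> (a * b)" by auto
  qed
  have ex_irr: "\<exists>q r. irreducible q \<and> a = q * r" if "a \<in> polys_on V" "a \<noteq> 0" "\<not> a dvd 1" for a
    using that
  proof (induction "\<delta> a" arbitrary: a rule: less_induct)
    case less
    show ?case
    proof (cases "irreducible a")
      case True
      then show ?thesis by (intro exI[of _ a] exI[of _ 1]) auto
    next
      case False
      then obtain b c where bc: "a = b * c" "\<not> b dvd 1" "\<not> c dvd 1"
        using less.prems by (auto simp: irreducible_def)
      then have "\<exists>q r. irreducible q \<and> b = q * r"
        using less.prems \<delta>_less(1) factor_in_polys_on[of b c] by (intro less.hyps) auto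
      then show ?thesis using bc(1) by (metis mult.assoc)
    qed
  qed
  show ?thesis using V(2) assms(1)
  proof (induction "\<delta> p" arbitrary: p rule: less_induct)
    case less
    show ?case
    proof (cases "p dvd 1")
      case False
      then obtain q r where qr: "irreducible q" "p = q * r" using ex_irr less.prems by blast
      have r: "r \<in> polys_on V" "r \<noteq> 0"
        using factor_in_polys_on[of r q V] less.prems qr(2) by (auto simp: mult.commute)
      have "Q r"
      proof (cases "r dvd 1")
        case False
        then have "\<delta> r < \<delta> p"
          using \<delta>_less(2)[of q r] less.prems qr by (auto simp: irreducible_def)
        then show ?thesis using less.hyps r by blast
      qed (rule unit)
      then show ?thesis using mult qr r by simp
    qed (rule unit)
  qed
qed

text \<open>Relative to a set of variables, so that it can serve as the induction hypothesis when a
  variable is added.\<close>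

definition primes_on :: "'v set \<Rightarrow> bool" where
  "primes_on V \<longleftrightarrow> (\<forall>p\<in>polys_on V. irreducible p \<longrightarrow>
     (\<forall>a\<in>polys_on V. \<forall>b\<in>polys_on V. p dvd a * b \<longrightarrow> p dvd a \<or> p dvd b))"

lemma primes_onD:
  "primes_on V \<Longrightarrow> irreducible p \<Longrightarrow> p \<in> polys_on V \<Longrightarrow> a \<in> polys_on V \<Longrightarrow> b \<in> polys_on V
    \<Longrightarrow> p dvd a * b \<Longrightarrow> p dvd a \<or> p dvd b"
  unfolding primes_on_def by blast

lemma free_dvd_iff:
  assumes "p \<in> polys_on (- {w})"
  shows "p dvd f \<longleftrightarrow> (\<forall>i. p dvd coeff (as_poly w f) i)"
proof
  assume "p dvd f"
  then obtain e where "f = p * e" by (rule dvdE)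
  then have "as_poly w f = [:p:] * as_poly w e" using assms by (simp add: as_poly_mult as_poly_free)
  then show "\<forall>i. p dvd coeff (as_poly w f) i" by simp
next
  assume "\<forall>i. p dvd coeff (as_poly w f) i"
  then have "\<forall>i. \<exists>e. coeff (as_poly w f) i = p * e" by (simp add: dvd_def)
  from choice[OF this] obtain e where e: "\<And>i. coeff (as_poly w f) i = p * e i" by blast
  have "(\<Sum>i\<le>deg_in w f. monom (coeff (as_poly w f) i) i) = as_poly w f"
    unfolding deg_in_def by (rule poly_as_sum_of_monoms)
  moreover have "(\<Sum>i\<le>deg_in w f. monom (coeff (as_poly w f) i) i) = [:p:]
      * (\<Sum>i\<le>deg_in w f. monom (e i) i)"
    (is "_ = _ * ?E") by (simp add: e sum_distrib_left smult_monom)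
  ultimately have "as_poly w f = [:p:] * ?E" by metis
  then have "f = p * poly ?E (poly_var w)" using poly_as_poly[of w f] by simp
  then show "p dvd f" by (rule dvdI)
qed

text \<open>Gauss's argument: if \<open>p\<close> divides neither factor, take in each the lowest
  coefficient, \<open>i\<close> and \<open>j\<close>, not divisible by \<open>p\<close>. In the
  coefficient \<open>i + j\<close> of the product every other summand is divisible by
  \<open>p\<close>.\<close>

lemma prime_lift:
  assumes V: "primes_on V" "w \<notin> V" and p: "irreducible p" "p \<in> polys_on V"
    and ab: "a \<in> polys_on (insert w V)" "b \<in> polys_on (insert w V)" "p dvd a * b"
  shows "p dvd a \<or> p dvd b"
proof (rule ccontr)
  assume contra: "\<not> ?thesis"
  let ?A = "as_poly w a" and ?B = "as_poly w b"
  have pw: "p \<in> polys_on (- {w})" using p V by (auto intro: polys_on_mono)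
  have VV: "insert w V - {w} = V" using V by auto
  have coeffs: "coeff ?A i \<in> polys_on V" "coeff ?B i \<in> polys_on V" for i
    using as_poly_coeff[OF ab(1), of w] as_poly_coeff[OF ab(2), of w] by (simp_all only: VV)
  define i where "i = (LEAST i. \<not> p dvd coeff ?A i)"
  define j where "j = (LEAST j. \<not> p dvd coeff ?B j)"
  have ex: "\<exists>i. \<not> p dvd coeff ?A i" "\<exists>j. \<not> p dvd coeff ?B j"
    using contra free_dvd_iff[OF pw] by blast+
  have i: "\<not> p dvd coeff ?A i" unfolding i_def by (rule LeastI_ex[OF ex(1)])
  have i': "p dvd coeff ?A k" if "k < i" for k
    by (rule ccontr) (use that Least_le[of "\<lambda>i. \<not> p dvd coeff ?A i" k] in \<open>simp add: i_def\<close>)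
  have j: "\<not> p dvd coeff ?B j" unfolding j_def by (rule LeastI_ex[OF ex(2)])
  have j': "p dvd coeff ?B k" if "k < j" for k
    by (rule ccontr) (use that Least_le[of "\<lambda>i. \<not> p dvd coeff ?B i" k] in \<open>simp add: j_def\<close>)
  have "p dvd coeff (?A * ?B) (i + j)"
    using ab(3) free_dvd_iff[OF pw, of "a * b"] by (simp only: as_poly_mult)
  moreover have "coeff (?A * ?B) (i + j) = coeff ?A i * coeff ?B j
      + (\<Sum>k\<in>{..i + j} - {i}. coeff ?A k * coeff ?B (i + j - k))"
    by (simp add: coeff_mult sum.remove[of "{..i + j}" i])
  moreover have "p dvd (\<Sum>k\<in>{..i + j} - {i}. coeff ?A k * coeff ?B (i + j - k))"
  proof (rule dvd_sum)
    fix k assume "k \<in> {..i + j} - {i}"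
    then consider "k < i" | "i + j - k < j" by fastforce
    then show "p dvd coeff ?A k * coeff ?B (i + j - k)"
      by cases (simp_all add: i' j')
  qed
  ultimately have "p dvd coeff ?A i * coeff ?B j"
    by (simp only: dvd_add_left_iff)
  then show False using primes_onD[OF V(1) p coeffs(1)[of i] coeffs(2)[of j]] i j by simp
qed

lemma irreducible_dvd_unit_or:
  "irreducible (p :: 'v mpoly) \<Longrightarrow> p = a * b \<Longrightarrow> a dvd 1 \<or> b dvd 1"
  by (auto simp: irreducible_def)

lemma irreducible_dvd_sym:
  fixes p q :: "'v mpoly"
  assumes "irreducible p" "irreducible q" "p dvd q"
  shows "q dvd p"
proof -
  obtain c where c: "q = p * c" using assms(3) by (rule dvdE)
  then have "c dvd 1" using assms by (auto simp: irreducible_def)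
  then obtain d where "1 = c * d" by (rule dvdE)
  then have "p = q * d" using c by (metis mult.assoc mult_1_right)
  then show ?thesis by simp
qed

text \<open>A factor \<open>a\<close> not involving \<open>w\<close> can be cancelled from \<open>a * f = q * d\<close>
  because the irreducible factors of \<open>a\<close> are prime and do not divide a polynomial
  that is irreducible and involves \<open>w\<close>.\<close>

lemma cancel_free:
  assumes V: "primes_on V" "w \<notin> V" and G: "irreducible G" "G \<in> polys_on (insert w V)" "deg_in w G > 0"
    and a: "a \<in> polys_on V" "a \<noteq> 0" and F: "F \<in> polys_on (insert w V)"
  shows "G dvd a * F \<Longrightarrow> G dvd F"
    and "a * G = q * F \<Longrightarrow> deg_in w F > 0 \<Longrightarrow> G dvd F"
proof -
  have not_dvd: "\<not> p dvd G" if p: "irreducible p" "p \<in> polys_on V" for p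
  proof
    assume "p dvd G"
    then obtain e where "G * e = p" using irreducible_dvd_sym[OF p(1) G(1)] by (metis dvdE)
    moreover have "deg_in w p = 0" using p V by (intro deg_in_free) (auto intro: polys_on_mono)
    ultimately show False
      using G(3) p deg_in_mult[of G e w] by (auto simp: irreducible_def)
  qed
  have "G dvd F" if "G * e = a * F" for e
    using a(2) that a(1) F
  proof (induction arbitrary: e rule: mpoly_irreducible_decomp)
    case (unit u)
    from unit(1) obtain v where "1 = u * v" by (rule dvdE)
    then have "F = (u * v) * F" by simp
    also have "\<dots> = v * (G * e)" by (simp only: unit(2) mult_ac)
    finally have "F = G * (e * v)" by (simp only: mult_ac)
    then show ?case by simp
  next
    case (mult p r)
    then have pr: "p \<in> polys_on V" "r \<in> polys_on V"
      using factor_in_polys_on[of p r V] factor_in_polys_on[of r p V]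
      by (auto simp: mult.commute irreducible_def)
    show ?case
    proof (cases "F = 0")
      case False
      then have ne: "G * e \<noteq> 0" using mult by (auto simp: irreducible_def)
      have "p * r * F \<in> polys_on (insert w V)"
        using pr mult.prems(3) by (auto intro!: polys_on_mult intro: polys_on_mono)
      then have "e * G \<in> polys_on (insert w V)" using mult.prems(1) by (simp add: mult.commute)
      then have e: "e \<in> polys_on (insert w V)"
        by (rule factor_in_polys_on) (use ne in auto)
      have "p dvd G * e" using mult.prems by simp
      then have "p dvd e" using prime_lift[OF V mult(1) pr(1) G(2) e] not_dvd mult(1) pr(1) by blast
      then obtain e' where "e = p * e'" by (rule dvdE)
      then have "p * (G * e') = p * (r * F)" using mult.prems by (simp add: ac_simps)
      then have "G * e' = r * F" using mult(1) by (auto simp: mpoly_mult_cancel irreducible_def)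
      then show ?thesis using mult.IH pr mult.prems by blast
    qed auto
  qed
  then show "G dvd a * F \<Longrightarrow> G dvd F" by (metis dvdE)
  \<comment> \<open>Each irreducible factor of \<open>a\<close> is removed from \<open>q\<close> or
    from \<open>F\<close>. The latter keeps the degree of \<open>F\<close> in \<open>w\<close>, so
    what remains of \<open>F\<close> in the end is a non-unit divisor of \<open>G\<close> and hence
    associated with it.\<close>
  have "G dvd F" if "a * G = q * F" "deg_in w F > 0" for q
    using a(2) that a(1) F
  proof (induction arbitrary: q F rule: mpoly_irreducible_decomp)
    case (unit u)
    from unit(1) obtain v where "1 = u * v" by (rule dvdE)
    then have "G = (u * v) * G" by simp
    then have "G = v * (u * G)" by (simp only: mult_ac)
    then have GF: "G = (v * q) * F" using unit(2) by (simp add: mult.assoc)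
    moreover have "\<not> F dvd 1"
      using unit by (auto simp: mpoly_unit_iff deg_in_free)
    ultimately have "v * q dvd 1" using irreducible_dvd_unit_or[OF G(1)] by blast
    then obtain z where "1 = v * q * z" by (rule dvdE)
    then have "F = (v * q * z) * F" by simp
    also have "\<dots> = G * z" by (subst GF) (simp only: mult_ac)
    finally have "F = G * z" .
    then show ?case by simp
  next
    case (mult p r)
    have p0: "p \<noteq> 0" using mult by auto
    then have pr: "p \<in> polys_on V" "r \<in> polys_on V"
      using mult factor_in_polys_on[of p r V] factor_in_polys_on[of r p V]
      by (auto simp: mult.commute)
    have nz: "p * r * G \<noteq> 0" using p0 mult(2) G(1) by auto
    have "p * r * G \<in> polys_on (insert w V)"
      using pr G by (auto intro!: polys_on_mult intro: polys_on_mono)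
    then have q: "q \<in> polys_on (insert w V)"
      using mult.prems(1) nz factor_in_polys_on[of q F] by auto
    have "p dvd q * F" using mult.prems(1) by (metis dvd_triv_left mult.assoc)
    then consider "p dvd q" | "p dvd F" using prime_lift[OF V mult(1) pr(1) q mult.prems(4)] by blast
    then show ?case
    proof cases
      case 1
      then obtain q' where "q = p * q'" by (rule dvdE)
      then have "p * (r * G) = p * (q' * F)" using mult.prems by (simp add: ac_simps)
      then have "r * G = q' * F" using p0 by (auto simp: mpoly_mult_cancel)
      then show ?thesis using mult.IH[of q' F] pr mult.prems by blast
    next
      case 2
      then obtain F' where F': "F = p * F'" by (rule dvdE)
      then have "p * (r * G) = p * (q * F')" using mult.prems by (simp add: ac_simps)
      then have "r * G = q * F'" using p0 by (auto simp: mpoly_mult_cancel)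
      moreover have "F' \<noteq> 0" using mult.prems F' nz by auto
      moreover have "deg_in w p = 0" using pr V by (intro deg_in_free) (auto intro: polys_on_mono)
      ultimately have "G dvd F'"
        using mult.IH[of q F'] pr mult.prems F' p0 factor_in_polys_on[of F' p]
        by (auto simp: deg_in_mult mult.commute)
      then show ?thesis using F' by simp
    qed
  qed
  then show "a * G = q * F \<Longrightarrow> deg_in w F > 0 \<Longrightarrow> G dvd F" by blast
qed

text \<open>Elimination of \<open>w\<close>: an element of minimal degree in the ideal of \<open>G\<close> and \<open>F\<close> that
  still involves \<open>w\<close> would be a common divisor, by pseudo-division.\<close>

lemma eliminate:
  assumes V: "primes_on V" "w \<notin> V" and G: "irreducible G" "G \<in> polys_on (insert w V)" "deg_in w G > 0"
    and F: "F \<in> polys_on (insert w V)" "\<not> G dvd F"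
  shows "\<exists>u v d. d = u * G + v * F \<and> d \<noteq> 0 \<and> d \<in> polys_on V"
proof -
  define M where "M = {u * G + v * F | u v. u \<in> polys_on (insert w V) \<and> v \<in> polys_on (insert w V)}"
  have MG: "G \<in> M" unfolding M_def using F
    by (intro CollectI exI[of _ 1] exI[of _ 0]) auto
  have MF: "F \<in> M" unfolding M_def using F
    by (intro CollectI exI[of _ 0] exI[of _ 1]) auto
  have MW: "m \<in> polys_on (insert w V)" if "m \<in> M" for m
    using that F G unfolding M_def by (auto intro!: polys_on_add polys_on_mult)
  have Mcomb: "a * m - b * n \<in> M" if m: "m \<in> M" and n: "n \<in> M"
    and ab: "a \<in> polys_on (insert w V)" "b \<in> polys_on (insert w V)" for a b m n
  proof -
    obtain u v u' v' where uv: "m = u * G + v * F" "n = u' * G + v' * F"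
      "u \<in> polys_on (insert w V)" "v \<in> polys_on (insert w V)"
      "u' \<in> polys_on (insert w V)" "v' \<in> polys_on (insert w V)"
      using m n unfolding M_def by blast
    show ?thesis
      unfolding M_def
      by (rule CollectI, rule exI[of _ "a * u - b * u'"], rule exI[of _ "a * v - b * v'"])
        (use uv ab in \<open>auto simp: algebra_simps intro!: polys_on_diff polys_on_mult\<close>)
  qed
  have G0: "G \<noteq> 0" using G by auto
  obtain d where d: "d \<in> M" "d \<noteq> 0" and min: "\<And>m. m \<in> M \<Longrightarrow> m \<noteq> 0 \<Longrightarrow> deg_in w d \<le> deg_in w m"
    using ex_has_least_nat[of "\<lambda>m. m \<in> M \<and> m \<noteq> 0" G "deg_in w"] MG G0 by blast
  have VV: "insert w V - {w} = V" using V by auto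
  have "deg_in w d = 0"
  proof (rule ccontr)
    assume pos: "deg_in w d \<noteq> 0"
    define lc where "lc = lead_coeff (as_poly w d)"
    have lc: "lc \<in> polys_on V" "lc \<noteq> 0"
      using as_poly_coeff[OF MW[OF d(1)], of w] d(2) unfolding lc_def VV by auto
    have div: "\<exists>a q. a \<in> polys_on V \<and> a \<noteq> 0 \<and> a * f = q * d" if f: "f \<in> M" for f
    proof -
      obtain n q r where nqr: "lc ^ n * f = q * d + r" "q \<in> polys_on (insert w V)"
        "r \<in> polys_on (insert w V)" "r = 0 \<or> deg_in w r < deg_in w d"
        using pseudo_division[OF d(2) MW[OF d(1)] MW[OF f], of w] unfolding lc_def by blast
      have "lc ^ n \<in> polys_on V" using lc by (intro polys_on_power)
      moreover from this have "lc ^ n * f - q * d \<in> M"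
        using f d nqr by (intro Mcomb) (auto intro: polys_on_mono)
      then have "r \<in> M" using nqr(1) by simp
      then have "r = 0" using nqr(4) min[of r] by (cases "r = 0") auto
      ultimately show ?thesis using nqr lc
        by (intro exI[of _ "lc ^ n"] exI[of _ q]) auto
    qed
    obtain a q where a: "a \<in> polys_on V" "a \<noteq> 0" "a * G = q * d" using div[OF MG] by blast
    then have Gd: "G dvd d" using cancel_free(2)[OF V G a(1,2) MW[OF d(1)]] pos by auto
    obtain b q' where b: "b \<in> polys_on V" "b \<noteq> 0" "b * F = q' * d" using div[OF MF] by blast
    then have "G dvd b * F" using Gd by simp
    then show False using cancel_free(1)[OF V G b(1,2) F(1)] F(2) by blast
  qed
  then have "d \<in> polys_on (insert w V - {w})" by (rule deg_in_0_imp) (rule MW[OF d(1)])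
  then show ?thesis using d unfolding M_def VV by blast
qed

text \<open>A \<open>G\<close> free of \<open>w\<close> is covered by Gauss's argument. If
  \<open>G\<close> involves \<open>w\<close> and divides neither \<open>a\<close> nor
  \<open>b\<close>, eliminating \<open>w\<close> yields non-zero \<open>d\<close> and
  \<open>d'\<close> free of \<open>w\<close> such that \<open>G\<close> divides
  \<open>d * d'\<close>, which contradicts the degrees in \<open>w\<close>.\<close>

lemma primes_on_finite: "finite V \<Longrightarrow> primes_on V"
proof (induction V rule: finite_induct)
  case empty
  have "\<not> irreducible p" if "p \<in> polys_on {}" for p :: "'a mpoly"
    using polys_on_empty[OF that] mpoly_unit_iff[of p] by (metis irreducible_def const_poly_0)
  then show ?case by (auto simp: primes_on_def)
next
  case (insert w V)
  have "G dvd a \<or> G dvd b"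
    if G: "irreducible G" "G \<in> polys_on (insert w V)"
      and ab: "a \<in> polys_on (insert w V)" "b \<in> polys_on (insert w V)" "G dvd a * b" for G a b
  proof (cases "deg_in w G > 0")
    case False
    then have "G \<in> polys_on (insert w V - {w})" using G by (intro deg_in_0_imp) auto
    then have "G \<in> polys_on V" using insert.hyps by simp
    then show ?thesis using prime_lift[OF insert.IH insert.hyps(2) G(1) _ ab] by blast
  next
    case True
    show ?thesis
    proof (rule ccontr)
      assume "\<not> ?thesis"
      then obtain u v d u' v' d' where d: "d = u * G + v * a" "d \<noteq> 0" "d \<in> polys_on V"
        and d': "d' = u' * G + v' * b" "d' \<noteq> 0" "d' \<in> polys_on V"
        using eliminate[OF insert.IH insert.hyps(2) G True] ab by metis
      have "d * d' = G * (u * (u' * G + v' * b) + v * a * u') + v * v' * (a * b)"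
        unfolding d(1) d'(1) by (simp add: algebra_simps)
      then have "G dvd d * d'" using ab(3) by simp
      then obtain e where e: "d * d' = G * e" by (rule dvdE)
      have "d * d' \<in> polys_on (- {w})"
        using d d' insert.hyps by (intro polys_on_mult) (auto intro: polys_on_mono)
      then have "deg_in w (G * e) = 0" using e deg_in_free by metis
      moreover have "G \<noteq> 0" "e \<noteq> 0" using e d d' by auto
      ultimately show False using True by (simp add: deg_in_mult)
    qed
  qed
  then show ?case unfolding primes_on_def by blast
qed

lemma mpoly_irreducible_dvd_mult:
  fixes p :: "'v mpoly"
  assumes "irreducible p" "p dvd a * b"
  shows "p dvd a \<or> p dvd b"
proof -
  obtain U where U: "finite U" "p \<in> polys_on U" using ex_finite_polys_on by metis
  obtain W where W: "finite W" "a \<in> polys_on W" "b \<in> polys_on W" using ex_finite_polys_on2 by metis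
  show ?thesis
    using primes_onD[OF primes_on_finite[of "U \<union> W"] assms(1) _ _ _ assms(2)] U W
    by (auto intro: polys_on_mono)
qed

lemma mpoly_irreducible_dvd_prod:
  fixes p :: "'v mpoly"
  assumes "irreducible p" "finite S" "p dvd prod f S"
  shows "\<exists>s\<in>S. p dvd f s"
  using assms(2,3)
proof (induction S rule: finite_induct)
  case empty
  then show ?case using assms(1) by (simp add: irreducible_def)
qed (use mpoly_irreducible_dvd_mult[OF assms(1)] in auto)

lemma mpoly_irreducible_factor:
  fixes p :: "'v mpoly"
  assumes "p \<noteq> 0" "\<not> p dvd 1"
  shows "\<exists>q. irreducible q \<and> q dvd p"
  using assms by (induction rule: mpoly_irreducible_decomp) auto

text \<open>The Nullstellensatz for one irreducible equation. If \<open>G\<close> does not divide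
  \<open>F\<close>, elimination gives a non-zero \<open>d\<close> free of \<open>w\<close> in the
  ideal of \<open>G\<close> and \<open>F\<close>. Above a point with \<open>d\<close> non-zero there
  is still a root of \<open>G\<close> in the variable \<open>w\<close>, and there \<open>d\<close>
  would have to vanish.\<close>

lemma irreducible_vanishing:
  assumes G: "irreducible G" and F: "\<And>x. poly_eval G x = 0 \<Longrightarrow> poly_eval F x = 0"
  shows "G dvd F"
proof (rule ccontr)
  assume nd: "\<not> G dvd F"
  obtain V where V: "finite V" "G \<in> polys_on V" "F \<in> polys_on V" using ex_finite_polys_on2 by metis
  have G0: "G \<noteq> 0" "\<not> G dvd 1" using G by (auto simp: irreducible_def)
  then obtain w where w: "w \<in> V" "deg_in w G > 0" using nonconst_deg_in_pos V by blast
  then have VV: "insert w (V - {w}) = V" by auto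
  obtain u v d where d: "d = u * G + v * F" "d \<noteq> 0" "d \<in> polys_on (V - {w})"
    using eliminate[OF primes_on_finite[of "V - {w}"] _ G _ w(2) _ nd] V unfolding VV by auto
  let ?P = "as_poly w G"
  have P: "coeff ?P i \<in> polys_on (V - {w})" for i using as_poly_coeff V(2) .
  \<comment> \<open>The leading coefficient of \<open>G\<close> must survive the specialisation too,
    so that the univariate polynomial keeps its positive degree and has a root.\<close>
  have "d * lead_coeff ?P \<noteq> 0" using d G0 by simp
  then obtain x where x: "poly_eval (d * lead_coeff ?P) x \<noteq> 0" using poly_identity by blast
  define p where "p = map_poly (\<lambda>c. poly_eval c x) ?P"
  have "coeff p (deg_in w G) \<noteq> 0" using x by (simp add: p_def coeff_map_poly poly_eval_mult deg_in_def)
  then have "degree p > 0" using w(2) by (meson le_degree less_le_trans)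
  then obtain z where z: "poly p z = 0"
    using Fundamental_Theorem_Algebra.fundamental_theorem_of_algebra[of p] constant_degree[of p] by auto
  have "poly_eval (poly ?P (poly_var w)) (x(w := z)) = 0"
    unfolding poly_eval_update[OF as_poly_coeff_free] using z by (simp add: p_def)
  then have Gz: "poly_eval G (x(w := z)) = 0" by simp
  then have "poly_eval d (x(w := z)) = 0" using F[OF Gz]
    by (simp add: d(1) poly_eval_add poly_eval_mult)
  moreover have "poly_eval d (x(w := z)) = poly_eval d x" by (rule poly_eval_cong[OF d(3)]) auto
  ultimately show False using x by (simp add: poly_eval_mult)
qed

section \<open>Hypersurfaces in the Zariski topology\<close>

definition vanishes_on :: "'v mpoly \<Rightarrow> ('v \<Rightarrow> complex) set \<Rightarrow> bool" where
  "vanishes_on F S \<longleftrightarrow> (\<forall>x\<in>S. poly_eval F x = 0)"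

text \<open>Irreducibility as primality of the vanishing ideal. In this form it makes sense for sets
  that are not closed and can be tested along curves.\<close>

definition irreducible_set :: "'v set \<Rightarrow> ('v \<Rightarrow> complex) set \<Rightarrow> bool" where
  "irreducible_set V S \<longleftrightarrow> S \<noteq> {} \<and> S \<subseteq> affine_space V \<and>
     (\<forall>F\<in>polys_on V. \<forall>H\<in>polys_on V. vanishes_on (F * H) S \<longrightarrow> vanishes_on F S \<or> vanishes_on H S)"

text \<open>Phrased through the vanishing ideal, hence insensitive to replacing \<open>S\<close> by
  its closure.\<close>

definition hypersurface :: "'v set \<Rightarrow> ('v \<Rightarrow> complex) set \<Rightarrow> 'v mpoly \<Rightarrow> bool" where
  "hypersurface V S G \<longleftrightarrow> irreducible G \<and> G \<in> polys_on V \<and>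
     (\<forall>F\<in>polys_on V. vanishes_on F S \<longleftrightarrow> G dvd F)"

text \<open>Points of the affine space vanish outside \<open>V\<close>, whereas polynomials can be
  evaluated anywhere; this moves a point into the space without changing the values of polynomials
  on \<open>V\<close>.\<close>

definition truncate :: "'v set \<Rightarrow> ('v \<Rightarrow> complex) \<Rightarrow> ('v \<Rightarrow> complex)" where
  "truncate V x = (\<lambda>v. if v \<in> V then x v else 0)"

lemma truncate_in_affine_space [simp]: "truncate V x \<in> affine_space V"
  by (simp add: truncate_def affine_space_def)

lemma poly_eval_truncate: "F \<in> polys_on V \<Longrightarrow> poly_eval F (truncate V x) = poly_eval F x"
  by (rule poly_eval_cong) (auto simp: truncate_def)

lemma vanishes_on_affine_space: "F \<in> polys_on V \<Longrightarrow> vanishes_on F (affine_space V) \<longleftrightarrow> F = 0"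
proof
  assume F: "F \<in> polys_on V" "vanishes_on F (affine_space V)"
  then have "poly_eval F x = 0" for x
    using poly_eval_truncate[of F V x] by (auto simp: vanishes_on_def)
  then show "F = 0" by (rule poly_identity)
qed (simp add: vanishes_on_def)

lemma vanishes_on_subset: "vanishes_on F S \<Longrightarrow> T \<subseteq> S \<Longrightarrow> vanishes_on F T"
  by (auto simp: vanishes_on_def)

lemma vanishes_on_dvd: "vanishes_on F S \<Longrightarrow> F dvd H \<Longrightarrow> vanishes_on H S"
  by (auto simp: vanishes_on_def dvd_def poly_eval_mult)

lemma zero_set_subset: "zero_set V P \<subseteq> affine_space V"
  by (auto simp: zero_set_def)

lemma zariski_closure_of:
  assumes "S \<subseteq> affine_space V"
  shows "zariski V closure_of S =
    {x \<in> affine_space V. \<forall>F\<in>polys_on V. vanishes_on F S \<longrightarrow> poly_eval F x = 0}" (is "_ = ?R")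
proof
  have R: "?R = zero_set V {F \<in> polys_on V. vanishes_on F S}" by (auto simp: zero_set_def)
  then have "closedin (zariski V) ?R"
    unfolding closedin_zariski by (intro exI[of _ "{F \<in> polys_on V. vanishes_on F S}"]) auto
  then show "zariski V closure_of S \<subseteq> ?R"
    by (rule closure_of_minimal[rotated]) (use assms in \<open>auto simp: vanishes_on_def\<close>)
  obtain P where P: "P \<subseteq> polys_on V" "zariski V closure_of S = zero_set V P"
    using closedin_closure_of[of "zariski V" S] unfolding closedin_zariski by blast
  have "S \<subseteq> zero_set V P" using closure_of_subset[of S "zariski V"] assms unfolding P(2) by simp
  then have "vanishes_on p S" if "p \<in> P" for p using that by (auto simp: vanishes_on_def zero_set_def)
  then show "?R \<subseteq> zariski V closure_of S" unfolding P(2) zero_set_def using P(1) by blast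
qed

lemma vanishes_on_closure:
  assumes "S \<subseteq> affine_space V" "F \<in> polys_on V"
  shows "vanishes_on F (zariski V closure_of S) \<longleftrightarrow> vanishes_on F S"
  using assms closure_of_subset[of S "zariski V"]
  by (auto simp: vanishes_on_def zariski_closure_of[OF assms(1)])

lemma closed_subset_iff:
  assumes "closedin (zariski V) C"
  shows "x \<in> C \<longleftrightarrow> x \<in> affine_space V \<and> (\<forall>F\<in>polys_on V. vanishes_on F C \<longrightarrow> poly_eval F x = 0)"
proof -
  have "C \<subseteq> affine_space V" using closedin_subset[OF assms] by simp
  from zariski_closure_of[OF this] show ?thesis using closure_of_closedin[OF assms] by blast
qed

lemma irreducible_closed_closure:
  assumes "irreducible_set V S"
  shows "irreducible_closed (zariski V) (zariski V closure_of S)"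
  unfolding irreducible_closed_def
proof (intro conjI allI impI)
  have S: "S \<noteq> {}" "S \<subseteq> affine_space V" using assms by (auto simp: irreducible_set_def)
  then have sub: "S \<subseteq> zariski V closure_of S" using closure_of_subset[of S "zariski V"] by simp
  show "closedin (zariski V) (zariski V closure_of S)" by simp
  show "zariski V closure_of S \<noteq> {}" using sub S by blast
  fix C D
  assume *: "closedin (zariski V) C \<and> closedin (zariski V) D \<and> zariski V closure_of S \<subseteq> C \<union> D"
  have "S \<subseteq> C \<or> S \<subseteq> D"
  proof (rule ccontr)
    assume "\<not> ?thesis"
    then obtain x y where xy: "x \<in> S" "x \<notin> C" "y \<in> S" "y \<notin> D" by blast
    then obtain F H where FH: "F \<in> polys_on V" "vanishes_on F C" "poly_eval F x \<noteq> 0"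
      "H \<in> polys_on V" "vanishes_on H D" "poly_eval H y \<noteq> 0"
      using * S closed_subset_iff[of V C x] closed_subset_iff[of V D y] by blast
    have "vanishes_on (F * H) S"
      using * sub FH unfolding vanishes_on_def poly_eval_mult by (metis UnE mult_eq_0_iff subsetD)
    then show False using assms FH xy unfolding irreducible_set_def vanishes_on_def by blast
  qed
  then show "zariski V closure_of S \<subseteq> C \<or> zariski V closure_of S \<subseteq> D"
    using * closure_of_minimal by metis
qed

lemma irreducible_closed_imp_set:
  assumes "irreducible_closed (zariski V) Z"
  shows "irreducible_set V Z"
  unfolding irreducible_set_def
proof (intro conjI ballI impI)
  have Z: "closedin (zariski V) Z" "Z \<noteq> {}" using assms by (auto simp: irreducible_closed_def)
  show "Z \<noteq> {}" by fact
  show Za: "Z \<subseteq> affine_space V" using closedin_subset[OF Z(1)] by simp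
  fix F H assume FH: "F \<in> polys_on V" "H \<in> polys_on V" "vanishes_on (F * H) Z"
  have "closedin (zariski V) (zero_set V {F})" "closedin (zariski V) (zero_set V {H})"
    using FH by (auto simp: closedin_zariski)
  moreover have "Z \<subseteq> zero_set V {F} \<union> zero_set V {H}"
    using FH(3) Za by (auto simp: vanishes_on_def zero_set_def poly_eval_mult)
  ultimately have "Z \<subseteq> zero_set V {F} \<or> Z \<subseteq> zero_set V {H}"
    using assms unfolding irreducible_closed_def by blast
  then show "vanishes_on F Z \<or> vanishes_on H Z" by (auto simp: vanishes_on_def zero_set_def)
qed

lemma irreducible_closed_affine_space: "irreducible_closed (zariski V) (affine_space V)"
proof -
  have "irreducible_set V (affine_space V)"
  proof -
    have "(\<lambda>_. 0) \<in> affine_space V" by (simp add: affine_space_def)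
    then show ?thesis unfolding irreducible_set_def
      by (simp add: vanishes_on_affine_space polys_on_mult) blast
  qed
  moreover have "zariski V closure_of affine_space V = affine_space V"
    using closure_of_topspace[of "zariski V"] by simp
  ultimately show ?thesis using irreducible_closed_closure by metis
qed

text \<open>Primality passes the vanishing on to a factor, and a unit cannot vanish on the non-empty
  set \<open>S\<close>.\<close>

lemma ex_irreducible_vanishing:
  assumes "irreducible_set V S" "F \<noteq> 0" "F \<in> polys_on V" "vanishes_on F S"
  shows "\<exists>q. irreducible q \<and> q \<in> polys_on V \<and> vanishes_on q S"
  using assms(2,3,4)
proof (induction rule: mpoly_irreducible_decomp)
  case (unit u)
  then obtain c where "c \<noteq> 0" "u = const_poly c" by (auto simp: mpoly_unit_iff)
  then show ?case using unit assms(1) by (auto simp: vanishes_on_def irreducible_set_def)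
next
  case (mult q r)
  have "q * r \<noteq> 0" using mult by auto
  then have "q \<in> polys_on V" "r \<in> polys_on V"
    using mult.prems factor_in_polys_on[of q r] factor_in_polys_on[of r q] by (auto simp: mult.commute)
  then show ?case using mult assms(1) unfolding irreducible_set_def by blast
qed

lemma zero_set_dvd:
  assumes "irreducible G" "G \<in> polys_on V" "F \<in> polys_on V" "vanishes_on F (zero_set V {G})"
  shows "G dvd F"
proof (rule irreducible_vanishing[OF assms(1)])
  fix x assume "poly_eval G x = 0"
  then have "truncate V x \<in> zero_set V {G}"
    using poly_eval_truncate[OF assms(2)] by (simp add: zero_set_def)
  then show "poly_eval F x = 0"
    using assms(4) poly_eval_truncate[OF assms(3)] by (metis vanishes_on_def)
qed

lemma hypersurface_zero_set:
  assumes "irreducible G" "G \<in> polys_on V"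
  shows "hypersurface V (zero_set V {G}) G"
proof -
  have "vanishes_on G (zero_set V {G})" by (auto simp: vanishes_on_def zero_set_def)
  then show ?thesis
    using assms zero_set_dvd vanishes_on_dvd by (auto simp: hypersurface_def)
qed

lemma hypersurface_closure:
  assumes "hypersurface V S G" "S \<subseteq> affine_space V"
  shows "zariski V closure_of S = zero_set V {G}"
proof -
  have "(\<forall>F\<in>polys_on V. G dvd F \<longrightarrow> poly_eval F x = 0) \<longleftrightarrow> poly_eval G x = 0" for x
    using assms(1) by (metis dvdE dvd_refl hypersurface_def mult_zero_left poly_eval_mult)
  then show ?thesis using assms by (auto simp: zariski_closure_of hypersurface_def zero_set_def)
qed

lemma irreducible_closed_zero_set:
  assumes "irreducible G" "G \<in> polys_on V"
  shows "irreducible_closed (zariski V) (zero_set V {G})"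
proof -
  note h = hypersurface_zero_set[OF assms]
  have "irreducible_set V (zero_set V {G})"
    unfolding irreducible_set_def
  proof (intro conjI ballI impI)
    have "\<not> vanishes_on 1 (zero_set V {G})"
      using h assms(1) by (auto simp: hypersurface_def irreducible_def)
    then show "zero_set V {G} \<noteq> {}" by (auto simp: vanishes_on_def)
    show "zero_set V {G} \<subseteq> affine_space V" by (rule zero_set_subset)
    fix F H assume "F \<in> polys_on V" "H \<in> polys_on V" "vanishes_on (F * H) (zero_set V {G})"
    then show "vanishes_on F (zero_set V {G}) \<or> vanishes_on H (zero_set V {G})"
      using h mpoly_irreducible_dvd_mult[OF assms(1)] polys_on_mult[of F V H]
      unfolding hypersurface_def by blast
  qed
  then show ?thesis
    using irreducible_closed_closure hypersurface_closure[OF h zero_set_subset] by metis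
qed

section \<open>Hypersurfaces and Krull codimension one\<close>

lemma proper_closed_ex_poly:
  assumes "closedin (zariski V) C" "C \<noteq> affine_space V"
  shows "\<exists>F\<in>polys_on V. F \<noteq> 0 \<and> vanishes_on F C"
proof -
  obtain x where "x \<in> affine_space V" "x \<notin> C"
    using assms closedin_subset[OF assms(1)] by auto
  then obtain F where "F \<in> polys_on V" "vanishes_on F C" "poly_eval F x \<noteq> 0"
    using closed_subset_iff[OF assms(1), of x] by blast
  then show ?thesis by (intro bexI[of _ F]) auto
qed

lemma codimension_chain:
  assumes "C 0 = Z" "\<And>i. i \<le> n \<Longrightarrow> irreducible_closed X (C i)" "\<And>i. i < n \<Longrightarrow> C i \<subset> C (Suc i)"
  shows "codimension X Z \<ge> enat n"
  unfolding codimension_def using assms by (intro Sup_upper) blast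

text \<open>Only the whole space lies strictly above the closure. A proper irreducible closed set
  above it satisfies some irreducible equation \<open>q\<close>; then \<open>G\<close> divides
  \<open>q\<close>, the two are associated, and the set lies in the zero set of
  \<open>G\<close>.\<close>

lemma codimension_hypersurface:
  assumes h: "hypersurface V S G" and S: "irreducible_set V S"
  shows "codimension (zariski V) (zariski V closure_of S) = 1"
proof (rule antisym)
  let ?X = "zariski V" and ?Z = "zariski V closure_of S"
  have Sa: "S \<subseteq> affine_space V" and G: "irreducible G" "G \<in> polys_on V"
    and Gv: "\<And>F. F \<in> polys_on V \<Longrightarrow> vanishes_on F S \<longleftrightarrow> G dvd F"
    using assms by (auto simp: hypersurface_def irreducible_set_def)
  have "\<not> vanishes_on G (affine_space V)" using G by (auto simp: vanishes_on_affine_space)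
  then have ne: "?Z \<noteq> affine_space V"
    using hypersurface_closure[OF h Sa] by (auto simp: zero_set_def vanishes_on_def)
  have Zsub: "?Z \<subseteq> affine_space V" using closure_of_subset_topspace[of ?X S] by simp
  have "enat 1 \<le> codimension ?X ?Z"
    using ne Zsub irreducible_closed_closure[OF S] irreducible_closed_affine_space
    by (intro codimension_chain[where C = "\<lambda>i. if i = 0 then ?Z else affine_space V"]) auto
  then show "1 \<le> codimension ?X ?Z" by (simp add: one_enat_def)
  show "codimension ?X ?Z \<le> 1"
    unfolding codimension_def
  proof (rule Sup_least)
    fix m :: enat
    assume "m \<in> {enat n |n. \<exists>C. C 0 = ?Z \<and> (\<forall>i\<le>n. irreducible_closed ?X (C i))
        \<and> (\<forall>i<n. C i \<subset> C (Suc i))}"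
    then obtain n C where m: "m = enat n"
      and C: "C 0 = ?Z" "\<forall>i\<le>n. irreducible_closed ?X (C i)" "\<forall>i<n. C i \<subset> C (Suc i)" by blast
    show "m \<le> 1"
    proof (rule ccontr)
      assume "\<not> ?thesis"
      then have n: "2 \<le> n" by (simp add: m one_enat_def)
      then have C1: "irreducible_closed ?X (C 1)" and C2: "irreducible_closed ?X (C 2)"
        and sub: "C 0 \<subset> C 1" "C 1 \<subset> C 2"
        using C by (auto simp: numeral_2_eq_2)
      have "C 2 \<subseteq> affine_space V" using C2 closedin_subset[of ?X "C 2"]
        by (simp add: irreducible_closed_def)
      then have "C 1 \<noteq> affine_space V" using sub by auto
      moreover have "closedin ?X (C 1)" using C1 by (simp add: irreducible_closed_def)
      ultimately obtain F where "F \<in> polys_on V" "F \<noteq> 0" "vanishes_on F (C 1)"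
        using proper_closed_ex_poly[of V "C 1"] by blast
      then obtain q where q: "irreducible q" "q \<in> polys_on V" "vanishes_on q (C 1)"
        using ex_irreducible_vanishing[OF irreducible_closed_imp_set[OF C1]] by blast
      have "S \<subseteq> C 1" using closure_of_subset[of S ?X] Sa C(1) sub by auto
      then have "G dvd q" using Gv q vanishes_on_subset by metis
      then have "q dvd G" using irreducible_dvd_sym G q by metis
      then have "vanishes_on G (C 1)" using q(3) vanishes_on_dvd by metis
      moreover have "C 1 \<subseteq> affine_space V" using C1 closedin_subset[of ?X "C 1"]
        by (simp add: irreducible_closed_def)
      ultimately have "C 1 \<subseteq> ?Z"
        using hypersurface_closure[OF h Sa] by (auto simp: zero_set_def vanishes_on_def)
      then show False using sub C(1) by auto
    qed
  qed
qed

text \<open>The whole space has codimension 0, so \<open>Z\<close> satisfies an irreducible equation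
  \<open>q\<close>. If \<open>Z\<close> were smaller than the zero set of \<open>q\<close>, this
  zero set could be inserted below the whole space, giving a chain of length 2.\<close>

lemma codimension_1_imp_hypersurface:
  assumes Z: "irreducible_closed (zariski V) Z" and cod: "codimension (zariski V) Z = 1"
  shows "\<exists>G. hypersurface V Z G"
proof -
  let ?X = "zariski V"
  have "Z \<noteq> affine_space V"
  proof
    assume Zall: "Z = affine_space V"
    have "codimension ?X Z \<le> 0"
      unfolding codimension_def
    proof (rule Sup_least)
      fix m :: enat
      assume "m \<in> {enat n |n. \<exists>C. C 0 = Z \<and> (\<forall>i\<le>n. irreducible_closed ?X (C i))
          \<and> (\<forall>i<n. C i \<subset> C (Suc i))}"
      then obtain n C where m: "m = enat n"
        and C: "C 0 = Z" "\<forall>i\<le>n. irreducible_closed ?X (C i)" "\<forall>i<n. C i \<subset> C (Suc i)" by blast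
      have "n = 0"
      proof (rule ccontr)
        assume "n \<noteq> 0"
        then have "C 0 \<subset> C 1" "irreducible_closed ?X (C 1)" using C by auto
        then show False using C(1) Zall closedin_subset[of ?X "C 1"]
          by (auto simp: irreducible_closed_def)
      qed
      then show "m \<le> 0" by (simp add: m zero_enat_def)
    qed
    then show False using cod by simp
  qed
  moreover have "closedin ?X Z" using Z by (simp add: irreducible_closed_def)
  ultimately obtain F where "F \<in> polys_on V" "F \<noteq> 0" "vanishes_on F Z"
    using proper_closed_ex_poly[of V Z] by blast
  then obtain q where q: "irreducible q" "q \<in> polys_on V" "vanishes_on q Z"
    using ex_irreducible_vanishing[OF irreducible_closed_imp_set[OF Z]] by blast
  have Za: "Z \<subseteq> affine_space V" using Z closedin_subset[of ?X Z] by (simp add: irreducible_closed_def)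
  then have sub: "Z \<subseteq> zero_set V {q}" using q(3) by (auto simp: zero_set_def vanishes_on_def)
  have ne: "zero_set V {q} \<noteq> affine_space V"
    using vanishes_on_affine_space[OF q(2)] q(1) by (auto simp: zero_set_def vanishes_on_def)
  have "Z = zero_set V {q}"
  proof (rule ccontr)
    assume neq: "Z \<noteq> zero_set V {q}"
    define C where "C i = (if i = 0 then Z else if i = 1 then zero_set V {q} else affine_space V)"
      for i :: nat
    have "enat 2 \<le> codimension ?X Z"
    proof (rule codimension_chain[where C = C])
      show "irreducible_closed ?X (C i)" for i
        using Z irreducible_closed_zero_set[OF q(1,2)] irreducible_closed_affine_space[of V]
          by (simp add: C_def)
      show "C i \<subset> C (Suc i)" if "i < 2" for i
        using that neq sub ne zero_set_subset[of V "{q}"] by (auto simp: C_def less_2_cases_iff)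
    qed (simp add: C_def)
    then show False using cod by (simp add: one_enat_def)
  qed
  then show ?thesis using hypersurface_zero_set[OF q(1,2)] by blast
qed

lemma hypersurface_closure_iff:
  assumes "S \<subseteq> affine_space V"
  shows "hypersurface V (zariski V closure_of S) G \<longleftrightarrow> hypersurface V S G"
  using vanishes_on_closure[OF assms] by (simp add: hypersurface_def)

lemma irreducible_closed_subset_Union:
  assumes Z: "irreducible_closed X Z" and "finite I" "\<And>i. i \<in> I \<Longrightarrow> closedin X (C i)" "Z \<subseteq> (\<Union>i\<in>I. C i)"
  shows "\<exists>i\<in>I. Z \<subseteq> C i"
  using assms(2-)
proof (induction I rule: finite_induct)
  case empty
  then show ?case using Z by (auto simp: irreducible_closed_def)
next
  case (insert i I)
  have "closedin X (\<Union>i\<in>I. C i)" using insert by (intro closedin_Union) auto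
  then have "Z \<subseteq> C i \<or> Z \<subseteq> (\<Union>i\<in>I. C i)"
    using Z insert.prems unfolding irreducible_closed_def by (metis UN_insert insertI1)
  then show ?case using insert by auto
qed

text \<open>Depends only on the variables and on the set whose closure is taken, so that the
  discriminant of the collection and that of a Cayley set can be treated alike.\<close>

definition discriminant_of :: "'v set \<Rightarrow> ('v \<Rightarrow> complex) set \<Rightarrow> 'v mpoly \<Rightarrow> bool" where
  "discriminant_of V S D \<longleftrightarrow> D \<in> polys_on V \<and> squarefree D \<and>
     zero_set V {D} = \<Union>{Z \<in> irreducible_components (zariski V) (zariski V closure_of S).
       codimension (zariski V) Z = 1}"

lemma is_reduced_discriminant_iff:
  "is_reduced_discriminant K I A D \<longleftrightarrow> discriminant_of (Sigma I A) (singular_systems K I A) D"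
  by (simp add: is_reduced_discriminant_def discriminant_of_def Let_def)

lemma zero_set_prod:
  assumes "finite H"
  shows "zero_set V {prod G H} = (\<Union>j\<in>H. zero_set V {G j})"
  using assms by (auto simp: zero_set_def poly_eval_prod)

section \<open>The discriminant of a finite union of irreducible proper sets\<close>

context
  fixes V :: "'v set" and S :: "('v \<Rightarrow> complex) set" and I :: "'j set"
    and T :: "'j \<Rightarrow> ('v \<Rightarrow> complex) set" and H :: "'j set" and G :: "'j \<Rightarrow> 'v mpoly"
  assumes fin: "finite I"
    and T: "\<And>j. j \<in> I \<Longrightarrow> irreducible_set V (T j)"
    and proper: "\<And>j. j \<in> I \<Longrightarrow> \<exists>F\<in>polys_on V. F \<noteq> 0 \<and> vanishes_on F (T j)"
    and cl: "zariski V closure_of S = (\<Union>j\<in>I. zariski V closure_of T j)"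
    and H: "H = {j \<in> I. \<exists>G. hypersurface V (T j) G}"
    and G: "\<And>j. j \<in> H \<Longrightarrow> hypersurface V (T j) (G j)"
    and distinct: "\<And>i j. i \<in> H \<Longrightarrow> j \<in> H \<Longrightarrow> G i dvd G j \<Longrightarrow> i = j"
begin

text \<open>A component lies in the closure of some \<open>T j\<close> and equals it by maximality.
  Conversely, an irreducible closed set strictly above a hypersurface \<open>T j\<close> lies in the
  closure of some \<open>T i\<close>, which is not the whole space; this would give a chain of
  length 2 against codimension 1.\<close>

lemma codim_1_components:
  "\<Union>{Z \<in> irreducible_components (zariski V) (zariski V closure_of S). codimension (zariski V) Z = 1}
    = zero_set V {prod G H}" (is "\<Union>?L = _")
proof -
  let ?X = "zariski V"
  have finH: "finite H" using H fin by simp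
  have Ta: "T j \<subseteq> affine_space V" if "j \<in> I" for j using T[OF that] by (simp add: irreducible_set_def)
  have cl_ne: "?X closure_of T j \<noteq> affine_space V" if j: "j \<in> I" for j
  proof
    assume eq: "?X closure_of T j = affine_space V"
    obtain F where F: "F \<in> polys_on V" "F \<noteq> 0" "vanishes_on F (T j)" using proper[OF j] by blast
    then have "vanishes_on F (?X closure_of T j)" using vanishes_on_closure[OF Ta[OF j] F(1)] by simp
    then show False using F eq vanishes_on_affine_space[OF F(1)] by simp
  qed
  have sub: "\<exists>j\<in>I. Z \<subseteq> ?X closure_of T j"
    if "irreducible_closed ?X Z" "Z \<subseteq> ?X closure_of S" for Z
    using irreducible_closed_subset_Union[OF that(1) fin, of "\<lambda>j. ?X closure_of T j"] that(2) cl by simp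
  have "\<exists>j\<in>H. Z = zero_set V {G j}" if "Z \<in> ?L" for Z
  proof -
    have Z: "irreducible_closed ?X Z" "Z \<subseteq> ?X closure_of S" "codimension ?X Z = 1"
      and max: "\<And>Y. irreducible_closed ?X Y \<Longrightarrow> Z \<subseteq> Y \<Longrightarrow> Y \<subseteq> ?X closure_of S \<Longrightarrow> Y = Z"
      using that by (auto simp: irreducible_components_def)
    obtain j where j: "j \<in> I" "Z \<subseteq> ?X closure_of T j" using sub[OF Z(1,2)] by blast
    then have eq: "?X closure_of T j = Z"
      using cl irreducible_closed_closure[OF T[OF j(1)]] by (intro max) auto
    then obtain G' where "hypersurface V (T j) G'"
      using codimension_1_imp_hypersurface[OF Z(1,3)] hypersurface_closure_iff[OF Ta[OF j(1)]] by auto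
    then have "j \<in> H" using H j by auto
    then show ?thesis using eq hypersurface_closure[OF G Ta] j by auto
  qed
  moreover have "zero_set V {G j} \<in> ?L" if j: "j \<in> H" for j
  proof -
    have jI: "j \<in> I" using j H by simp
    have eq: "zero_set V {G j} = ?X closure_of T j" using hypersurface_closure[OF G[OF j] Ta[OF jI]]
      by simp
    have cod: "codimension ?X (?X closure_of T j) = 1"
      by (rule codimension_hypersurface[OF G[OF j] T[OF jI]])
    have "Y = ?X closure_of T j"
      if Y: "irreducible_closed ?X Y" "?X closure_of T j \<subseteq> Y" "Y \<subseteq> ?X closure_of S" for Y
    proof (rule ccontr)
      assume ne: "Y \<noteq> ?X closure_of T j"
      obtain i where i: "i \<in> I" "Y \<subseteq> ?X closure_of T i" using sub[OF Y(1,3)] by blast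
      moreover have "?X closure_of T i \<subseteq> affine_space V" for i
        using closure_of_subset_topspace[of ?X "T i"] by simp
      ultimately have psub: "Y \<subset> affine_space V" using cl_ne[OF i(1)] by blast
      define C where "C i = (if i = 0 then ?X closure_of T j
          else if i = 1 then Y else affine_space V)" for i :: nat
      have "enat 2 \<le> codimension ?X (?X closure_of T j)"
      proof (rule codimension_chain[where C = C])
        show "irreducible_closed ?X (C i)" for i
          using Y irreducible_closed_closure[OF T[OF jI]] irreducible_closed_affine_space[of V]
            by (simp add: C_def)
        show "C i \<subset> C (Suc i)" if "i < 2" for i
          using that ne Y psub by (auto simp: C_def less_2_cases_iff)
      qed (simp add: C_def)
      then show False using cod by (simp add: one_enat_def)
    qed
    moreover have "?X closure_of T j \<subseteq> ?X closure_of S" using cl jI by auto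
    ultimately show ?thesis
      unfolding irreducible_components_def eq using cod irreducible_closed_closure[OF T[OF jI]] by blast
  qed
  ultimately have "?L = (\<lambda>j. zero_set V {G j}) ` H" by blast
  then show ?thesis using zero_set_prod[OF finH, of V G] by simp
qed

lemma prod_generators_dvd:
  assumes "F \<in> polys_on V" "\<And>j. j \<in> H \<Longrightarrow> G j dvd F"
  shows "prod G H dvd F"
proof -
  have Girr: "irreducible (G j)" if "j \<in> H" for j using G[OF that] by (simp add: hypersurface_def)
  have "prod G H' dvd F" if "finite H'" "H' \<subseteq> H" for H'
    using that
  proof (induction H' rule: finite_induct)
    case (insert i H')
    then obtain h where h: "F = prod G H' * h" by (auto elim: dvdE)
    have "G i dvd prod G H' * h" using assms(2) insert.prems h by auto
    then have "G i dvd prod G H' \<or> G i dvd h"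
      using Girr insert.prems by (intro mpoly_irreducible_dvd_mult) auto
    moreover have "\<not> G i dvd prod G H'"
      using mpoly_irreducible_dvd_prod[of "G i" H' G] Girr insert distinct by blast
    ultimately obtain h' where "h = G i * h'" by (auto elim: dvdE)
    then have "F = prod G (insert i H') * h'" using h insert.hyps by (simp add: ac_simps)
    then show ?case by (rule dvdI)
  qed simp
  then show ?thesis using H fin by auto
qed

lemma discriminant_of_prod: "discriminant_of V S (prod G H)"
  unfolding discriminant_of_def
proof (intro conjI)
  have finH: "finite H" using H fin by simp
  have Girr: "irreducible (G j)" "G j \<in> polys_on V" if "j \<in> H" for j
    using G[OF that] by (auto simp: hypersurface_def)
  show "prod G H \<in> polys_on V" using Girr by (intro polys_on_prod)
  have ne: "prod G H \<noteq> 0" using Girr(1) finH by (metis mpoly_prod_eq_0_iff not_irreducible_zero)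
  show "squarefree (prod G H)"
  proof (rule squarefreeI)
    fix x assume x: "x\<^sup>2 dvd prod G H"
    show "x dvd 1"
    proof (rule ccontr)
      assume nu: "\<not> x dvd 1"
      have "x \<noteq> 0" using x ne by auto
      then obtain q where q: "irreducible q" "q dvd x" using mpoly_irreducible_factor nu by blast
      then have qq: "q * q dvd prod G H"
        using x by (metis dvd_trans mult_dvd_mono power2_eq_square)
      then have "q dvd prod G H" using dvd_mult_left by blast
      then obtain j where j: "j \<in> H" "q dvd G j"
        using mpoly_irreducible_dvd_prod[OF q(1) finH] by blast
      then have Gq: "G j dvd q" using irreducible_dvd_sym q Girr by blast
      then have "G j * G j dvd G j * prod G (H - {j})"
        using qq finH j(1) by (metis dvd_trans mult_dvd_mono prod.remove)
      then have "G j dvd prod G (H - {j})"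
        using Girr(1)[OF j(1)] by (auto simp: dvd_def mult.assoc mpoly_mult_cancel)
      then obtain i where "i \<in> H - {j}" "G j dvd G i"
        using mpoly_irreducible_dvd_prod[OF Girr(1)[OF j(1)], of "H - {j}"] finH by blast
      then show False using distinct j(1) by blast
    qed
  qed
  show "zero_set V {prod G H} = \<Union>{Z \<in> irreducible_components (zariski V) (zariski V closure_of S).
       codimension (zariski V) Z = 1}" using codim_1_components by simp
qed

text \<open>By the Nullstellensatz the zero set determines the irreducible factors. A further
  irreducible factor of the cofactor \<open>h\<close> would also divide the product, hence occur
  twice in the squarefree \<open>D\<close>.\<close>

lemma discriminant_of_unique:
  assumes "discriminant_of V S D"
  shows "\<exists>c. c \<noteq> 0 \<and> D = const_poly c * prod G H"
proof -
  have finH: "finite H" using H fin by simp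
  have Girr: "irreducible (G j)" "G j \<in> polys_on V" if "j \<in> H" for j
    using G[OF that] by (auto simp: hypersurface_def)
  have D: "D \<in> polys_on V" "squarefree D" "zero_set V {D} = (\<Union>j\<in>H. zero_set V {G j})"
    using assms codim_1_components zero_set_prod[OF finH, of V G] by (auto simp: discriminant_of_def)
  have D0: "D \<noteq> 0" using D(2) by auto
  have "G j dvd D" if "j \<in> H" for j
  proof (rule zero_set_dvd[OF Girr[OF that] D(1)])
    show "vanishes_on D (zero_set V {G j})" using D(3) that by (auto simp: vanishes_on_def zero_set_def)
  qed
  then obtain h where h: "D = prod G H * h" using prod_generators_dvd[OF D(1)] by (auto elim: dvdE)
  have "h dvd 1"
  proof (rule ccontr)
    assume "\<not> h dvd 1"
    moreover have "h \<noteq> 0" using D0 h by auto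
    ultimately obtain q where q: "irreducible q" "q dvd h" using mpoly_irreducible_factor by blast
    then have "q dvd D" using h by simp
    then have qV: "q \<in> polys_on V" using dvd_in_polys_on D(1) D0 by blast
    have "zero_set V {q} \<subseteq> zero_set V {D}"
      using \<open>q dvd D\<close> by (auto simp: zero_set_def dvd_def poly_eval_mult)
    then have "zero_set V {q} \<subseteq> zero_set V {prod G H}" using D(3) zero_set_prod[OF finH] by metis
    then have "vanishes_on (prod G H) (zero_set V {q})"
      by (auto simp: vanishes_on_def zero_set_def)
    then have "q dvd prod G H" using q qV Girr by (intro zero_set_dvd polys_on_prod) auto
    then have "q\<^sup>2 dvd D" using h q(2) by (simp add: power2_eq_square mult_dvd_mono)
    then have "q dvd 1" using D(2) squarefreeD by blast
    then show False using q(1) by (simp add: irreducible_def)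
  qed
  then show ?thesis using h by (auto simp: mpoly_unit_iff mult.commute)
qed

end

section \<open>Partial derivatives\<close>

lemma mpoly_induct [consumes 1, case_names const var add mult]:
  assumes p: "p \<in> polys_on V"
    and const: "\<And>c. Q (const_poly c)" and var: "\<And>v. v \<in> V \<Longrightarrow> Q (poly_var v)"
    and add: "\<And>p q. p \<in> polys_on V \<Longrightarrow> q \<in> polys_on V \<Longrightarrow> Q p \<Longrightarrow> Q q \<Longrightarrow> Q (p + q)"
    and mult: "\<And>p q. p \<in> polys_on V \<Longrightarrow> q \<in> polys_on V \<Longrightarrow> Q p \<Longrightarrow> Q q \<Longrightarrow> Q (p * q)"
  shows "Q p"
proof -
  let ?R = "\<lambda>p. p \<in> polys_on V \<and> Q p"
  have R: "?R 0" "?R 1" using const[of 0] const[of 1] by (auto simp: const_poly_0)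
  have sum: "?R (sum f S)" if "\<And>s. s \<in> S \<Longrightarrow> ?R (f s)" for f :: "('a \<Rightarrow>\<^sub>0 nat) \<Rightarrow> 'a mpoly" and S
    using that R by (induction S rule: infinite_finite_induct) (auto intro: polys_on_add add)
  have prod: "?R (prod f S)" if "\<And>s. s \<in> S \<Longrightarrow> ?R (f s)" for f :: "'a \<Rightarrow> 'a mpoly" and S
    using that R by (induction S rule: infinite_finite_induct) (auto intro: polys_on_mult mult)
  have power: "?R (q ^ n)" if "?R q" for q n
    using that R by (induction n) (auto intro: polys_on_mult mult)
  have m: "?R (Poly_Mapping.single m c)" if "Poly_Mapping.keys m \<subseteq> V" for m c
  proof -
    have "Poly_Mapping.single m c
        = const_poly c * (\<Prod>v\<in>Poly_Mapping.keys m. poly_var v ^ Poly_Mapping.lookup m v)"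
      by (rule mpoly_eqI) (simp add: poly_eval_mult poly_eval_prod poly_eval_power monom_eval_def)
    moreover have "?R (\<Prod>v\<in>Poly_Mapping.keys m. poly_var v ^ Poly_Mapping.lookup m v)"
      using that var by (intro prod power) auto
    ultimately show ?thesis using const mult polys_on_mult polys_on_const by metis
  qed
  have "?R (\<Sum>m\<in>Poly_Mapping.keys p. Poly_Mapping.single m (Poly_Mapping.lookup p m))"
    using p by (intro sum m) (auto simp: polys_on_def)
  then show ?thesis using mpoly_sum_monomials[of p] by simp
qed

lemma ex_partial:
  assumes "p \<in> polys_on V"
  shows "\<exists>q\<in>polys_on V. \<forall>x. ((\<lambda>z. poly_eval p (x(v := z))) has_field_derivative poly_eval q x)
      (at (x v))"
  using assms
proof (induction rule: mpoly_induct)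
  case (const c)
  then show ?case by (intro bexI[of _ 0]) auto
next
  case (var u)
  show ?case by (intro bexI[of _ "if u = v then 1 else 0"]) auto
next
  case (add p q)
  then obtain p' q' where *: "p' \<in> polys_on V" "q' \<in> polys_on V"
    "\<And>x. ((\<lambda>z. poly_eval p (x(v := z))) has_field_derivative poly_eval p' x) (at (x v))"
    "\<And>x. ((\<lambda>z. poly_eval q (x(v := z))) has_field_derivative poly_eval q' x) (at (x v))" by blast
  have "((\<lambda>z. poly_eval (p + q) (x(v := z))) has_field_derivative poly_eval (p' + q') x) (at (x v))"
    for x
    using DERIV_add[OF *(3)[of x] *(4)[of x]] by (simp add: poly_eval_add)
  then show ?case using polys_on_add[OF *(1,2)] by blast
next
  case (mult p q)
  then obtain p' q' where *: "p' \<in> polys_on V" "q' \<in> polys_on V"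
    "\<And>x. ((\<lambda>z. poly_eval p (x(v := z))) has_field_derivative poly_eval p' x) (at (x v))"
    "\<And>x. ((\<lambda>z. poly_eval q (x(v := z))) has_field_derivative poly_eval q' x) (at (x v))" by blast
  have "((\<lambda>z. poly_eval (p * q) (x(v := z))) has_field_derivative
      poly_eval (p' * q + q' * p) x) (at (x v))" for x
    using DERIV_mult[OF *(3)[of x] *(4)[of x]] by (simp add: poly_eval_mult poly_eval_add)
  moreover have "p' * q + q' * p \<in> polys_on V" using * mult by (intro polys_on_add polys_on_mult)
  ultimately show ?case by blast
qed

text \<open>Defined analytically, so that the sum, product and chain rules are inherited from
  complex derivatives. The polynomial is unique because polynomials are determined by their
  values.\<close>

definition partial :: "'v \<Rightarrow> 'v mpoly \<Rightarrow> 'v mpoly" where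
  "partial v p = (THE q. \<forall>x. ((\<lambda>z. poly_eval p (x(v := z))) has_field_derivative poly_eval q x)
      (at (x v)))"

lemma partial_eqI:
  assumes "\<And>x. ((\<lambda>z. poly_eval p (x(v := z))) has_field_derivative poly_eval q x) (at (x v))"
  shows "partial v p = q"
  unfolding partial_def
proof (rule the_equality)
  fix r assume "\<forall>x. ((\<lambda>z. poly_eval p (x(v := z))) has_field_derivative poly_eval r x) (at (x v))"
  then show "r = q" using assms DERIV_unique by (intro mpoly_eqI) blast
qed (use assms in auto)

lemma partial_in_polys_on: "p \<in> polys_on V \<Longrightarrow> partial v p \<in> polys_on V"
  using ex_partial partial_eqI by metis

lemma has_derivative_partial:
  "((\<lambda>z. poly_eval p (x(v := z))) has_field_derivative poly_eval (partial v p) x) (at (x v))"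
  using ex_partial[of p UNIV v] partial_eqI by (metis polys_on_UNIV)

lemma partial_const [simp]: "partial v (const_poly c) = 0"
  by (rule partial_eqI) auto

lemma partial_0 [simp]: "partial v 0 = 0"
  using partial_const[of v 0] by simp

lemma partial_var: "partial v (poly_var u) = (if u = v then 1 else 0)"
  by (rule partial_eqI) auto

lemma partial_add: "partial v (p + q) = partial v p + partial v q"
proof (rule partial_eqI)
  show "((\<lambda>z. poly_eval (p + q) (x(v := z))) has_field_derivative
      poly_eval (partial v p + partial v q) x) (at (x v))" for x
    using DERIV_add[OF has_derivative_partial[of p x v] has_derivative_partial[of q x v]]
    by (simp add: poly_eval_add)
qed

lemma partial_mult: "partial v (p * q) = partial v p * q + partial v q * p"
proof (rule partial_eqI)
  show "((\<lambda>z. poly_eval (p * q) (x(v := z))) has_field_derivative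
      poly_eval (partial v p * q + partial v q * p) x) (at (x v))" for x
    using DERIV_mult[OF has_derivative_partial[of p x v] has_derivative_partial[of q x v]]
    by (simp add: poly_eval_mult poly_eval_add)
qed

lemma partial_free:
  assumes "p \<in> polys_on (- {v})"
  shows "partial v p = 0"
proof (rule partial_eqI)
  have "poly_eval p (x(v := z)) = poly_eval p x" for x z by (rule poly_eval_cong[OF assms]) auto
  then show "((\<lambda>z. poly_eval p (x(v := z))) has_field_derivative poly_eval 0 x) (at (x v))" for x
    by simp
qed

lemma poly_eval_chain_rule:
  assumes V: "finite V" and p: "p \<in> polys_on V"
    and g: "\<And>v. v \<in> V \<Longrightarrow> ((\<lambda>s. g s v) has_field_derivative g' v) (at s)"
  shows "((\<lambda>s. poly_eval p (g s)) has_field_derivative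
    (\<Sum>v\<in>V. poly_eval (partial v p) (g s) * g' v)) (at s)"
  using p
proof (induction rule: mpoly_induct)
  case (var u)
  have "(\<Sum>v\<in>V. poly_eval (partial v (poly_var u)) (g s) * g' v) = (\<Sum>v\<in>V. if v = u then g' v else 0)"
    by (intro sum.cong) (auto simp: partial_var)
  also have "\<dots> = g' u" using var V by simp
  finally show ?case using g[OF var] by simp
next
  case (add p q)
  from DERIV_add[OF add.IH] show ?case
    by (simp add: poly_eval_add partial_add sum.distrib distrib_right)
next
  case (mult p q)
  from DERIV_mult[OF mult.IH] show ?case
    by (simp add: poly_eval_mult poly_eval_add partial_mult sum.distrib distrib_left sum_distrib_left
        mult_ac)
qed auto

lemma poly_eval_holomorphic:
  assumes "\<And>v. (\<lambda>s. g s v) holomorphic_on UNIV"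
  shows "(\<lambda>s. poly_eval p (g s)) holomorphic_on UNIV"
  unfolding poly_eval_def monom_eval_def using assms by (auto intro!: holomorphic_intros)

lemma partial_sum: "partial v (sum f S) = (\<Sum>s\<in>S. partial v (f s))"
  by (induction S rule: infinite_finite_induct) (auto simp: partial_add)

lemma partial_var_power: "partial w (poly_var w ^ Suc n) = of_nat (Suc n) * poly_var w ^ n"
proof (induction n)
  case (Suc n)
  have "partial w (poly_var w ^ Suc (Suc n)) = poly_var w ^ Suc n + (of_nat (Suc n) * poly_var w ^ n)
      * poly_var w"
    by (subst power_Suc, subst partial_mult, subst Suc) (simp add: partial_var)
  then show ?case by (simp add: algebra_simps)
qed (simp add: partial_var)

lemma as_poly_sum_powers: "p = (\<Sum>i\<le>deg_in w p. coeff (as_poly w p) i * poly_var w ^ i)"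
  using poly_as_poly[of w p] unfolding poly_altdef deg_in_def by simp

lemma of_nat_mpoly: "of_nat n = (const_poly (of_nat n) :: 'v mpoly)"
  by (simp add: const_poly_def)

lemma as_poly_partial:
  "as_poly w (partial w p) = (\<Sum>i<deg_in w p. monom (of_nat (Suc i) * coeff (as_poly w p) (Suc i)) i)"
proof (rule as_poly_eqI)
  let ?c = "\<lambda>i. coeff (as_poly w p) i"
  show "coeff (\<Sum>i<deg_in w p. monom (of_nat (Suc i) * ?c (Suc i)) i) j \<in> polys_on (- {w})" for j
    unfolding coeff_sum
    by (rule polys_on_sum)
        (auto simp: of_nat_mpoly simp del: of_nat_Suc intro!: polys_on_mult as_poly_coeff_free)
  have free: "partial w (?c i) = 0" for i by (intro partial_free as_poly_coeff_free)
  have "partial w p = (\<Sum>i\<le>deg_in w p. ?c i * partial w (poly_var w ^ i))"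
  proof -
    have "partial w p = partial w (\<Sum>i\<le>deg_in w p. ?c i * poly_var w ^ i)"
      by (rule arg_cong[OF as_poly_sum_powers])
    also have "\<dots> = (\<Sum>i\<le>deg_in w p. ?c i * partial w (poly_var w ^ i))"
      unfolding partial_sum by (simp add: partial_mult free mult.commute)
    finally show ?thesis .
  qed
  also have "\<dots> = (\<Sum>i<deg_in w p. ?c (Suc i) * partial w (poly_var w ^ Suc i))"
    using partial_const[of w 1] by (subst sum.atMost_shift) simp
  also have "\<dots> = (\<Sum>i<deg_in w p. of_nat (Suc i) * ?c (Suc i) * poly_var w ^ i)"
    by (intro sum.cong refl) (simp only: partial_var_power mult_ac)
  finally show "poly (\<Sum>i<deg_in w p. monom (of_nat (Suc i) * ?c (Suc i)) i) (poly_var w) = partial w p"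
    by (simp only: poly_sum poly_monom)
qed

section \<open>Renaming variables\<close>

lemma monom_eval_sum: "monom_eval (sum f S) x = (\<Prod>s\<in>S. monom_eval (f s) x)"
  by (induction S rule: infinite_finite_induct) (auto simp: monom_eval_add)

lemma poly_eval_rename: "poly_eval (rename_vars f p) x = poly_eval p (x \<circ> f)"
  unfolding rename_vars_def poly_eval_sum
  by (simp add: monom_eval_sum poly_eval_def[of p] monom_eval_def[of _ "x \<circ> f"])

lemma rename_vars_in_polys_on:
  assumes "p \<in> polys_on V"
  shows "rename_vars f p \<in> polys_on (f ` V)"
  using assms
proof (induction rule: mpoly_induct)
  case (const c)
  have "rename_vars f (const_poly c) = const_poly c" by (rule mpoly_eqI) (simp add: poly_eval_rename)
  then show ?case by simp
next
  case (var v)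
  have "rename_vars f (poly_var v) = poly_var (f v)" by (rule mpoly_eqI) (simp add: poly_eval_rename)
  then show ?case using var by simp
next
  case (add p q)
  have "rename_vars f (p + q) = rename_vars f p + rename_vars f q"
    by (rule mpoly_eqI) (simp add: poly_eval_rename poly_eval_add)
  then show ?case using add by (simp add: polys_on_add)
next
  case (mult p q)
  have "rename_vars f (p * q) = rename_vars f p * rename_vars f q"
    by (rule mpoly_eqI) (simp add: poly_eval_rename poly_eval_mult)
  then show ?case using mult by (simp add: polys_on_mult)
qed

lemma rename_vars_rename:
  assumes "p \<in> polys_on V" "\<And>v. v \<in> V \<Longrightarrow> g (f v) = v"
  shows "rename_vars g (rename_vars f p) = p"
  by (rule mpoly_eqI) (auto simp: poly_eval_rename assms(2) intro!: poly_eval_cong[OF assms(1)])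

lemma rename_vars_mult: "rename_vars f (p * q) = rename_vars f p * rename_vars f q"
  by (rule mpoly_eqI) (simp add: poly_eval_rename poly_eval_mult)

lemma rename_vars_const [simp]: "rename_vars f (const_poly c) = const_poly c"
  by (rule mpoly_eqI) (simp add: poly_eval_rename)

section \<open>Singular loci in logarithmic coordinates\<close>

text \<open>Points of the torus are given by logarithms \<open>\<xi>\<close> of their coordinates.\<close>

definition char_exp :: "'k set \<Rightarrow> ('k \<Rightarrow> int) \<Rightarrow> ('k \<Rightarrow> complex) \<Rightarrow> complex" where
  "char_exp K a \<xi> = exp (\<Sum>t\<in>K. of_int (a t) * \<xi> t)"

lemma char_exp_nonzero [simp]: "char_exp K a \<xi> \<noteq> 0"
  by (simp add: char_exp_def)

lemma char_exp_add: "char_exp K a (\<lambda>t. \<xi> t + \<eta> t) = char_exp K a \<xi> * char_exp K a \<eta>"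
  by (simp add: char_exp_def distrib_left sum.distrib exp_add)

lemma char_exp_minus: "char_exp K a (\<lambda>t. - \<xi> t) = inverse (char_exp K a \<xi>)"
  by (simp add: char_exp_def sum_negf exp_minus)

text \<open>The derivatives are logarithmic ones, y_t d/dy_t, which are again combinations of the
  same characters and vanish at the same torus points. Exponents are attached to indices by
  \<open>e\<close>, so that the coefficient variables may be named independently of the
  exponents.\<close>

definition singular_at ::
  "'v set \<Rightarrow> 'k set \<Rightarrow> ('v \<Rightarrow> 'k \<Rightarrow> int) \<Rightarrow> ('v \<Rightarrow> complex) \<Rightarrow> ('k \<Rightarrow> complex) \<Rightarrow> bool" where
  "singular_at N K e x \<xi> \<longleftrightarrow> (\<Sum>n\<in>N. x n * char_exp K (e n) \<xi>) = 0 \<and>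
     (\<forall>t\<in>K. (\<Sum>n\<in>N. x n * of_int (e n t) * char_exp K (e n) \<xi>) = 0)"

text \<open>Coordinates in \<open>V\<close> outside \<open>N\<close> are free; this is how the locus
  of a Cayley set is placed in the space of all systems.\<close>

definition singular_locus ::
  "'v set \<Rightarrow> 'v set \<Rightarrow> 'k set \<Rightarrow> ('v \<Rightarrow> 'k \<Rightarrow> int) \<Rightarrow> ('v \<Rightarrow> complex) set" where
  "singular_locus V N K e = {x \<in> affine_space V. \<exists>\<xi>. singular_at N K e x \<xi>}"

definition incidence ::
  "'v set \<Rightarrow> 'v set \<Rightarrow> 'k set \<Rightarrow> ('v \<Rightarrow> 'k \<Rightarrow> int) \<Rightarrow> ('v + 'k \<Rightarrow> complex) set" where
  "incidence V N K e = {case_sum x (\<lambda>t. exp (\<xi> t)) | x \<xi>. x \<in> affine_space V \<and> singular_at N K e x \<xi>}"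

text \<open>\<open>f\<close> is non-zero on a neighbourhood of \<open>a\<close>, so \<open>g\<close>
  vanishes there and by the identity theorem everywhere. With the identity as \<open>f\<close>, this
  extends a vanishing from non-zero parameters to 0.\<close>

lemma entire_no_zero_divisors:
  assumes "f holomorphic_on UNIV" "g holomorphic_on UNIV" "\<And>z. f z * g z = 0" "f a \<noteq> (0 :: complex)"
  shows "g z = 0"
proof -
  have "isCont f a"
    using assms(1)
        by (meson UNIV_I continuous_on_eq_continuous_at holomorphic_on_imp_continuous_on open_UNIV)
  then obtain r where "r > 0" "\<And>y. dist a y < r \<Longrightarrow> f y \<noteq> 0"
    using continuous_at_avoid[of a f 0] assms(4) by blast
  then obtain S where S: "open S" "a \<in> S" "\<And>z. z \<in> S \<Longrightarrow> f z \<noteq> 0"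
    using that[of "ball a r"] by auto
  then have "g z = 0" if "z \<in> S" for z using assms(3)[of z] that by simp
  then show ?thesis
    using analytic_continuation_open[of S UNIV g "\<lambda>_. 0" z] S assms(2) by auto
qed

text \<open>Any two points of the incidence variety lie on an entire curve inside it: the coordinates
  \<open>x n * char_exp K (e n) \<xi>\<close> trivialise it over the torus, so that one can
  interpolate them and \<open>\<xi>\<close> linearly.\<close>

lemma incidence_no_zero_divisors:
  assumes N: "N \<subseteq> V"
    and FH: "vanishes_on (F * H) (incidence V N K e)" and F: "\<not> vanishes_on F (incidence V N K e)"
  shows "vanishes_on H (incidence V N K e)"
  unfolding vanishes_on_def
proof
  fix Q assume "Q \<in> incidence V N K e"
  then obtain q \<xi>q where q: "Q = case_sum q (\<lambda>t. exp (\<xi>q t))" "q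
      \<in> affine_space V" "singular_at N K e q \<xi>q"
    by (auto simp: incidence_def)
  obtain p \<xi>p where p: "p \<in> affine_space V" "singular_at N K e p \<xi>p"
    and Fp: "poly_eval F (case_sum p (\<lambda>t. exp (\<xi>p t))) \<noteq> 0"
    using F by (auto simp: incidence_def vanishes_on_def)
  define \<xi> where "\<xi> s t = (1 - s) * \<xi>p t + s * \<xi>q t" for s t
  define x where "x s v = (if v \<in> N
    then ((1 - s) * (p v * char_exp K (e v) \<xi>p) + s * (q v * char_exp K (e v) \<xi>q)) * char_exp K (e v)
        (\<lambda>t. - \<xi> s t)
    else (1 - s) * p v + s * q v)" for s v
  define g where "g s = case_sum (x s) (\<lambda>t. exp (\<xi> s t))" for s
  have xN: "x s n * char_exp K (e n) (\<xi> s)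
      = (1 - s) * (p n * char_exp K (e n) \<xi>p) + s * (q n * char_exp K (e n) \<xi>q)" if "n \<in> N" for s n
    using that by (simp add: x_def char_exp_minus)
  have comb: "(\<Sum>n\<in>N. x s n * c n * char_exp K (e n) (\<xi> s))
      = (1 - s) * (\<Sum>n\<in>N. p n * c n * char_exp K (e n) \<xi>p) + s * (\<Sum>n\<in>N. q n * c n * char_exp K (e n)
          \<xi>q)" for s c
  proof -
    have "(\<Sum>n\<in>N. x s n * c n * char_exp K (e n) (\<xi> s)) = (\<Sum>n\<in>N. c n * (x s n * char_exp K (e n) (\<xi> s)))"
      by (simp add: mult_ac)
    also have "\<dots> = (\<Sum>n\<in>N. c n * ((1 - s) * (p n * char_exp K (e n) \<xi>p) + s * (q n * char_exp K (e n)
        \<xi>q)))"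
      by (intro sum.cong refl) (simp only: xN)
    finally show ?thesis by (simp add: sum.distrib distrib_left sum_distrib_left mult_ac)
  qed
  have "singular_at N K e (x s) (\<xi> s)" for s
    using comb[of s "\<lambda>_. 1"] comb[of s "\<lambda>n. of_int (e n t)" for t] p(2) q(3)
      by (simp add: singular_at_def)
  moreover have "x s \<in> affine_space V" for s
    using N p q by (auto simp: affine_space_def x_def)
  ultimately have ginc: "g s \<in> incidence V N K e" for s by (auto simp: incidence_def g_def)
  have hol\<xi>: "(\<lambda>s. \<xi> s t) holomorphic_on UNIV" for t
    unfolding \<xi>_def by (intro holomorphic_intros)
  have "(\<lambda>s. x s v) holomorphic_on UNIV" for v
    unfolding x_def char_exp_def
    by (cases "v \<in> N") (auto intro!: holomorphic_intros hol\<xi>)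
  then have hol: "(\<lambda>s. g s v) holomorphic_on UNIV" for v
    by (cases v) (auto simp: g_def intro!: holomorphic_intros hol\<xi>)
  have "x 0 = p" "x 1 = q" by (auto simp: x_def \<xi>_def fun_eq_iff char_exp_minus)
  then have g01: "g 0 = case_sum p (\<lambda>t. exp (\<xi>p t))" "g 1 = Q" by (simp_all add: g_def \<xi>_def q)
  have "poly_eval H (g 1) = 0"
  proof (rule entire_no_zero_divisors[where f = "\<lambda>s. poly_eval F (g s)"
    and g = "\<lambda>s. poly_eval H (g s)" and a = 0])
    show "(\<lambda>s. poly_eval F (g s)) holomorphic_on UNIV" "(\<lambda>s. poly_eval H (g s)) holomorphic_on UNIV"
      by (intro poly_eval_holomorphic hol)+
    show "poly_eval F (g s) * poly_eval H (g s) = 0" for s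
      using FH ginc[of s] by (simp add: vanishes_on_def poly_eval_mult)
    show "poly_eval F (g 0) \<noteq> 0" using Fp g01 by simp
  qed
  then show "poly_eval H Q = 0" using g01 by simp
qed

text \<open>The singular locus is the projection of the incidence variety, so its vanishing ideal is
  a contraction and inherits primality.\<close>

lemma vanishes_on_incidence_Inl:
  "vanishes_on (rename_vars Inl F) (incidence V N K e) \<longleftrightarrow> vanishes_on F (singular_locus V N K e)"
proof -
  have "poly_eval (rename_vars Inl F) (case_sum x y) = poly_eval F x" for x and y :: "'b \<Rightarrow> complex"
    by (simp add: poly_eval_rename comp_def)
  then show ?thesis unfolding vanishes_on_def incidence_def singular_locus_def by fastforce
qed

lemma zero_in_singular_locus: "(\<lambda>_. 0) \<in> singular_locus V N K e"
  by (auto simp: singular_locus_def singular_at_def affine_space_def)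

lemma irreducible_singular_locus:
  assumes "N \<subseteq> V"
  shows "irreducible_set V (singular_locus V N K e)"
  unfolding irreducible_set_def
proof (intro conjI ballI impI)
  show "singular_locus V N K e \<noteq> {}" using zero_in_singular_locus by blast
  show "singular_locus V N K e \<subseteq> affine_space V" by (auto simp: singular_locus_def)
  fix F H assume "vanishes_on (F * H) (singular_locus V N K e)"
  then show "vanishes_on F (singular_locus V N K e) \<or> vanishes_on H (singular_locus V N K e)"
    using incidence_no_zero_divisors[OF assms, of "rename_vars Inl F" "rename_vars Inl H" K e]
    by (auto simp: vanishes_on_incidence_Inl[symmetric] rename_vars_mult)
qed

section \<open>Extending derivations\<close>

definition vector_field :: "'w set \<Rightarrow> ('w \<Rightarrow> 'w mpoly) \<Rightarrow> 'w mpoly \<Rightarrow> 'w mpoly" where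
  "vector_field W q p = (\<Sum>v\<in>W. q v * partial v p)"

lemma vector_field_add: "vector_field W q (p + r) = vector_field W q p + vector_field W q r"
  by (simp add: vector_field_def partial_add distrib_left sum.distrib)

lemma vector_field_sum: "vector_field W q (sum f S) = (\<Sum>s\<in>S. vector_field W q (f s))"
  unfolding vector_field_def partial_sum sum_distrib_left by (rule sum.swap)

lemma vector_field_mult: "vector_field W q (p * r) = vector_field W q p * r + vector_field W q r * p"
  by (simp add: vector_field_def partial_mult distrib_left sum.distrib sum_distrib_left mult_ac)

locale prime_ideal_mpoly =
  fixes P :: "'w mpoly set"
  assumes zero: "0 \<in> P"
    and add: "p \<in> P \<Longrightarrow> q \<in> P \<Longrightarrow> p + q \<in> P"
    and mult: "p \<in> P \<Longrightarrow> q * p \<in> P"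
    and prime: "p * q \<in> P \<Longrightarrow> p \<in> P \<or> q \<in> P"
    and one: "1 \<notin> P"
begin

lemma mult': "p \<in> P \<Longrightarrow> p * q \<in> P"
  using mult[of p q] by (simp add: mult.commute)

lemma uminus: "p \<in> P \<Longrightarrow> - p \<in> P"
  using mult[of p "- 1"] by simp

lemma diff: "p \<in> P \<Longrightarrow> q \<in> P \<Longrightarrow> p - q \<in> P"
  using add[of p "- q"] uminus by simp

lemma sum: "(\<And>s. s \<in> S \<Longrightarrow> f s \<in> P) \<Longrightarrow> sum f S \<in> P"
  by (induction S rule: infinite_finite_induct) (auto intro: zero add)

lemma power: "p \<notin> P \<Longrightarrow> p ^ n \<notin> P"
  by (induction n) (auto simp: one dest: prime)

lemma const: "c \<noteq> 0 \<Longrightarrow> const_poly c \<notin> P"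
  using mult[of "const_poly c" "const_poly (1 / c)"] one by (auto simp: const_poly_mult[symmetric])

text \<open>The field maps c * w^i to a multiple of its value at c plus a multiple of c, both in the
  ideal whatever the component of the field at \<open>w\<close> is.\<close>

lemma vector_field_coeffs:
  assumes "\<And>i. coeff (as_poly w r) i \<in> P"
    and "\<And>i. vector_field W q (coeff (as_poly w r) i) \<in> P"
  shows "vector_field W q r \<in> P"
proof -
  have "vector_field W q r = vector_field W q (\<Sum>i\<le>deg_in w r. coeff (as_poly w r) i * poly_var w ^ i)"
    by (rule arg_cong[OF as_poly_sum_powers])
  also have "\<dots> \<in> P"
    unfolding vector_field_sum vector_field_mult by (intro sum add mult mult' assms)
  finally show ?thesis .
qed

text \<open>By \<open>low\<close> the top term lies in the ideal and can be split off, and what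
  remains has smaller degree: below degree \<open>d\<close> the ideal imposes no relation on
  \<open>w\<close> itself.\<close>

lemma coeffs_in_ideal:
  assumes low: "\<And>m. m \<in> P \<Longrightarrow> m \<in> polys_on U \<Longrightarrow> m \<noteq> 0 \<Longrightarrow> deg_in w m < d \<Longrightarrow> lead_coeff (as_poly w m) \<in> P"
    and p: "p \<in> P" "p \<in> polys_on U" "p = 0 \<or> deg_in w p < d" and w: "w \<in> U"
  shows "coeff (as_poly w p) i \<in> P"
  using p
proof (induction "deg_in w p" arbitrary: p i rule: less_induct)
  case less
  show ?case
  proof (cases "p = 0")
    case False
    define c where "c = lead_coeff (as_poly w p)"
    define p' where "p' = p - c * poly_var w ^ deg_in w p"
    have "deg_in w p < d" using less.prems(3) False by simp
    then have c: "c \<in> P" "c \<in> polys_on (U - {w})"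
      unfolding c_def using less.prems(1,2) False by (auto intro!: low as_poly_coeff)
    have p'_as: "as_poly w p' = as_poly w p - monom c (deg_in w p)"
      unfolding p'_def as_poly_diff
      by (subst as_poly_var_power_mult) (use c in \<open>auto intro: polys_on_mono\<close>)
    have "coeff (as_poly w p') j = 0" if "j \<ge> deg_in w p" for j
      using that by (cases "j = deg_in w p") (auto simp: p'_as c_def deg_in_def coeff_eq_0)
    then have "p' = 0 \<or> deg_in w p' < deg_in w p"
      using leading_coeff_0_iff[of "as_poly w p'"] unfolding deg_in_def
        by (metis as_poly_eq_0_iff not_le)
    moreover have "p' \<in> P" unfolding p'_def using less.prems c by (intro diff mult')
    moreover have "p' \<in> polys_on U"
      unfolding p'_def using less.prems c w
      by (intro polys_on_diff polys_on_mult polys_on_power) (auto intro: polys_on_mono)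
    ultimately have "coeff (as_poly w p') i \<in> P"
      using less.hyps[of p' i] less.prems(3) False zero by fastforce
    moreover have "coeff (as_poly w p) i = coeff (as_poly w p') i + (if i = deg_in w p then c else 0)"
      by (simp add: p'_as)
    ultimately show ?thesis using c by (auto intro: add zero)
  qed (simp add: zero)
qed

text \<open>A vector field that preserves the ideal on the variables \<open>U\<close> extends to one more variable
  \<open>w\<close>. If \<open>m\<close> is an element of the ideal of minimal degree in \<open>w\<close> among those whose leading
  coefficient is not in the ideal, then \<open>m\<close> plays the role of the minimal polynomial of \<open>w\<close>
  and forces the component of the field at \<open>w\<close>; multiplying by \<open>partial w m\<close> clears its denominator.\<close>

lemma extend_vector_field:
  assumes W: "finite W" "w \<notin> W" "w \<notin> U" "v \<in> W" and q: "q v \<notin> P"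
    and pres: "\<And>p. p \<in> P \<Longrightarrow> p \<in> polys_on U \<Longrightarrow> vector_field W q p \<in> P"
  shows "\<exists>q'. q' v \<notin> P \<and> (\<forall>p\<in>P \<inter> polys_on (insert w U). vector_field (insert w W) q' p \<in> P)"
proof -
  define C where "C = {m \<in> P \<inter> polys_on (insert w U). m \<noteq> 0 \<and> lead_coeff (as_poly w m) \<notin> P}"
  have coeffU: "coeff (as_poly w p) i \<in> polys_on U" if "p \<in> polys_on (insert w U)" for p i
    using as_poly_coeff[OF that, of w] W(3) by simp
  have free: "partial w p = 0" if "p \<in> polys_on U" for p
    using that W(3) by (intro partial_free) (auto intro: polys_on_mono)
  have split: "vector_field (insert w W) q' p = q' w * partial w p + (\<Sum>u\<in>W. q' u * partial u p)"
    for q' p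
    using W by (simp add: vector_field_def)
  show ?thesis
  proof (cases "C = {}")
    case True
    \<comment> \<open>Here \<open>w\<close> is transcendental modulo the ideal: elements of the
      ideal have all their coefficients in it, so the component at \<open>w\<close> can be chosen as
      0.\<close>
    define q' where "q' = q(w := 0)"
    have eq: "vector_field (insert w W) q' p = vector_field W q p" for p
      unfolding split using W(2) by (auto simp: vector_field_def q'_def intro!: sum.cong)
    have "vector_field (insert w W) q' p \<in> P" if p: "p \<in> P" "p \<in> polys_on (insert w U)" for p
    proof (rule vector_field_coeffs[of w])
      show "coeff (as_poly w p) i \<in> P" for i
        by (rule coeffs_in_ideal[of "insert w U" w "Suc (deg_in w p)"])
            (use True p in \<open>auto simp: C_def\<close>)
      then show "vector_field (insert w W) q' (coeff (as_poly w p) i) \<in> P" for i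
        unfolding eq using coeffU[OF p(2)] by (intro pres)
    qed
    moreover have "q' v \<notin> P" using q W by (auto simp: q'_def)
    ultimately show ?thesis by blast
  next
    case False
    then obtain m where m: "m \<in> C" and min: "\<And>m'. m' \<in> C \<Longrightarrow> deg_in w m \<le> deg_in w m'"
      using ex_has_least_nat[of "\<lambda>m. m \<in> C" _ "deg_in w"] by blast
    have mP: "m \<in> P" "m \<in> polys_on (insert w U)" "m \<noteq> 0" "lead_coeff (as_poly w m) \<notin> P"
      using m by (auto simp: C_def)
    have coeffs: "coeff (as_poly w p) i \<in> P"
      if "p \<in> P" "p \<in> polys_on (insert w U)" "p = 0 \<or> deg_in w p < deg_in w m" for p i
      by (rule coeffs_in_ideal[of "insert w U" w "deg_in w m"])
        (use that min in \<open>auto simp: C_def not_less[symmetric]\<close>)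
    have pos: "deg_in w m > 0"
    proof (rule ccontr)
      assume "\<not> ?thesis"
      then have "as_poly w m = [:m:]" using deg_in_0_imp[of w m UNIV]
        by (intro as_poly_free) (auto simp: Compl_eq_Diff_UNIV)
      then show False using mP by simp
    qed
    \<comment> \<open>Separability in characteristic 0: the derivative has smaller degree than
      \<open>m\<close>, so if it were in the ideal, so would be its top coefficient, a non-zero
      integer multiple of the leading coefficient of \<open>m\<close>.\<close>
    have dm: "partial w m \<notin> P"
    proof
      assume dP: "partial w m \<in> P"
      let ?i = "deg_in w m - 1"
      have co: "coeff (as_poly w (partial w m)) j
          = (if j < deg_in w m then of_nat (Suc j) * coeff (as_poly w m) (Suc j) else 0)" for j
        unfolding as_poly_partial coeff_sum by (simp add: sum.delta)
      then have "degree (as_poly w (partial w m)) \<le> ?i" using pos by (intro degree_le) auto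
      then have "deg_in w (partial w m) < deg_in w m" using pos by (simp add: deg_in_def)
      then have "coeff (as_poly w (partial w m)) ?i \<in> P"
        using dP mP partial_in_polys_on by (intro coeffs) auto
      then have "of_nat (deg_in w m) * lead_coeff (as_poly w m) \<in> P"
        using pos by (simp add: co deg_in_def del: of_nat_Suc)
      then show False using prime mP(4) const pos unfolding of_nat_mpoly
        by (metis of_nat_0_eq_iff neq0_conv)
    qed
    \<comment> \<open>Chosen so that the new field annihilates \<open>m\<close>: it maps p to
      (dm/dw) times the old field at p minus the old field at m times dp/dw.\<close>
    define q' where "q' u = (if u = w then - vector_field W q m else partial w m * q u)" for u
    define D where "D = vector_field (insert w W) q'"
    have D: "D p = partial w m * vector_field W q p - vector_field W q m * partial w p" for p
    proof -
      have "(\<Sum>u\<in>W. q' u * partial u p) = partial w m * vector_field W q p"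
        unfolding vector_field_def sum_distrib_left
        by (intro sum.cong refl) (use W in \<open>auto simp: q'_def mult.assoc\<close>)
      then show ?thesis unfolding D_def split by (simp add: q'_def)
    qed
    have "D p \<in> P" if p: "p \<in> P" "p \<in> polys_on (insert w U)" for p
    proof -
      define a where "a = lead_coeff (as_poly w m)"
      \<comment> \<open>Modulo the ideal only the remainder \<open>r\<close> matters. Its
        coefficients lie in the ideal because its degree is below that of \<open>m\<close>, and the
        power of \<open>a\<close> can be cancelled at the end since \<open>a\<close> is outside the
        prime ideal.\<close>
      obtain n h r where nhr: "a ^ n * p = h * m + r" "h \<in> polys_on (insert w U)" "r
          \<in> polys_on (insert w U)"
        "r = 0 \<or> deg_in w r < deg_in w m"
        using pseudo_division[OF mP(3,2) p(2), of w] unfolding a_def by blast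
      have "a ^ n * p - h * m \<in> P" using p mP by (intro diff mult)
      then have rP: "r \<in> P" using nhr(1) by simp
      have "D r \<in> P"
        unfolding D_def
      proof (rule vector_field_coeffs[of w])
        show c: "coeff (as_poly w r) i \<in> P" for i using coeffs rP nhr by blast
        show "vector_field (insert w W) q' (coeff (as_poly w r) i) \<in> P" for i
          unfolding D_def[symmetric] D free[OF coeffU[OF nhr(3)]]
          using pres[OF c coeffU[OF nhr(3)]] by (simp add: mult)
      qed
      moreover have "D m = 0" unfolding D by (simp add: mult.commute)
      moreover have "D (a ^ n * p) = D (h * m) + D r" unfolding nhr(1) D_def by (rule vector_field_add)
      ultimately have "D (a ^ n) * p + D p * a ^ n = D h * m + D r"
        unfolding D_def vector_field_mult by simp
      then have "D p * a ^ n = D h * m + D r - D (a ^ n) * p" by (simp add: algebra_simps)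
      also have "\<dots> \<in> P" using \<open>D r \<in> P\<close> mP p by (intro diff add mult)
      finally show ?thesis using prime power[of a n] mP(4) unfolding a_def by blast
    qed
    moreover have "q' v \<notin> P" using q dm prime W by (auto simp: q'_def)
    ultimately show ?thesis unfolding D_def by blast
  qed
qed

text \<open>Starts from \<open>c * partial v\<close> on the variables \<open>U\<close>. Every
  variable of \<open>W\<close> receives its component in turn, while the component at
  \<open>v\<close> stays outside the ideal.\<close>

lemma extend_vector_field_finite:
  assumes "finite W" "W \<inter> U = {}" "v \<in> U" "c \<notin> P"
    and "\<And>p. p \<in> P \<Longrightarrow> p \<in> polys_on U \<Longrightarrow> c * partial v p \<in> P"
  shows "\<exists>q. q v \<notin> P \<and> (\<forall>p\<in>P \<inter> polys_on (U \<union> W). vector_field (insert v W) q p \<in> P)"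
  using assms(1,2)
proof (induction W rule: finite_induct)
  case empty
  then show ?case using assms by (intro exI[of _ "\<lambda>_. c"]) (auto simp: vector_field_def)
next
  case (insert w W)
  then obtain q where "q v \<notin> P" "\<And>p. p \<in> P \<Longrightarrow> p \<in> polys_on (U \<union> W) \<Longrightarrow> vector_field (insert v W) q p \<in> P"
    by auto
  then have "\<exists>q'. q' v \<notin> P \<and> (\<forall>p\<in>P \<inter> polys_on (insert w (U \<union> W)). vector_field (insert w (insert v W))
      q' p \<in> P)"
    using insert assms(3) by (intro extend_vector_field) auto
  then show ?case by (simp add: insert_commute)
qed

end

lemma partial_rename:
  assumes "inj f"
  shows "partial (f v) (rename_vars f p) = rename_vars f (partial v p)"
proof (rule partial_eqI)
  fix x
  have "poly_eval (rename_vars f p) (x(f v := z)) = poly_eval p ((x \<circ> f)(v := z))" for z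
    unfolding poly_eval_rename
    by (rule arg_cong[of _ _ "poly_eval p"]) (use assms in \<open>auto simp: fun_eq_iff inj_eq\<close>)
  then show "((\<lambda>z. poly_eval (rename_vars f p) (x(f v := z))) has_field_derivative
      poly_eval (rename_vars f (partial v p)) x) (at (x (f v)))"
    using has_derivative_partial[of p "x \<circ> f" v] by (simp add: poly_eval_rename)
qed

lemma prime_ideal_incidence:
  assumes "N \<subseteq> V"
  shows "prime_ideal_mpoly {F. vanishes_on F (incidence V N K e)}"
proof
  show "p \<in> {F. vanishes_on F (incidence V N K e)} \<or> q \<in> {F. vanishes_on F (incidence V N K e)}"
    if "p * q \<in> {F. vanishes_on F (incidence V N K e)}" for p q
    using that incidence_no_zero_divisors[OF assms, of p q K e] by auto
  have "case_sum (\<lambda>_. 0) (\<lambda>t. exp 0) \<in> incidence V N K e"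
    unfolding incidence_def
    by (intro CollectI exI[of _ "\<lambda>_. 0"] exI[of _ "\<lambda>_. 0"])
        (auto simp: singular_at_def affine_space_def)
  then show "1 \<notin> {F. vanishes_on F (incidence V N K e)}"
    by (auto simp: vanishes_on_def)
qed (auto simp: vanishes_on_def poly_eval_add poly_eval_mult)

text \<open>If \<open>partial n\<close> preserved the ideal of the singular locus, it would extend to a vector field
  tangent to the incidence variety. As the logarithmic derivatives of the Laurent polynomial vanish there,
  such a field maps the equation of the hypersurface to a multiple of the monomial with index \<open>n\<close>,
  which is nowhere zero.\<close>

lemma ex_partial_not_vanishing:
  assumes fin: "finite V" "finite K" and N: "N \<subseteq> V" and n: "n \<in> N"
  shows "\<exists>F\<in>polys_on V. vanishes_on F (singular_locus V N K e) \<and>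
    \<not> vanishes_on (partial n F) (singular_locus V N K e)"
proof (rule ccontr)
  assume contra: "\<not> ?thesis"
  define P where "P = {F. vanishes_on F (incidence V N K e)}"
  interpret prime_ideal_mpoly P unfolding P_def by (rule prime_ideal_incidence[OF N])
  have finN: "finite N" using fin(1) N finite_subset by blast
  have pres: "1 * partial (Inl n) p \<in> P" if p: "p \<in> P" "p \<in> polys_on (Inl ` V)" for p
  proof -
    \<comment> \<open>Inverse of renaming by \<open>Inl\<close>; the value \<open>n\<close> on the
      \<open>Inr\<close> side is a dummy, as \<open>p\<close> involves no such variable.\<close>
    define p0 where "p0 = rename_vars (case_sum id (\<lambda>_. n)) p"
    have p0: "p0 \<in> polys_on V"
      unfolding p0_def using rename_vars_in_polys_on[OF p(2), of "case_sum id (\<lambda>_. n)"]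
      by (simp add: image_image)
    have p_eq: "rename_vars Inl p0 = p" unfolding p0_def by (rule rename_vars_rename[OF p(2)]) auto
    then have "vanishes_on p0 (singular_locus V N K e)"
      using p(1) vanishes_on_incidence_Inl[of p0 V N K e] by (simp add: P_def)
    then have "vanishes_on (partial n p0) (singular_locus V N K e)" using contra p0 by blast
    moreover have "partial (Inl n) p = rename_vars Inl (partial n p0)"
      unfolding p_eq[symmetric] by (rule partial_rename) simp
    ultimately show ?thesis by (simp add: P_def vanishes_on_incidence_Inl)
  qed
  have "\<exists>q. q (Inl n) \<notin> P \<and>
      (\<forall>p\<in>P \<inter> polys_on (Inl ` V \<union> Inr ` K). vector_field (insert (Inl n) (Inr ` K)) q p \<in> P)"
    using fin(2) n N by (intro extend_vector_field_finite[OF _ _ _ one pres]) auto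
  then obtain q where q: "q (Inl n) \<notin> P"
    "\<And>p. p \<in> P \<Longrightarrow> p \<in> polys_on (Inl ` V \<union> Inr ` K) \<Longrightarrow> vector_field (insert (Inl n) (Inr ` K)) q p \<in> P"
    by blast
  \<comment> \<open>A common shift of all exponents by \<open>M\<close> turns the Laurent monomials
    into ordinary ones; it multiplies everything by an exponential, which never vanishes.\<close>
  define M where "M = nat (\<Sum>m\<in>N. \<Sum>t\<in>K. \<bar>e m t\<bar>)"
  have M: "0 \<le> e m t + int M" if "m \<in> N" "t \<in> K" for m t
  proof -
    have "\<bar>e m t\<bar> \<le> (\<Sum>t\<in>K. \<bar>e m t\<bar>)" using that fin by (intro member_le_sum) auto
    also have "\<dots> \<le> (\<Sum>m\<in>N. \<Sum>t\<in>K. \<bar>e m t\<bar>)"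
      using that finN by (intro member_le_sum[of m N "\<lambda>m. \<Sum>t\<in>K. \<bar>e m t\<bar>"]) (auto intro: sum_nonneg)
    finally show ?thesis unfolding M_def by linarith
  qed
  define Y where "Y m = (\<Prod>t\<in>K. poly_var (Inr t :: 'a + 'b) ^ nat (e m t + int M))" for m
  define f where "f = (\<Sum>m\<in>N. poly_var (Inl m) * Y m)"
  have YU: "Y m \<in> polys_on (Inr ` K)" for m
    unfolding Y_def by (intro polys_on_prod polys_on_power) auto
  have fU: "f \<in> polys_on (Inl ` V \<union> Inr ` K)"
    unfolding f_def using N by (intro polys_on_sum polys_on_mult) (auto intro: polys_on_mono[OF YU])
  have evY: "poly_eval (Y m) (case_sum x (\<lambda>t. exp (\<xi> t)))
      = exp (of_nat M * (\<Sum>t\<in>K. \<xi> t)) * char_exp K (e m) \<xi>" if "m \<in> N" for m x \<xi>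
  proof -
    have "poly_eval (Y m) (case_sum x (\<lambda>t. exp (\<xi> t))) = (\<Prod>t\<in>K. exp (\<xi> t) ^ nat (e m t + int M))"
      by (simp add: Y_def poly_eval_prod poly_eval_power)
    also have "\<dots> = (\<Prod>t\<in>K. exp (of_int (e m t + int M) * \<xi> t))"
      using M[OF that] by (intro prod.cong refl) (simp add: exp_of_nat_mult[symmetric])
    also have "\<dots> = exp (\<Sum>t\<in>K. of_int (e m t + int M) * \<xi> t)" using fin by (simp add: exp_sum)
    also have "(\<Sum>t\<in>K. of_int (e m t + int M) * \<xi> t) = of_nat M * (\<Sum>t\<in>K. \<xi> t) + (\<Sum>t\<in>K. of_int (e m t)
        * \<xi> t)"
      by (simp add: distrib_right sum.distrib sum_distrib_left)
    finally show ?thesis by (simp add: exp_add char_exp_def)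
  qed
  have evf: "poly_eval f (case_sum x (\<lambda>t. exp (\<xi> t)))
      = exp (of_nat M * (\<Sum>t\<in>K. \<xi> t)) * (\<Sum>m\<in>N. x m * char_exp K (e m) \<xi>)" for x \<xi>
    unfolding f_def by (simp add: poly_eval_sum poly_eval_mult evY sum_distrib_left mult_ac)
  have fP: "f \<in> P"
    by (auto simp: P_def vanishes_on_def incidence_def evf singular_at_def)
  have dn: "partial (Inl n) f = Y n"
  proof -
    have "partial (Inl n) (Y m) = 0" for m by (rule partial_free) (auto intro: polys_on_mono[OF YU])
    then have "partial (Inl n) f = (\<Sum>m\<in>N. if m = n then Y m else 0)"
      unfolding f_def partial_sum by (intro sum.cong refl) (auto simp: partial_mult partial_var)
    then show ?thesis using finN n by simp
  qed
  have dt: "partial (Inr t) f \<in> P" if t: "t \<in> K" for t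
  proof -
    have "poly_eval (partial (Inr t) f) (case_sum x (\<lambda>t. exp (\<xi> t))) = 0"
      if sing: "singular_at N K e x \<xi>" for x \<xi>
    proof -
      \<comment> \<open>Only the logarithm of the torus coordinate \<open>t\<close> moves. The
        derivative along this curve combines the value of the Laurent polynomial, which enters
        through the shift by \<open>M\<close>, and its logarithmic derivative; both are 0 at a
        singular point.\<close>
      define \<zeta> where "\<zeta> s u = \<xi> u + (if u = t then s else 0)" for s u
      define g where "g s = case_sum x (\<lambda>u. exp (\<zeta> s u))" for s
      have "((\<lambda>s. g s v) has_field_derivative (if v = Inr t then exp (\<xi> t) else 0)) (at 0)" for v
        by (cases v) (auto simp: g_def \<zeta>_def intro!: derivative_eq_intros)
      then have "((\<lambda>s. poly_eval f (g s)) has_field_derivative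
          (\<Sum>v\<in>Inl ` V \<union> Inr ` K. poly_eval (partial v f) (g 0) * (if v = Inr t then exp (\<xi> t)
              else 0))) (at 0)"
        using fin by (intro poly_eval_chain_rule fU) auto
      also have "(\<Sum>v\<in>Inl ` V \<union> Inr ` K. poly_eval (partial v f) (g 0) * (if v = Inr t then exp (\<xi> t)
          else 0))
          = poly_eval (partial (Inr t) f) (g 0) * exp (\<xi> t)"
        using fin t by (simp add: if_distrib[of "(*) _"] cong: if_cong)
      finally have d1: "((\<lambda>s. poly_eval f (g s)) has_field_derivative
          poly_eval (partial (Inr t) f) (g 0) * exp (\<xi> t)) (at 0)" .
      define E where "E = exp (of_nat M * (\<Sum>u\<in>K. \<xi> u))"
      have char: "char_exp K a (\<zeta> s) = char_exp K a \<xi> * exp (of_int (a t) * s)" for a s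
        using t fin unfolding \<zeta>_def char_exp_add
          by (simp add: char_exp_def if_distrib[of "(*) _"] cong: if_cong)
      have "exp (of_nat M * (\<Sum>u\<in>K. \<zeta> s u)) = E * exp (of_nat M * s)" for s
        using t fin by (simp add: \<zeta>_def E_def sum.distrib distrib_left exp_add)
      then have f_eq: "poly_eval f (g s) = E * exp (of_nat M * s) * (\<Sum>m\<in>N. x m * char_exp K (e m)
          \<xi> * exp (of_int (e m t) * s))" for s
        unfolding g_def evf by (simp add: char mult.assoc)
      have "((\<lambda>s. poly_eval f (g s)) has_field_derivative
          E * of_nat M * (\<Sum>m\<in>N. x m * char_exp K (e m) \<xi>) + E * (\<Sum>m\<in>N. x m * char_exp K (e m)
              \<xi> * of_int (e m t))) (at 0)"
        unfolding f_eq by (auto intro!: derivative_eq_intros simp: algebra_simps)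
      also have "E * of_nat M * (\<Sum>m\<in>N. x m * char_exp K (e m) \<xi>) + E * (\<Sum>m\<in>N. x m * char_exp K (e m)
          \<xi> * of_int (e m t)) = 0"
        using sing t by (simp add: singular_at_def mult_ac)
      finally have "poly_eval (partial (Inr t) f) (g 0) * exp (\<xi> t) = 0"
        using d1 DERIV_unique by blast
      then show ?thesis by (simp add: g_def \<zeta>_def)
    qed
    then show ?thesis by (auto simp: P_def vanishes_on_def incidence_def)
  qed
  have "vector_field (insert (Inl n) (Inr ` K)) q f = q (Inl n) * Y n + (\<Sum>v\<in>Inr ` K. q v * partial v f)"
    unfolding vector_field_def using fin by (subst sum.insert) (auto simp: dn)
  moreover have "(\<Sum>v\<in>Inr ` K. q v * partial v f) \<in> P" using dt by (auto intro!: sum mult)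
  moreover have "vector_field (insert (Inl n) (Inr ` K)) q f \<in> P" by (rule q(2)[OF fP fU])
  ultimately have "q (Inl n) * Y n + (\<Sum>v\<in>Inr ` K. q v * partial v f) - (\<Sum>v\<in>Inr ` K. q v * partial v f)
      \<in> P"
    by (intro diff) auto
  then have "q (Inl n) * Y n \<in> P" by simp
  then have "Y n \<in> P" using prime q(1) by blast
  moreover have "case_sum (\<lambda>_. 0) (\<lambda>t. exp 0) \<in> incidence V N K e"
    unfolding incidence_def
    by (intro CollectI exI[of _ "\<lambda>_. 0"] exI[of _ "\<lambda>_. 0"])
        (auto simp: singular_at_def affine_space_def)
  ultimately have "poly_eval (Y n) (case_sum (\<lambda>_. 0) (\<lambda>t. exp 0)) = 0"
    unfolding P_def vanishes_on_def by blast
  then show False using evY[OF n, of "\<lambda>_. 0" "\<lambda>_. 0"] by simp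
qed

lemma singular_locus_proper:
  assumes "finite V" "finite K" "N \<subseteq> V" "N \<noteq> {}"
  shows "\<exists>F\<in>polys_on V. F \<noteq> 0 \<and> vanishes_on F (singular_locus V N K e)"
proof -
  obtain n where "n \<in> N" using assms by auto
  then obtain F where F: "F \<in> polys_on V" "vanishes_on F (singular_locus V N K e)"
    "\<not> vanishes_on (partial n F) (singular_locus V N K e)"
    using ex_partial_not_vanishing[of V K N n e] assms by blast
  then have "F \<noteq> 0" by (auto simp: vanishes_on_def)
  then show ?thesis using F by blast
qed

text \<open>If \<open>G\<close> were free of \<open>n\<close>, differentiating a multiple
  \<open>G * h\<close> by \<open>n\<close> would give a multiple of \<open>G\<close> again, so the
  derivative of every vanishing polynomial would vanish as well.\<close>

lemma hypersurface_involves: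
  assumes "finite V" "finite K" "N \<subseteq> V" "n \<in> N" and G: "hypersurface V (singular_locus V N K e) G"
  shows "G \<notin> polys_on (V - {n})"
proof
  assume "G \<in> polys_on (V - {n})"
  then have dG: "partial n G = 0" by (intro partial_free) (auto intro: polys_on_mono)
  obtain F where F: "F \<in> polys_on V" "vanishes_on F (singular_locus V N K e)"
    "\<not> vanishes_on (partial n F) (singular_locus V N K e)"
    using ex_partial_not_vanishing[of V K N n e] assms by blast
  then obtain h where "F = G * h" using G by (auto simp: hypersurface_def elim: dvdE)
  then have "partial n F = G * partial n h" by (simp add: partial_mult dG mult.commute)
  moreover have "vanishes_on G (singular_locus V N K e)" using G by (auto simp: hypersurface_def)
  ultimately show False using F(3) vanishes_on_dvd[of G] by auto
qed

section \<open>Linear algebra\<close>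

lemma homogeneous_system:
  fixes z :: "'i \<Rightarrow> 'e \<Rightarrow> complex"
  assumes "finite E" "finite P" "card E < card P"
  shows "\<exists>\<mu>. (\<exists>i\<in>P. \<mu> i \<noteq> 0) \<and> (\<forall>f\<in>E. (\<Sum>i\<in>P. \<mu> i * z i f) = 0)"
  using assms
proof (induction E arbitrary: P z rule: finite_induct)
  case empty
  then have "P \<noteq> {}" by auto
  then show ?case by (intro exI[of _ "\<lambda>_. 1"]) auto
next
  case (insert e E)
  show ?case
  proof (cases "\<forall>i\<in>P. z i e = 0")
    case True
    have "card E < card P" using insert by simp
    then obtain \<mu> where "\<exists>i\<in>P. \<mu> i \<noteq> 0" "\<forall>f\<in>E. (\<Sum>i\<in>P. \<mu> i * z i f) = 0"
      using insert.IH[of P z] insert.prems by blast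
    then show ?thesis using True by (intro exI[of _ \<mu>]) auto
  next
    case False
    then obtain p where p: "p \<in> P" "z p e \<noteq> 0" by blast
    define z' where "z' i f = z i f - z i e / z p e * z p f" for i f
    have "card E < card (P - {p})" using insert p by (simp add: card_Diff_singleton)
    then obtain \<mu> where \<mu>: "\<exists>i\<in>P - {p}. \<mu> i \<noteq> 0" "\<And>f. f \<in> E \<Longrightarrow> (\<Sum>i\<in>P - {p}. \<mu> i * z' i f) = 0"
      using insert.IH[of "P - {p}" z'] insert.prems by blast
    define \<nu> where "\<nu> = \<mu>(p := - (\<Sum>i\<in>P - {p}. \<mu> i * (z i e / z p e)))"
    have "(\<Sum>i\<in>P. \<nu> i * z i f) = (\<Sum>i\<in>P - {p}. \<mu> i * z' i f)" for f
    proof -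
      have "(\<Sum>i\<in>P. \<nu> i * z i f) = \<nu> p * z p f + (\<Sum>i\<in>P - {p}. \<nu> i * z i f)"
        using insert.prems(1) p(1) by (rule sum.remove)
      also have "(\<Sum>i\<in>P - {p}. \<nu> i * z i f) = (\<Sum>i\<in>P - {p}. \<mu> i * z i f)"
        by (intro sum.cong) (auto simp: \<nu>_def)
      finally show ?thesis
        by (simp add: \<nu>_def z'_def right_diff_distrib sum_subtractf sum_distrib_right mult.assoc)
    qed
    moreover have "z' i e = 0" for i using p by (simp add: z'_def)
    ultimately have "(\<Sum>i\<in>P. \<nu> i * z i f) = 0" if "f \<in> insert e E" for f
      using that \<mu>(2) by auto
    moreover have "\<exists>i\<in>P. \<nu> i \<noteq> 0" using \<mu>(1) by (auto simp: \<nu>_def)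
    ultimately show ?thesis by blast
  qed
qed

text \<open>\<open>dim\<close> takes the default value 0 on sets of infinite rank, so monotonicity
  needs a bound on the rank of \<open>Y\<close>, here its finiteness.\<close>

lemma dim_finite_mono:
  fixes X Y :: "'v :: real_vector set"
  assumes "X \<subseteq> Y" "finite Y"
  shows "dim X \<le> dim Y"
proof -
  obtain B where B: "B \<subseteq> X" "independent B" "X \<subseteq> span B" "card B = dim X"
    using real_vector.basis_exists by blast
  have "B \<subseteq> Y" using B assms by auto
  then obtain C where C: "B \<subseteq> C" "C \<subseteq> Y" "independent C" "Y \<subseteq> span C"
    using real_vector.maximal_independent_subset_extend[of B Y] B(2) by blast
  then have "card C = dim Y" using real_vector.basis_card_eq_dim by blast
  moreover have "card B \<le> card C" using C assms finite_subset by (intro card_mono) auto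
  ultimately show ?thesis using B by simp
qed

text \<open>Extend a basis of the intersection first to \<open>X\<close>, then to the union. The
  vectors added last avoid \<open>X\<close>, so they lie in \<open>Y\<close> and are independent of
  the initial basis.\<close>

lemma dim_finite_submodular:
  fixes X Y :: "'v :: real_vector set"
  assumes "finite X" "finite Y"
  shows "dim (X \<union> Y) + dim (X \<inter> Y) \<le> dim X + dim Y"
proof -
  obtain B0 where B0: "B0 \<subseteq> X \<inter> Y" "independent B0" "X \<inter> Y \<subseteq> span B0" "card B0 = dim (X \<inter> Y)"
    using real_vector.basis_exists by blast
  obtain B1 where B1: "B0 \<subseteq> B1" "B1 \<subseteq> X" "independent B1" "X \<subseteq> span B1"
    using real_vector.maximal_independent_subset_extend[of B0 X] B0 by blast
  obtain B2 where B2: "B1 \<subseteq> B2" "B2 \<subseteq> X \<union> Y" "independent B2" "X \<union> Y \<subseteq> span B2"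
    using real_vector.maximal_independent_subset_extend[of B1 "X \<union> Y"] B1 by blast
  have fin: "finite B0" "finite B1" "finite B2" using assms B0(1) B1(2) B2(2) finite_subset by blast+
  have "b \<notin> X" if b: "b \<in> B2 - B1" for b
  proof
    assume "b \<in> X"
    then have "b \<in> span (B2 - {b})"
      using B1(4) B2(1) b real_vector.span_mono[of B1 "B2 - {b}"] by auto
    then show False using B2(3) b real_vector.dependent_def by blast
  qed
  then have sub: "B0 \<union> (B2 - B1) \<subseteq> Y" using B0 B2 by blast
  have "independent (B0 \<union> (B2 - B1))"
    using B2(1,3) B1(1) by (intro real_vector.independent_mono[OF B2(3)]) auto
  then have "card (B0 \<union> (B2 - B1)) = dim (B0 \<union> (B2 - B1))"
    using real_vector.dim_eq_card_independent by metis
  also have "\<dots> \<le> dim Y" using sub assms(2) by (rule dim_finite_mono)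
  finally have "card B0 + (card B2 - card B1) \<le> dim Y"
    using fin B1(1) B2(1) by (subst (asm) card_Un_disjoint) (auto simp: card_Diff_subset)
  moreover have "card B1 = dim X" "card B2 = dim (X \<union> Y)"
    using B1 B2 real_vector.basis_card_eq_dim by blast+
  moreover have "card B1 \<le> card B2" using fin B2(1) by (intro card_mono)
  ultimately show ?thesis using B0(4) by linarith
qed

text \<open>Rado's theorem: by submodularity, the rank condition survives the removal of one of any two
  elements of a set, until all sets are singletons.\<close>

lemma ex_independent_transversal:
  fixes B :: "'i \<Rightarrow> 'v :: real_vector set"
  assumes D: "finite D" and Q: "finite Q" and "\<And>i. i \<in> Q \<Longrightarrow> finite (B i)"
    and "\<And>P. P \<subseteq> Q \<Longrightarrow> dim (D \<union> (\<Union>i\<in>P. B i)) \<ge> dim D + card P"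
  shows "\<exists>b. (\<forall>i\<in>Q. b i \<in> B i) \<and> dim (D \<union> b ` Q) \<ge> dim D + card Q"
  using assms(3,4)
proof (induction "\<Sum>i\<in>Q. card (B i)" arbitrary: B rule: less_induct)
  case less
  note hall = less.prems(2)
  have ne: "B i \<noteq> {}" if "i \<in> Q" for i using hall[of "{i}"] that by auto
  show ?case
  proof (cases "\<forall>i\<in>Q. card (B i) = 1")
    case True
    define b where "b i = (THE x. x \<in> B i)" for i
    have Bb: "B i = {b i}" if i: "i \<in> Q" for i
    proof -
      from True i obtain x where "B i = {x}" by (meson card_1_singletonE)
      then show ?thesis by (simp add: b_def)
    qed
    then have "(\<Union>i\<in>Q. B i) = b ` Q" by auto
    then show ?thesis using hall[of Q] Bb by (intro exI[of _ b]) auto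
  next
    case False
    then obtain k where k: "k \<in> Q" "card (B k) \<noteq> 1" by blast
    have "\<not> B k \<subseteq> {x}" for x
      using k ne[of k] by (auto simp: subset_singleton_iff)
    then obtain x y where xy: "x \<in> B k" "y \<in> B k" "x \<noteq> y"
      by (metis ne k(1) ex_in_conv singletonI subsetI singleton_iff)
    define C where "C v = B(k := B k - {v})" for v
    have smaller: "(\<Sum>i\<in>Q. card (C v i)) < (\<Sum>i\<in>Q. card (B i))" if "v \<in> B k" for v
    proof (rule sum_strict_mono_ex1[OF Q])
      show "\<forall>i\<in>Q. card (C v i) \<le> card (B i)" using less.prems(1) by (auto simp: C_def intro!: card_mono)
      show "\<exists>i\<in>Q. card (C v i) < card (B i)"
      proof (rule bexI[OF _ k(1)])
        have "C v k \<subset> B k" using that by (auto simp: C_def)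
        then show "card (C v k) < card (B k)" using less.prems(1)[OF k(1)]
          by (rule psubset_card_mono[rotated])
      qed
    qed
    have reduce: ?thesis
      if v: "v \<in> B k" and h: "\<And>P. P \<subseteq> Q \<Longrightarrow> dim (D \<union> (\<Union>i\<in>P. C v i)) \<ge> dim D + card P" for v
    proof -
      have "finite (C v i)" if "i \<in> Q" for i
        using less.prems(1)[OF that] less.prems(1)[OF k(1)] by (simp add: C_def)
      then obtain b where "\<forall>i\<in>Q. b i \<in> C v i" "dim (D \<union> b ` Q) \<ge> dim D + card Q"
        using less.hyps[OF smaller[OF v]] h by blast
      moreover have "C v i \<subseteq> B i" for i by (auto simp: C_def)
      ultimately show ?thesis by blast
    qed
    \<comment> \<open>A violated condition must involve \<open>k\<close>, since \<open>C v\<close>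
      and \<open>B\<close> agree elsewhere. Expressed through \<open>P - {k}\<close> the strict
      inequality becomes a weak one.\<close>
    have bad: "\<exists>P. P \<subseteq> Q - {k} \<and> dim (D \<union> (\<Union>i\<in>P. B i) \<union> (B k - {v})) \<le> dim D + card P"
      if "P \<subseteq> Q" "\<not> dim (D \<union> (\<Union>i\<in>P. C v i)) \<ge> dim D + card P" for P v
    proof -
      have kP: "k \<in> P"
      proof (rule ccontr)
        assume "k \<notin> P"
        then have "(\<Union>i\<in>P. C v i) = (\<Union>i\<in>P. B i)" by (auto simp: C_def)
        then show False using that hall by auto
      qed
      then have "D \<union> (\<Union>i\<in>P. C v i) = D \<union> (\<Union>i\<in>P - {k}. B i) \<union> (B k - {v})" by (auto simp: C_def)
      moreover have "card P = Suc (card (P - {k}))"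
        using kP that(1) Q finite_subset card.remove by metis
      ultimately show ?thesis using that by (intro exI[of _ "P - {k}"]) auto
    qed
    show ?thesis
    proof (rule ccontr)
      assume contra: "\<not> ?thesis"
      from contra reduce[OF xy(1)] have "\<exists>P\<subseteq>Q. \<not> dim (D \<union> (\<Union>i\<in>P. C x i)) \<ge> dim D + card P" by blast
      then obtain P1 where
        P1: "P1 \<subseteq> Q - {k}" "dim (D \<union> (\<Union>i\<in>P1. B i) \<union> (B k - {x})) \<le> dim D + card P1"
          by (elim exE conjE) (drule (1) bad, blast)
      from contra reduce[OF xy(2)] have "\<exists>P\<subseteq>Q. \<not> dim (D \<union> (\<Union>i\<in>P. C y i)) \<ge> dim D + card P" by blast
      then obtain P2 where
        P2: "P2 \<subseteq> Q - {k}" "dim (D \<union> (\<Union>i\<in>P2. B i) \<union> (B k - {y})) \<le> dim D + card P2"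
          by (elim exE conjE) (drule (1) bad, blast)
      define X where "X = D \<union> (\<Union>i\<in>P1. B i) \<union> (B k - {x})"
      define Y where "Y = D \<union> (\<Union>i\<in>P2. B i) \<union> (B k - {y})"
      have finP: "finite P1" "finite P2" using P1 P2 Q finite_subset by blast+
      have fin: "finite X" "finite Y"
        using P1(1) P2(1) k less.prems(1) D finP by (auto simp: X_def Y_def)
      \<comment> \<open>As \<open>x\<close> and \<open>y\<close> differ, the union recovers all of
        \<open>B k\<close>, and the element \<open>k\<close> contributes 1 to the lower bound for
        its rank. With the bound for the intersection this exceeds by 1 what submodularity
        permits.\<close>
      have "X \<union> Y = D \<union> (\<Union>i\<in>insert k (P1 \<union> P2). B i)" using xy by (auto simp: X_def Y_def)
      moreover have "insert k (P1 \<union> P2) \<subseteq> Q" using P1 P2 k by auto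
      ultimately have "dim (X \<union> Y) \<ge> dim D + card (insert k (P1 \<union> P2))"
        using hall[of "insert k (P1 \<union> P2)"] by simp
      moreover have "card (insert k (P1 \<union> P2)) = Suc (card (P1 \<union> P2))"
        using P1 P2 finP by (intro card_insert_disjoint) auto
      moreover have "dim (X \<inter> Y) \<ge> dim D + card (P1 \<inter> P2)"
      proof -
        have "dim D + card (P1 \<inter> P2) \<le> dim (D \<union> (\<Union>i\<in>P1 \<inter> P2. B i))" using hall P1 by blast
        also have "\<dots> \<le> dim (X \<inter> Y)" using fin by (intro dim_finite_mono) (auto simp: X_def Y_def)
        finally show ?thesis .
      qed
      moreover have "card (P1 \<union> P2) + card (P1 \<inter> P2) = card P1 + card P2"
        using card_Un_Int[OF finP] by simp
      ultimately show False
        using dim_finite_submodular[OF fin] P1(2) P2(2) unfolding X_def[symmetric] Y_def[symmetric]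
          by linarith
    qed
  qed
qed

section \<open>Direction spaces of sets and of their convex hulls\<close>

lemma span_differences_eq:
  assumes "x0 \<in> S"
  shows "span {x - y | x y. x \<in> S \<and> y \<in> S} = span {x - x0 | x. x \<in> S}"
proof (rule antisym)
  have "x - y \<in> span {x - x0 | x. x \<in> S}" if "x \<in> S" "y \<in> S" for x y
  proof -
    have "x - y = (x - x0) - (y - x0)" by simp
    also have "\<dots> \<in> span {x - x0 | x. x \<in> S}" using that
      by (intro real_vector.span_diff real_vector.span_base) auto
    finally show ?thesis .
  qed
  then show "span {x - y | x y. x \<in> S \<and> y \<in> S} \<subseteq> span {x - x0 | x. x \<in> S}"
    by (intro real_vector.span_minimal) auto
  show "span {x - x0 | x. x \<in> S} \<subseteq> span {x - y | x y. x \<in> S \<and> y \<in> S}"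
    using assms by (intro real_vector.span_mono) auto
qed

text \<open>The points whose difference from a fixed \<open>x0\<close> in \<open>S\<close> lies in
  the direction space form an affine subspace, hence a convex set containing
  \<open>S\<close>.\<close>

lemma span_differences_convex_hull:
  assumes "S \<noteq> {}"
  shows "span {x - y | x y. x \<in> convex hull S \<and> y \<in> convex hull S} = span {x - y | x y. x \<in> S \<and> y \<in> S}"
proof -
  obtain x0 where x0: "x0 \<in> S" using assms by blast
  define L where "L = span {x - x0 | x. x \<in> S}"
  have "convex hull S \<subseteq> {x. x - x0 \<in> L}"
  proof (rule hull_minimal)
    show "S \<subseteq> {x. x - x0 \<in> L}" unfolding L_def by (auto intro: real_vector.span_base)
    show "convex {x. x - x0 \<in> L}"
    proof (rule convexI)
      fix x y and u v :: real
      assume *: "x \<in> {x. x - x0 \<in> L}" "y \<in> {x. x - x0 \<in> L}" "u + v = 1"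
      have "u *\<^sub>R x + v *\<^sub>R y - x0 = u *\<^sub>R x + v *\<^sub>R y - (u + v) *\<^sub>R x0" using * by simp
      also have "\<dots> = u *\<^sub>R (x - x0) + v *\<^sub>R (y - x0)" by (simp add: algebra_simps)
      also have "\<dots> \<in> L" using * unfolding L_def
        by (auto intro: real_vector.span_add real_vector.span_scale)
      finally show "u *\<^sub>R x + v *\<^sub>R y \<in> {x. x - x0 \<in> L}" by simp
    qed
  qed
  then have "{x - x0 | x. x \<in> convex hull S} \<subseteq> L" by auto
  then have "span {x - x0 | x. x \<in> convex hull S} \<subseteq> L"
    unfolding L_def by (intro real_vector.span_minimal) auto
  moreover have "L \<subseteq> span {x - x0 | x. x \<in> convex hull S}"
    unfolding L_def by (intro real_vector.span_mono) (auto intro: hull_inc)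
  ultimately show ?thesis
    using span_differences_eq[OF x0] span_differences_eq[OF hull_inc[OF x0], of convex]
      unfolding L_def by simp
qed

section \<open>Dimensions of Minkowski sums\<close>

definition real_vec :: "('k \<Rightarrow> int) \<Rightarrow> 'k \<Rightarrow> real" where
  "real_vec a = (\<lambda>t. of_int (a t))"

lemma real_vec_add: "real_vec (a + b) = real_vec a + real_vec b"
  by (simp add: real_vec_def fun_eq_iff)

text \<open>Spans the direction space of the Minkowski sum, but is a finite set and a union over
  \<open>J\<close>, which is the form that Rado's theorem takes.\<close>

definition differences :: "('i \<Rightarrow> ('k \<Rightarrow> int) set) \<Rightarrow> 'i set \<Rightarrow> ('k \<Rightarrow> real) set" where
  "differences A J = (\<Union>j\<in>J. {real_vec a - real_vec b | a b. a \<in> A j \<and> b \<in> A j})"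

lemma finite_differences:
  assumes "finite J" "\<And>j. j \<in> J \<Longrightarrow> finite (A j)"
  shows "finite (differences A J)"
proof -
  have "{real_vec a - real_vec b | a b. a \<in> A j \<and> b \<in> A j} = (\<lambda>(a, b). real_vec a - real_vec b)
      ` (A j \<times> A j)" for j
    by auto
  then show ?thesis using assms by (simp add: differences_def)
qed

lemma differences_mono: "J \<subseteq> J' \<Longrightarrow> differences A J \<subseteq> differences A J'"
  by (auto simp: differences_def)

text \<open>A difference of sums is a sum of differences; conversely, holding one summand fixed
  produces the differences of the other.\<close>

lemma span_differences_sum:
  assumes "finite J" "\<And>j. j \<in> J \<Longrightarrow> A j \<noteq> {}"
  shows "(\<Sum>j\<in>J. A j) \<noteq> {} \<and> span {real_vec a - real_vec b | a b. a \<in> (\<Sum>j\<in>J. A j) \<and> b \<in> (\<Sum>j\<in>J. A j)}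
    = span (differences A J)"
  using assms
proof (induction J rule: finite_induct)
  case empty
  have "{real_vec a - real_vec b |a b. a \<in> ({0} :: ('b \<Rightarrow> int) set) \<and> b \<in> ({0} :: ('b \<Rightarrow> int) set)} = {0}"
    by auto
  then have "span {real_vec a - real_vec b |a b. a \<in> ({0} :: ('b \<Rightarrow> int) set) \<and> b \<in> ({0} :: ('b \<Rightarrow> int)
      set)} = span {}"
    by (simp only: real_vector.span_insert_0)
  then show ?case by (simp only: sum.empty set_zero differences_def UN_empty) simp
next
  case (insert j J)
  let ?S = "\<Sum>j\<in>J. A j"
  let ?d = "\<lambda>S. {real_vec a - real_vec b | a b. a \<in> S \<and> b \<in> S}"
  have IH: "?S \<noteq> {}" "span (?d ?S) = span (differences A J)"
    using insert.IH insert.prems by blast+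
  have Aj: "A j \<noteq> {}" using insert by auto
  have sum: "(\<Sum>j\<in>insert j J. A j) = A j + ?S" using insert by simp
  have "A j + ?S \<noteq> {}" using IH(1) Aj by (auto simp: set_plus_def)
  moreover have "span (?d (A j + ?S)) = span (differences A (insert j J))"
  proof (rule antisym)
    have diff: "differences A (insert j J) = ?d (A j) \<union> differences A J" by (auto simp: differences_def)
    show "span (?d (A j + ?S)) \<subseteq> span (differences A (insert j J))"
    proof (rule real_vector.span_minimal, safe)
      fix a b assume "a \<in> A j + ?S" "b \<in> A j + ?S"
      then obtain u v u' v' where uv: "a = u + v" "b = u' + v'" "u \<in> A j" "u' \<in> A j" "v \<in> ?S" "v' \<in> ?S"
        by (auto simp: set_plus_def)
      have "real_vec v - real_vec v' \<in> span (?d ?S)" using uv by (intro real_vector.span_base) auto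
      then have "real_vec v - real_vec v' \<in> span (differences A (insert j J))"
        using IH(2) real_vector.span_mono[of "differences A J" "differences A (insert j J)"] diff
          by auto
      moreover have "real_vec u - real_vec u' \<in> span (differences A (insert j J))"
        using uv diff by (intro real_vector.span_base) auto
      moreover have "real_vec a - real_vec b = (real_vec u - real_vec u') + (real_vec v - real_vec v')"
        by (simp add: uv real_vec_add)
      ultimately show "real_vec a - real_vec b \<in> span (differences A (insert j J))"
        using real_vector.span_add by metis
    qed
    obtain u0 v0 where 0: "u0 \<in> A j" "v0 \<in> ?S" using Aj IH(1) by blast
    have "?d (A j) \<subseteq> ?d (A j + ?S)"
    proof safe
      fix a b assume "a \<in> A j" "b \<in> A j"
      then have "a + v0 \<in> A j + ?S" "b + v0 \<in> A j + ?S" using 0 by auto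
      moreover have "real_vec a - real_vec b = real_vec (a + v0) - real_vec (b + v0)"
        by (simp add: real_vec_add)
      ultimately show "\<exists>c d. real_vec a - real_vec b = real_vec c - real_vec d \<and> c \<in> A j + ?S \<and> d
          \<in> A j + ?S" by blast
    qed
    then have 1: "?d (A j) \<subseteq> span (?d (A j + ?S))" using real_vector.span_superset by blast
    have "?d ?S \<subseteq> ?d (A j + ?S)"
    proof safe
      fix a b assume "a \<in> ?S" "b \<in> ?S"
      then have "u0 + a \<in> A j + ?S" "u0 + b \<in> A j + ?S" using 0 by auto
      moreover have "real_vec a - real_vec b = real_vec (u0 + a) - real_vec (u0 + b)"
        by (simp add: real_vec_add)
      ultimately show "\<exists>c d. real_vec a - real_vec b = real_vec c - real_vec d \<and> c \<in> A j + ?S \<and> d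
          \<in> A j + ?S" by blast
    qed
    then have "span (?d ?S) \<subseteq> span (?d (A j + ?S))" by (rule real_vector.span_mono)
    then have "differences A J \<subseteq> span (?d (A j + ?S))" using IH(2) real_vector.span_superset by blast
    with 1 show "span (differences A (insert j J)) \<subseteq> span (?d (A j + ?S))"
      unfolding diff by (intro real_vector.span_minimal) auto
  qed
  ultimately show ?case unfolding sum by (intro conjI)
qed

lemma codim_eq:
  assumes "finite J" "\<And>j. j \<in> J \<Longrightarrow> A j \<noteq> {}"
  shows "codim A J = int (dim (differences A J)) - int (card J)"
proof -
  let ?S = "\<Sum>j\<in>J. A j"
  note * = span_differences_sum[OF assms]
  have "{x - y |x y. x \<in> real_vec ` ?S \<and> y \<in> real_vec ` ?S} = {real_vec a - real_vec b | a b. a \<in> ?S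
      \<and> b \<in> ?S}"
    by auto
  then have "span {x - y |x y. x \<in> convex hull (real_vec ` ?S) \<and> y \<in> convex hull (real_vec ` ?S)}
      = span (differences A J)"
    using * by (subst span_differences_convex_hull) auto
  moreover have rv: "(\<lambda>a t. real_of_int (a t)) = real_vec" by (simp add: real_vec_def fun_eq_iff)
  ultimately have "lattice_dim ?S = dim (differences A J)"
    unfolding lattice_dim_def Let_def rv by (intro real_vector.span_eq_dim)
  then show ?thesis by (simp add: codim_def)
qed

section \<open>Systems of Laurent polynomials\<close>

locale supports =
  fixes I :: "'i set" and K :: "'k set" and A :: "'i \<Rightarrow> ('k \<Rightarrow> int) set"
  assumes finite_I: "finite I" and finite_K: "finite K"
    and finite_A: "\<And>i. i \<in> I \<Longrightarrow> finite (A i)"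
begin

abbreviation V :: "('i \<times> ('k \<Rightarrow> int)) set" where "V \<equiv> Sigma I A"

definition val :: "('i \<times> ('k \<Rightarrow> int) \<Rightarrow> complex) \<Rightarrow> 'i \<Rightarrow> ('k \<Rightarrow> complex) \<Rightarrow> complex" where
  "val x i \<xi> = (\<Sum>a\<in>A i. x (i, a) * char_exp K a \<xi>)"

text \<open>The derivative of \<open>val x i\<close> with respect to \<open>\<xi> t\<close>, that
  is, y_t times the partial derivative; linear relations at a torus point are the same for
  both.\<close>

definition log_grad :: "('i \<times> ('k \<Rightarrow> int) \<Rightarrow> complex) \<Rightarrow> 'i \<Rightarrow> ('k \<Rightarrow> complex) \<Rightarrow> 'k \<Rightarrow> complex" where
  "log_grad x i \<xi> t = (\<Sum>a\<in>A i. x (i, a) * of_int (a t) * char_exp K a \<xi>)"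

definition dependent_systems :: "'i set \<Rightarrow> 'i set \<Rightarrow> ('i \<times> ('k \<Rightarrow> int) \<Rightarrow> complex) set" where
  "dependent_systems J H = {x \<in> affine_space V. \<exists>\<xi> \<nu>. (\<forall>i\<in>H. val x i \<xi> = 0) \<and> (\<forall>j\<in>J. \<nu> j \<noteq> 0) \<and>
     (\<forall>t\<in>K. (\<Sum>j\<in>J. \<nu> j * log_grad x j \<xi> t) = 0)}"

lemma finite_V: "finite V"
  using finite_I finite_A by auto

lemma laurent_exp:
  assumes "\<And>t. t \<in> K \<Longrightarrow> y t = exp (\<xi> t)"
  shows "laurent K (A i) (\<lambda>a. x (i, a)) y = val x i \<xi>"
proof -
  have "(\<Prod>t\<in>K. y t powi a t) = char_exp K a \<xi>" for a
    using assms finite_K by (simp add: char_exp_def exp_sum exp_power_int)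
  then show ?thesis by (simp add: laurent_def val_def)
qed

lemma partial_deriv_exp:
  assumes y: "\<And>t. t \<in> K \<Longrightarrow> y t = exp (\<xi> t)" and t: "t \<in> K"
  shows "y t * partial_deriv t (laurent K (A i) (\<lambda>a. x (i, a))) y = log_grad x i \<xi> t"
proof -
  have char: "(\<Prod>t\<in>K. y t powi a t) = char_exp K a \<xi>" for a
    using y finite_K by (simp add: char_exp_def exp_sum exp_power_int)
  have yt: "y t \<noteq> 0" using y[OF t] by simp
  define R where "R a = (\<Prod>u\<in>K - {t}. y u powi a u)" for a
  have R: "(\<Prod>u\<in>K. (y(t := z)) u powi a u) = z powi a t * R a" for a z
    using finite_K t by (subst prod.remove[of K t]) (auto simp: R_def intro!: prod.cong)
  have "((\<lambda>z. laurent K (A i) (\<lambda>a. x (i, a)) (y(t := z))) has_field_derivative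
      (\<Sum>a\<in>A i. x (i, a) * (of_int (a t) * y t powi (a t - 1) * R a))) (at (y t))"
    unfolding laurent_def R using yt by (auto intro!: derivative_eq_intros sum.cong simp: mult_ac)
  then have "partial_deriv t (laurent K (A i) (\<lambda>a. x (i, a))) y
      = (\<Sum>a\<in>A i. x (i, a) * (of_int (a t) * y t powi (a t - 1) * R a))"
    unfolding partial_deriv_def by (rule DERIV_imp_deriv)
  then have "y t * partial_deriv t (laurent K (A i) (\<lambda>a. x (i, a))) y
      = (\<Sum>a\<in>A i. x (i, a) * of_int (a t) * ((y t * y t powi (a t - 1)) * R a))"
    by (simp add: sum_distrib_left mult_ac)
  also have "\<dots> = (\<Sum>a\<in>A i. x (i, a) * of_int (a t) * char_exp K a \<xi>)"
  proof (intro sum.cong refl)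
    fix a
    have "y t * y t powi (a t - 1) = y t powi a t" using yt by (simp add: power_int_diff)
    then show "x (i, a) * of_int (a t) * ((y t * y t powi (a t - 1)) * R a)
        = x (i, a) * of_int (a t) * char_exp K a \<xi>"
      using R[of "y t" a] char[of a] by simp
  qed
  finally show ?thesis by (simp add: log_grad_def)
qed

text \<open>The systems are sorted by the support \<open>J\<close> of their relation. Logarithms of
  torus coordinates come from \<open>Ln\<close>, and the factor \<open>y t\<close> between the two
  kinds of derivatives is non-zero.\<close>

lemma singular_systems_eq: "singular_systems K I A = (\<Union>J\<in>Pow I - {{}}. dependent_systems J I)"
proof (intro equalityI subsetI)
  fix x assume "x \<in> singular_systems K I A"
  then obtain y \<mu> where x: "x \<in> affine_space V" and y: "y \<in> torus K"
    and val: "\<And>i. i \<in> I \<Longrightarrow> laurent K (A i) (\<lambda>a. x (i, a)) y = 0"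
    and \<mu>: "\<exists>i\<in>I. \<mu> i \<noteq> 0"
    and grad: "\<And>t. t \<in> K \<Longrightarrow> (\<Sum>i\<in>I. \<mu> i * partial_deriv t (laurent K (A i) (\<lambda>a. x (i, a))) y) = 0"
    unfolding singular_systems_def by blast
  define \<xi> where "\<xi> t = Ln (y t)" for t
  have ye: "y t = exp (\<xi> t)" if "t \<in> K" for t
    using y that by (auto simp: torus_def \<xi>_def)
  define J where "J = {i \<in> I. \<mu> i \<noteq> 0}"
  have "(\<Sum>j\<in>J. \<mu> j * log_grad x j \<xi> t) = 0" if t: "t \<in> K" for t
  proof -
    have "(\<Sum>j\<in>J. \<mu> j * log_grad x j \<xi> t) = (\<Sum>i\<in>I. \<mu> i * log_grad x i \<xi> t)"
      using finite_I by (intro sum.mono_neutral_left) (auto simp: J_def)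
    also have "\<dots> = (\<Sum>i\<in>I. \<mu> i * (y t * partial_deriv t (laurent K (A i) (\<lambda>a. x (i, a))) y))"
      by (intro sum.cong refl arg_cong2[where f = "(*)"] partial_deriv_exp[symmetric] ye t)
    also have "\<dots> = y t * (\<Sum>i\<in>I. \<mu> i * partial_deriv t (laurent K (A i) (\<lambda>a. x (i, a))) y)"
      by (simp add: sum_distrib_left mult_ac)
    finally show ?thesis using grad[OF t] by simp
  qed
  moreover have "val x i \<xi> = 0" if "i \<in> I" for i
    using val[OF that] laurent_exp[OF ye, where i = i and x = x] by simp
  moreover have "\<mu> j \<noteq> 0" if "j \<in> J" for j using that by (simp add: J_def)
  ultimately have "x \<in> dependent_systems J I"
    using x unfolding dependent_systems_def by blast
  moreover have "J \<in> Pow I - {{}}" using \<mu> by (auto simp: J_def)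
  ultimately show "x \<in> (\<Union>J\<in>Pow I - {{}}. dependent_systems J I)" by blast
next
  fix x assume "x \<in> (\<Union>J\<in>Pow I - {{}}. dependent_systems J I)"
  then obtain J \<xi> \<nu> where J: "J \<subseteq> I" "J \<noteq> {}" and x: "x \<in> affine_space V"
    and val: "\<And>i. i \<in> I \<Longrightarrow> val x i \<xi> = 0" and \<nu>: "\<And>j. j \<in> J \<Longrightarrow> \<nu> j \<noteq> 0"
    and grad: "\<And>t. t \<in> K \<Longrightarrow> (\<Sum>j\<in>J. \<nu> j * log_grad x j \<xi> t) = 0"
    unfolding dependent_systems_def by blast
  define y where "y t = (if t \<in> K then exp (\<xi> t) else 0)" for t
  have ye: "y t = exp (\<xi> t)" if "t \<in> K" for t using that by (simp add: y_def)
  have y: "y \<in> torus K" by (simp add: torus_def affine_space_def y_def)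
  define \<mu> where "\<mu> i = (if i \<in> J then \<nu> i else 0)" for i
  have "(\<Sum>i\<in>I. \<mu> i * partial_deriv t (laurent K (A i) (\<lambda>a. x (i, a))) y) = 0" if t: "t \<in> K" for t
  proof -
    have "y t * (\<Sum>i\<in>I. \<mu> i * partial_deriv t (laurent K (A i) (\<lambda>a. x (i, a))) y)
        = (\<Sum>i\<in>I. \<mu> i * (y t * partial_deriv t (laurent K (A i) (\<lambda>a. x (i, a))) y))"
      by (simp add: sum_distrib_left mult_ac)
    also have "\<dots> = (\<Sum>i\<in>I. \<mu> i * log_grad x i \<xi> t)"
      by (intro sum.cong refl arg_cong2[where f = "(*)"] partial_deriv_exp ye t)
    also have "\<dots> = (\<Sum>j\<in>J. \<mu> j * log_grad x j \<xi> t)"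
      using finite_I J by (intro sum.mono_neutral_right) (auto simp: \<mu>_def)
    also have "\<dots> = 0" using grad[OF t] by (simp add: \<mu>_def)
    finally show ?thesis using ye[OF t] by simp
  qed
  moreover have "laurent K (A i) (\<lambda>a. x (i, a)) y = 0" if "i \<in> I" for i
    using val[OF that] laurent_exp[OF ye, where i = i and x = x] by simp
  moreover have "\<exists>i\<in>I. \<mu> i \<noteq> 0" using J \<nu> by (auto simp: \<mu>_def)
  ultimately show "x \<in> singular_systems K I A"
    using x y unfolding singular_systems_def by blast
qed

lemma char_exp_cayley:
  assumes "j \<in> I"
  shows "char_exp (K <+> I) (cayley_point (j, a)) \<zeta> = char_exp K a (\<lambda>t. \<zeta> (Inl t)) * exp (\<zeta> (Inr j))"
proof -
  have "(\<Sum>t\<in>K <+> I. of_int (cayley_point (j, a) t) * \<zeta> t)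
      = (\<Sum>t\<in>K. of_int (a t) * \<zeta> (Inl t)) + (\<Sum>i\<in>I. of_int (of_bool (i = j)) * \<zeta> (Inr i))"
    using finite_K finite_I by (simp add: sum.Plus)
  also have "(\<Sum>i\<in>I. of_int (of_bool (i = j)) * \<zeta> (Inr i)) = (\<Sum>i\<in>I. if i = j then \<zeta> (Inr i) else 0)"
    by (intro sum.cong) auto
  also have "\<dots> = \<zeta> (Inr j)" using assms finite_I by simp
  finally show ?thesis by (simp add: char_exp_def exp_add)
qed

text \<open>The coefficient \<open>\<nu> j\<close> of the relation becomes the torus coordinate
  \<open>exp (\<zeta> (Inr j))\<close>. The logarithmic derivative in this coordinate isolates the
  polynomial number \<open>j\<close>, and the derivatives in the directions of \<open>K\<close> give
  the relation.\<close>

lemma dependent_systems_eq_singular_locus: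
  assumes J: "J \<subseteq> I"
  shows "dependent_systems J J = singular_locus V (Sigma J A) (K <+> I) cayley_point"
proof -
  have finJ: "finite J" using J finite_I finite_subset by blast
  have fA: "\<And>j. j \<in> J \<Longrightarrow> finite (A j)" using J finite_A by blast
  have s: "(\<Sum>n\<in>Sigma J A. x n * c n * char_exp (K <+> I) (cayley_point n) \<zeta>)
      = (\<Sum>j\<in>J. exp (\<zeta> (Inr j)) * (\<Sum>a\<in>A j. x (j, a) * c (j, a) * char_exp K a (\<lambda>t. \<zeta> (Inl t))))"
          for x c \<zeta>
  proof -
    have "(\<Sum>n\<in>Sigma J A. x n * c n * char_exp (K <+> I) (cayley_point n) \<zeta>)
      = (\<Sum>j\<in>J. \<Sum>a\<in>A j. x (j, a) * c (j, a) * char_exp (K <+> I) (cayley_point (j, a)) \<zeta>)"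
      using finJ fA by (subst sum.Sigma) (auto simp: case_prod_unfold simp del: cayley_point.simps)
    also have "\<dots> = (\<Sum>j\<in>J. exp (\<zeta> (Inr j)) * (\<Sum>a\<in>A j. x (j, a) * c (j, a)
        * char_exp K a (\<lambda>t. \<zeta> (Inl t))))"
      using J by (intro sum.cong refl)
          (auto simp: char_exp_cayley sum_distrib_left mult_ac simp del: cayley_point.simps)
    finally show ?thesis .
  qed
  have sing: "singular_at (Sigma J A) (K <+> I) cayley_point x \<zeta> \<longleftrightarrow>
      (\<forall>j\<in>J. val x j (\<lambda>t. \<zeta> (Inl t)) = 0) \<and>
      (\<forall>t\<in>K. (\<Sum>j\<in>J. exp (\<zeta> (Inr j)) * log_grad x j (\<lambda>t. \<zeta> (Inl t)) t) = 0)" (is "_ \<longleftrightarrow> ?val \<and> ?grad")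
          for x \<zeta>
  proof -
    have 0: "(\<Sum>n\<in>Sigma J A. x n * char_exp (K <+> I) (cayley_point n) \<zeta>)
        = (\<Sum>j\<in>J. exp (\<zeta> (Inr j)) * val x j (\<lambda>t. \<zeta> (Inl t)))"
      using s[of x "\<lambda>_. 1" \<zeta>] by (simp add: val_def)
    have 1: "(\<Sum>n\<in>Sigma J A. x n * of_int (cayley_point n (Inl t)) * char_exp (K <+> I)
        (cayley_point n) \<zeta>)
        = (\<Sum>j\<in>J. exp (\<zeta> (Inr j)) * log_grad x j (\<lambda>t. \<zeta> (Inl t)) t)" for t
      using s[of x "\<lambda>n. of_int (cayley_point n (Inl t))" \<zeta>] by (simp add: log_grad_def)
    have 2: "(\<Sum>n\<in>Sigma J A. x n * of_int (cayley_point n (Inr i)) * char_exp (K <+> I)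
        (cayley_point n) \<zeta>)
        = (if i \<in> J then exp (\<zeta> (Inr i)) * val x i (\<lambda>t. \<zeta> (Inl t)) else 0)" for i
    proof -
      have "(\<Sum>n\<in>Sigma J A. x n * of_int (cayley_point n (Inr i)) * char_exp (K <+> I) (cayley_point n)
          \<zeta>)
          = (\<Sum>j\<in>J. if j = i then exp (\<zeta> (Inr j)) * val x j (\<lambda>t. \<zeta> (Inl t)) else 0)"
        unfolding s[of x "\<lambda>n. of_int (cayley_point n (Inr i))" \<zeta>]
        by (intro sum.cong refl) (auto simp: val_def)
      then show ?thesis using finJ by simp
    qed
    have ball: "(\<forall>t\<in>K <+> I. P t) \<longleftrightarrow> (\<forall>t\<in>K. P (Inl t)) \<and> (\<forall>i\<in>I. P (Inr i))" for P :: "'k + 'i \<Rightarrow> bool"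
      by auto
    show ?thesis
      unfolding singular_at_def 0 ball 1 2 using J by auto
  qed
  show ?thesis
  proof (intro equalityI subsetI)
    fix x assume "x \<in> dependent_systems J J"
    then obtain \<xi> \<nu> where x: "x \<in> affine_space V" "\<forall>i\<in>J. val x i \<xi> = 0" "\<forall>j\<in>J. \<nu> j \<noteq> 0"
      "\<forall>t\<in>K. (\<Sum>j\<in>J. \<nu> j * log_grad x j \<xi> t) = 0"
      unfolding dependent_systems_def by blast
    have "singular_at (Sigma J A) (K <+> I) cayley_point x (case_sum \<xi> (\<lambda>j. Ln (\<nu> j)))"
      unfolding sing using x by (simp cong: sum.cong)
    then show "x \<in> singular_locus V (Sigma J A) (K <+> I) cayley_point"
      using x unfolding singular_locus_def by blast
  next
    fix x assume "x \<in> singular_locus V (Sigma J A) (K <+> I) cayley_point"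
    then obtain \<zeta> where "x \<in> affine_space V" "singular_at (Sigma J A) (K <+> I) cayley_point x \<zeta>"
      unfolding singular_locus_def by blast
    then show "x \<in> dependent_systems J J"
      unfolding dependent_systems_def sing
      by (intro CollectI conjI exI[of _ "\<lambda>t. \<zeta> (Inl t)"] exI[of _ "\<lambda>j. exp (\<zeta> (Inr j))"]) auto
  qed
qed

end

text \<open>Extending a basis of \<open>D\<close> to one of the union adds only vectors
  \<open>\<beta> k\<close>, and by the rank condition all of them, without repetition. A functional
  may be prescribed on that basis.\<close>

lemma ex_dual_functional:
  fixes \<beta> :: "'i \<Rightarrow> 'v :: real_vector"
  assumes fin: "finite D" "finite Q" and dim: "dim (D \<union> \<beta> ` Q) \<ge> dim D + card Q" and i: "i \<in> Q"
  shows "\<exists>g :: 'v \<Rightarrow> real. linear g \<and> (\<forall>d\<in>D. g d = 0) \<and> (\<forall>k\<in>Q. g (\<beta> k) = of_bool (k = i))"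
proof -
  obtain B where B: "B \<subseteq> D" "independent B" "D \<subseteq> span B" "card B = dim D"
    using real_vector.basis_exists by blast
  then obtain C where C: "B \<subseteq> C" "C \<subseteq> D \<union> \<beta> ` Q" "independent C" "D \<union> \<beta> ` Q \<subseteq> span C"
    using real_vector.maximal_independent_subset_extend[of B "D \<union> \<beta> ` Q"] by blast
  have finC: "finite C" using C(2) fin by (meson finite_UnI finite_imageI finite_subset)
  have "c \<notin> D" if c: "c \<in> C - B" for c
  proof
    assume "c \<in> D"
    then have "c \<in> span (C - {c})" using B(3) C(1) c real_vector.span_mono[of B "C - {c}"] by auto
    then show False using C(3) c real_vector.dependent_def by blast
  qed
  then have sub: "C - B \<subseteq> \<beta> ` Q" using C(2) by blast
  have "card C = dim (D \<union> \<beta> ` Q)" using C real_vector.basis_card_eq_dim by blast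
  then have "card Q \<le> card (C - B)"
    using dim B(4) C(1) finC by (simp add: card_Diff_subset finite_subset[OF C(1)])
  moreover have "card (C - B) \<le> card (\<beta> ` Q)" using sub fin by (intro card_mono) auto
  moreover have "card (\<beta> ` Q) \<le> card Q" using fin by (intro card_image_le)
  ultimately have eq: "card (\<beta> ` Q) = card Q" "card (C - B) = card (\<beta> ` Q)" by linarith+
  have inj: "inj_on \<beta> Q" using eq(1) fin by (intro eq_card_imp_inj_on)
  have CB: "C - B = \<beta> ` Q" using sub eq(2) fin by (intro card_subset_eq) auto
  obtain g :: "'v \<Rightarrow> real" where g: "linear g" "\<And>x. x \<in> C \<Longrightarrow> g x = of_bool (x = \<beta> i)"
    using real_vector.linear_independent_extend[OF C(3), of "\<lambda>x. of_bool (x = \<beta> i)"] by blast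
  have "\<beta> i \<in> C - B" using CB i by simp
  then have "g b = 0" if "b \<in> B" for b
    using that g(2)[of b] C(1) by auto
  then have "g d = 0" if "d \<in> D" for d
    using that B(3) g(1) real_vector.linear_eq_0_on_span[of g B d] by blast
  moreover have "g (\<beta> k) = of_bool (k = i)" if "k \<in> Q" for k
  proof -
    have "\<beta> k \<in> C" using CB that by blast
    moreover have "\<beta> k = \<beta> i \<longleftrightarrow> k = i" using inj that i by (auto simp: inj_on_def)
    ultimately show ?thesis using g(2)[of "\<beta> k"] by simp
  qed
  ultimately show ?thesis using g(1) by blast
qed

lemma linear_functional_coordinates:
  fixes g :: "('k \<Rightarrow> real) \<Rightarrow> real"
  assumes "linear g" "finite K" "\<And>t. t \<notin> K \<Longrightarrow> v t = 0"
  shows "g v = (\<Sum>t\<in>K. v t * g (\<lambda>u. of_bool (u = t)))"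
proof -
  have "(\<Sum>t\<in>K. v t *\<^sub>R (\<lambda>u. of_bool (u = t))) u = (\<Sum>t\<in>K. v t * of_bool (u = t))" for u
    by (induction K rule: infinite_finite_induct) (auto simp: scaleR_fun_def)
  also have "(\<Sum>t\<in>K. v t * of_bool (u = t)) = v u" for u
  proof -
    have "(\<Sum>t\<in>K. v t * of_bool (u = t)) = (\<Sum>t\<in>K. if u = t then v t else 0)"
      by (intro sum.cong) auto
    then show ?thesis using assms by simp
  qed
  finally have "v = (\<Sum>t\<in>K. v t *\<^sub>R (\<lambda>u. of_bool (u = t)))" by (simp add: fun_eq_iff)
  then have "g v = g (\<Sum>t\<in>K. v t *\<^sub>R (\<lambda>u. of_bool (u = t)))" by simp
  then show ?thesis using assms(1) by (simp add: linear_sum linear_scale)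
qed

text \<open>In the row of the largest entry \<open>\<mu> m\<close>, the term
  \<open>s * \<mu> m\<close> equals in norm a sum bounded by \<open>norm (\<mu> m)\<close> times the
  sum of all the norms, so \<open>\<mu> m\<close> is 0.\<close>

lemma diagonally_dominant_kernel:
  fixes M :: "'i \<Rightarrow> 'i \<Rightarrow> complex"
  assumes "finite Q" and s: "norm s > (\<Sum>i\<in>Q. \<Sum>k\<in>Q. norm (M i k))"
    and 0: "\<And>i. i \<in> Q \<Longrightarrow> (\<Sum>k\<in>Q. \<mu> k * M i k) + s * \<mu> i = 0" and i: "i \<in> Q"
  shows "\<mu> i = 0"
proof -
  have "finite (norm ` \<mu> ` Q)" "norm ` \<mu> ` Q \<noteq> {}" using assms by auto
  then obtain m where m: "m \<in> Q" "\<And>k. k \<in> Q \<Longrightarrow> norm (\<mu> k) \<le> norm (\<mu> m)"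
    using Max_in[of "norm ` \<mu> ` Q"] Max_ge[of "norm ` \<mu> ` Q"] by fastforce
  have "norm s * norm (\<mu> m) = norm (\<Sum>k\<in>Q. \<mu> k * M m k)"
    using 0[OF m(1)] by (metis add_eq_0_iff norm_minus_cancel norm_mult)
  also have "\<dots> \<le> (\<Sum>k\<in>Q. norm (\<mu> m) * norm (M m k))"
    by (rule order_trans[OF norm_sum]) (auto simp: norm_mult intro!: sum_mono mult_right_mono m)
  also have "\<dots> \<le> norm (\<mu> m) * (\<Sum>i\<in>Q. \<Sum>k\<in>Q. norm (M i k))"
    unfolding sum_distrib_left[symmetric]
    using m(1) assms(1) by (intro mult_left_mono member_le_sum[of m Q "\<lambda>i. \<Sum>k\<in>Q. norm (M i k)"])
        (auto intro: sum_nonneg)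
  finally have "norm (\<mu> m) * (norm s - (\<Sum>i\<in>Q. \<Sum>k\<in>Q. norm (M i k))) \<le> 0" by (simp add: algebra_simps)
  then have "norm (\<mu> m) \<le> 0" using s by (simp add: mult_le_0_iff)
  then show ?thesis using m(2)[OF i] by simp
qed

section \<open>Perturbation by binomials and the two comparisons of closures\<close>

context supports
begin

lemma val_linear: "val (\<lambda>v. x v + s * (\<Sum>b\<in>B. c b * g b v)) i \<xi> = val x i \<xi>
    + s * (\<Sum>b\<in>B. c b * val (g b) i \<xi>)"
proof -
  have "(\<Sum>a\<in>A i. (\<Sum>b\<in>B. c b * g b (i, a)) * char_exp K a \<xi>) = (\<Sum>b\<in>B. c b * val (g b) i \<xi>)"
    unfolding val_def sum_distrib_left sum_distrib_right by (subst sum.swap) (simp add: mult_ac)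
  then have "(\<Sum>a\<in>A i. s * ((\<Sum>b\<in>B. c b * g b (i, a)) * char_exp K a \<xi>)) = s * (\<Sum>b\<in>B. c b * val (g b)
      i \<xi>)"
    by (simp only: sum_distrib_left[symmetric])
  then show ?thesis by (simp add: val_def distrib_right sum.distrib mult.assoc)
qed

lemma log_grad_linear:
  "log_grad (\<lambda>v. x v + s * (\<Sum>b\<in>B. c b * g b v)) i \<xi> t
    = log_grad x i \<xi> t + s * (\<Sum>b\<in>B. c b * log_grad (g b) i \<xi> t)"
proof -
  have "(\<Sum>a\<in>A i. (\<Sum>b\<in>B. c b * g b (i, a)) * (of_int (a t) * char_exp K a \<xi>))
      = (\<Sum>b\<in>B. c b * log_grad (g b) i \<xi> t)"
    unfolding log_grad_def sum_distrib_left sum_distrib_right by (subst sum.swap) (simp add: mult_ac)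
  then have "(\<Sum>a\<in>A i. s * ((\<Sum>b\<in>B. c b * g b (i, a)) * (of_int (a t) * char_exp K a \<xi>)))
      = s * (\<Sum>b\<in>B. c b * log_grad (g b) i \<xi> t)"
    by (simp only: sum_distrib_left[symmetric])
  then show ?thesis by (simp add: log_grad_def distrib_right sum.distrib mult.assoc)
qed

text \<open>Normalised so that the two terms cancel at \<open>\<xi>\<close> and the logarithmic
  gradient there is the difference of the exponents: adding it changes a gradient without disturbing
  the zero.\<close>

definition binomial ::
  "('k \<Rightarrow> complex) \<Rightarrow> 'i \<Rightarrow> ('k \<Rightarrow> int) \<Rightarrow> ('k \<Rightarrow> int) \<Rightarrow> ('i \<times> ('k \<Rightarrow> int) \<Rightarrow> complex)" where
  "binomial \<xi> i a b v = of_bool (v = (i, a)) / char_exp K a \<xi> - of_bool (v = (i, b)) / char_exp K b \<xi>"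

lemma sum_binomial:
  assumes "i \<in> I" "a \<in> A i" "b \<in> A i"
  shows "(\<Sum>c\<in>A k. binomial \<xi> i a b (k, c) * f c * char_exp K c \<xi>) = (if k = i then f a - f b else 0)"
proof (cases "k = i")
  case True
  have "(\<Sum>c\<in>A i. binomial \<xi> i a b (i, c) * f c * char_exp K c \<xi>)
      = (\<Sum>c\<in>A i. (if c = a then f c else 0) - (if c = b then f c else 0))"
    by (intro sum.cong refl) (auto simp: binomial_def)
  also have "\<dots> = f a - f b" using assms finite_A by (simp add: sum_subtractf)
  finally show ?thesis using True by simp
qed (simp add: binomial_def)

lemma val_binomial:
  assumes "i \<in> I" "a \<in> A i" "b \<in> A i"
  shows "val (binomial \<xi> i a b) k \<xi> = 0"
  using sum_binomial[OF assms, where k = k and \<xi> = \<xi> and f = "\<lambda>_. 1"] by (simp add: val_def)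

lemma log_grad_binomial:
  assumes "i \<in> I" "a \<in> A i" "b \<in> A i"
  shows "log_grad (binomial \<xi> i a b) k \<xi> t = (if k = i then of_int (a t) - of_int (b t) else 0)"
  using sum_binomial[OF assms, where k = k and \<xi> = \<xi> and f = "\<lambda>c. of_int (c t)"]
    by (simp add: log_grad_def)

lemma binomial_outside:
  assumes "i \<in> I" "a \<in> A i" "b \<in> A i" "v \<notin> V"
  shows "binomial \<xi> i a b v = 0"
  using assms by (auto simp: binomial_def)

lemma dependent_systems_subset: "dependent_systems J H \<subseteq> affine_space V"
  by (auto simp: dependent_systems_def)

text \<open>Over the larger index set the gradients are dependent modulo the directions of the
  \<open>A j\<close> with \<open>j \<in> J\<close>. A perturbation of order \<open>s\<close> of the polynomials with index in \<open>J\<close> turns this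
  into an honest relation that involves further indices with coefficients of order \<open>s\<close>.\<close>

lemma dependent_systems_degenerate:
  assumes J: "J \<subseteq> J'" "J' \<subseteq> I" and A: "\<And>i. i \<in> I \<Longrightarrow> A i \<noteq> {}" and cod: "codim A J' < codim A J"
    and x: "x \<in> dependent_systems J I"
  shows "\<exists>J''. J \<subset> J'' \<and> J'' \<subseteq> I \<and> x \<in> zariski V closure_of dependent_systems J'' I"
proof -
  obtain \<xi> \<nu> where xV: "x \<in> affine_space V" and val0: "\<And>i. i \<in> I \<Longrightarrow> val x i \<xi> = 0"
    and \<nu>: "\<And>j. j \<in> J \<Longrightarrow> \<nu> j \<noteq> 0" and grad0: "\<And>t. t \<in> K \<Longrightarrow> (\<Sum>j\<in>J. \<nu> j * log_grad x j \<xi> t) = 0"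
    using x unfolding dependent_systems_def by blast
  define P where "P = J' - J"
  have fin: "finite J" "finite J'" "finite P" 
    using finite_subset[OF J(2) finite_I] finite_subset[OF J(1)] by (auto simp: P_def)
  have cJ': "card J' = card J + card P"
    using fin J card_mono[of J' J] by (simp add: P_def card_Diff_subset)
  have finD: "finite (differences A J')" "finite (differences A J)"
    using fin J finite_A by (auto intro!: finite_differences)
  obtain B0 where B0: "B0 \<subseteq> differences A J" "independent B0" "differences A J \<subseteq> span B0"
    "card B0 = dim (differences A J)"
    using real_vector.basis_exists by blast
  have "B0 \<subseteq> differences A J'" using B0 differences_mono[OF J(1), of A] by blast
  then obtain B1 where B1:
      "B0 \<subseteq> B1" "B1 \<subseteq> differences A J'" "independent B1" "differences A J' \<subseteq> span B1"
    using real_vector.maximal_independent_subset_extend[of B0 "differences A J'"] B0 by blast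
  have finB: "finite B1" "finite B0" using B1 B0 finD finite_subset by blast+
  have "card B1 = dim (differences A J')" using B1 real_vector.basis_card_eq_dim by blast
  moreover have "codim A J' = int (dim (differences A J')) - int (card J')"
    "codim A J = int (dim (differences A J)) - int (card J)"
    using fin J A by (auto intro!: codim_eq)
  \<comment> \<open>The drop of \<open>codim\<close> says that \<open>J'\<close> contributes fewer
    new directions than new indices, so the gradients with index in \<open>P\<close> satisfy a
    relation modulo the span of \<open>B0\<close>.\<close>
  ultimately have "card B1 < card B0 + card P" using cod cJ' B0(4) by linarith
  then have cB: "card (B1 - B0) < card P"
    using finB B1(1) card_mono[OF finB(1) B1(1)] by (simp add: card_Diff_subset)
  \<comment> \<open>At a zero the gradient does not change when all exponents are translated by
    \<open>a0\<close>, so it is a complex combination of differences of exponents.\<close>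
  have "\<exists>z. \<forall>t. log_grad x i \<xi> t = (\<Sum>\<beta>\<in>B1. z \<beta> * of_real (\<beta> t))" if i: "i \<in> P" for i
  proof -
    have iI: "i \<in> I" "i \<in> J'" using i J by (auto simp: P_def)
    obtain a0 where a0: "a0 \<in> A i" using A[OF iI(1)] by blast
    have "\<exists>u. real_vec a - real_vec a0 = (\<Sum>\<beta>\<in>B1. u \<beta> *\<^sub>R \<beta>)" if "a \<in> A i" for a
    proof -
      have "real_vec a - real_vec a0 \<in> differences A J'" using that a0 iI
        by (auto simp: differences_def)
      then have "real_vec a - real_vec a0 \<in> span B1" using B1 by blast
      then show ?thesis unfolding real_vector.span_finite[OF finB(1)] by auto
    qed
    then obtain u where u: "\<And>a. a \<in> A i \<Longrightarrow> real_vec a - real_vec a0 = (\<Sum>\<beta>\<in>B1. u a \<beta> *\<^sub>R \<beta>)" by metis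
    have ut: "of_int (a t) - of_int (a0 t) = (\<Sum>\<beta>\<in>B1. complex_of_real (u a \<beta>) * of_real (\<beta> t))"
      if "a \<in> A i" for a t
    proof -
      have "(real_vec a - real_vec a0) t = (\<Sum>\<beta>\<in>B1. u a \<beta> *\<^sub>R \<beta>) t" by (simp only: u[OF that])
      also have "\<dots> = (\<Sum>\<beta>\<in>B1. u a \<beta> * \<beta> t)" using finB
        by (induction B1 rule: infinite_finite_induct) (auto simp: scaleR_fun_def)
      finally have "real_of_int (a t) - real_of_int (a0 t) = (\<Sum>\<beta>\<in>B1. u a \<beta> * \<beta> t)"
        by (simp add: real_vec_def)
      then have "complex_of_real (real_of_int (a t) - real_of_int (a0 t))
          = complex_of_real (\<Sum>\<beta>\<in>B1. u a \<beta> * \<beta> t)" by simp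
      then show ?thesis by simp
    qed
    have "log_grad x i \<xi> t = (\<Sum>\<beta>\<in>B1. (\<Sum>a\<in>A i. x (i, a) * char_exp K a \<xi> * of_real (u a \<beta>))
        * of_real (\<beta> t))" for t
    proof -
      have "log_grad x i \<xi> t = log_grad x i \<xi> t - of_int (a0 t) * val x i \<xi>" using val0[OF iI(1)]
        by simp
      also have "\<dots> = (\<Sum>a\<in>A i. x (i, a) * char_exp K a \<xi> * (of_int (a t) - of_int (a0 t)))"
        by (simp add: log_grad_def val_def sum_distrib_left sum_subtractf right_diff_distrib mult_ac)
      also have "\<dots> = (\<Sum>a\<in>A i. \<Sum>\<beta>\<in>B1. x (i, a) * char_exp K a \<xi> * of_real (u a \<beta>) * of_real (\<beta> t))"
        by (intro sum.cong refl) (simp add: ut sum_distrib_left mult.assoc)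
      also have "\<dots> = (\<Sum>\<beta>\<in>B1. \<Sum>a\<in>A i. x (i, a) * char_exp K a \<xi> * of_real (u a \<beta>) * of_real (\<beta> t))"
        by (rule sum.swap)
      finally show ?thesis by (simp add: sum_distrib_right)
    qed
    then show ?thesis
      by (intro exI[of _ "\<lambda>\<beta>. \<Sum>a\<in>A i. x (i, a) * char_exp K a \<xi> * of_real (u a \<beta>)"]) blast
  qed
  then obtain z where z: "\<And>i t. i \<in> P \<Longrightarrow> log_grad x i \<xi> t = (\<Sum>\<beta>\<in>B1. z i \<beta> * of_real (\<beta> t))" by metis
  obtain \<mu> where \<mu>: "\<exists>i\<in>P. \<mu> i \<noteq> 0" "\<And>\<beta>. \<beta> \<in> B1 - B0 \<Longrightarrow> (\<Sum>i\<in>P. \<mu> i * z i \<beta>) = 0"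
    using homogeneous_system[OF _ fin(3) cB, of z] finB by auto
  define w where "w \<beta> = (\<Sum>i\<in>P. \<mu> i * z i \<beta>)" for \<beta>
  have w: "(\<Sum>i\<in>P. \<mu> i * log_grad x i \<xi> t) = (\<Sum>\<beta>\<in>B0. w \<beta> * of_real (\<beta> t))" for t
  proof -
    have "(\<Sum>i\<in>P. \<mu> i * log_grad x i \<xi> t) = (\<Sum>i\<in>P. \<Sum>\<beta>\<in>B1. \<mu> i * z i \<beta> * of_real (\<beta> t))"
      by (intro sum.cong refl) (simp add: z sum_distrib_left mult.assoc)
    also have "\<dots> = (\<Sum>\<beta>\<in>B1. w \<beta> * of_real (\<beta> t))"
      unfolding w_def sum_distrib_right by (rule sum.swap)
    also have "\<dots> = (\<Sum>\<beta>\<in>B0. w \<beta> * of_real (\<beta> t))"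
      using finB B1(1) \<mu>(2) by (intro sum.mono_neutral_right) (auto simp: w_def)
    finally show ?thesis .
  qed
  have "\<exists>j a b. j \<in> J \<and> a \<in> A j \<and> b \<in> A j \<and> \<beta> = real_vec a - real_vec b" if "\<beta> \<in> B0" for \<beta>
    using that B0(1) unfolding differences_def by blast
  then obtain j a b where jab: "\<And>\<beta>. \<beta> \<in> B0 \<Longrightarrow> j \<beta> \<in> J" "\<And>\<beta>. \<beta> \<in> B0 \<Longrightarrow> a \<beta> \<in> A (j \<beta>)"
    "\<And>\<beta>. \<beta> \<in> B0 \<Longrightarrow> b \<beta> \<in> A (j \<beta>)" "\<And>\<beta>. \<beta> \<in> B0 \<Longrightarrow> \<beta> = real_vec (a \<beta>) - real_vec (b \<beta>)" by metis
  have jI: "\<And>\<beta>. \<beta> \<in> B0 \<Longrightarrow> j \<beta> \<in> I" using jab J by blast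
  have \<beta>t: "of_int (a \<beta> t) - of_int (b \<beta> t) = complex_of_real (\<beta> t)" if "\<beta> \<in> B0" for \<beta> t
  proof -
    have "\<beta> t = real_of_int (a \<beta> t) - real_of_int (b \<beta> t)"
      using fun_cong[OF jab(4)[OF that], of t] by (simp add: real_vec_def)
    then show ?thesis by simp
  qed
  \<comment> \<open>The division by \<open>\<nu> (j \<beta>)\<close> compensates the weight of the
    polynomial that is perturbed: the weighted change of the gradients over \<open>J\<close> is
    minus \<open>s\<close> times the combination of gradients over \<open>P\<close> given by
    \<open>\<mu>\<close>.\<close>
  define xs where "xs s v = x v + s * (\<Sum>\<beta>\<in>B0. - (w \<beta> / \<nu> (j \<beta>)) * binomial \<xi> (j \<beta>) (a \<beta>) (b \<beta>) v)"
    for s v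
  have xs_val: "val (xs s) i \<xi> = 0" if "i \<in> I" for s i
    unfolding xs_def val_linear using val0[OF that] jab jI by (simp add: val_binomial)
  have xs_grad: "log_grad (xs s) i \<xi> t = log_grad x i \<xi> t
      + s * (\<Sum>\<beta>\<in>B0. - (w \<beta> / \<nu> (j \<beta>)) * (if i = j \<beta> then of_real (\<beta> t) else 0))" for s i t
    unfolding xs_def log_grad_linear
    by (intro arg_cong2[where f = "(+)"] arg_cong2[where f = "(*)"] refl sum.cong)
      (simp add: log_grad_binomial jab jI \<beta>t)
  have xsV: "xs s \<in> affine_space V" for s
    using xV jab jI by (auto simp: affine_space_def xs_def binomial_outside)
  define J'' where "J'' = J \<union> {i \<in> P. \<mu> i \<noteq> 0}"
  have JJ'': "J \<subset> J''" "J'' \<subseteq> I" using \<mu>(1) J by (auto simp: J''_def P_def)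
  have mem: "xs s \<in> dependent_systems J'' I" if s: "s \<noteq> 0" for s
  proof -
    define \<nu>' where "\<nu>' i = (if i \<in> J then \<nu> i else s * \<mu> i)" for i
    have "(\<Sum>i\<in>J''. \<nu>' i * log_grad (xs s) i \<xi> t) = 0" if t: "t \<in> K" for t
    proof -
      have "(\<Sum>i\<in>J''. \<nu>' i * log_grad (xs s) i \<xi> t)
          = (\<Sum>i\<in>J. \<nu>' i * log_grad (xs s) i \<xi> t) + (\<Sum>i\<in>{i \<in> P. \<mu> i \<noteq> 0}. \<nu>' i * log_grad (xs s) i \<xi> t)"
        unfolding J''_def using fin by (intro sum.union_disjoint) (auto simp: P_def)
      also have "(\<Sum>i\<in>{i \<in> P. \<mu> i \<noteq> 0}. \<nu>' i * log_grad (xs s) i \<xi> t) = (\<Sum>i\<in>P. \<nu>' i * log_grad (xs s)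
          i \<xi> t)"
        using fin by (intro sum.mono_neutral_left) (auto simp: P_def \<nu>'_def)
      also have "\<dots> = (\<Sum>i\<in>P. s * (\<mu> i * log_grad x i \<xi> t))"
      proof (intro sum.cong refl)
        fix i assume i: "i \<in> P"
        then have "i \<noteq> j \<beta>" if "\<beta> \<in> B0" for \<beta> using jab(1)[OF that] by (auto simp: P_def)
        then show "\<nu>' i * log_grad (xs s) i \<xi> t = s * (\<mu> i * log_grad x i \<xi> t)"
          using i by (simp add: xs_grad \<nu>'_def P_def)
      qed
      also have "\<dots> = s * (\<Sum>\<beta>\<in>B0. w \<beta> * of_real (\<beta> t))" by (simp only: sum_distrib_left[symmetric] w)
      also have "(\<Sum>i\<in>J. \<nu>' i * log_grad (xs s) i \<xi> t) = - (s * (\<Sum>\<beta>\<in>B0. w \<beta> * of_real (\<beta> t)))"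
      proof -
        have "(\<Sum>i\<in>J. \<nu>' i * log_grad (xs s) i \<xi> t) = (\<Sum>i\<in>J. \<nu> i * log_grad x i \<xi> t)
            + (\<Sum>i\<in>J. \<nu> i * (s * (\<Sum>\<beta>\<in>B0. - (w \<beta> / \<nu> (j \<beta>)) * (if i = j \<beta> then of_real (\<beta> t) else 0))))"
          by (simp add: xs_grad \<nu>'_def distrib_left sum.distrib)
        also have "\<dots> = s * (\<Sum>i\<in>J. \<Sum>\<beta>\<in>B0. \<nu> i * (- (w \<beta> / \<nu> (j \<beta>)) * (if i = j \<beta> then of_real (\<beta> t)
            else 0)))"
          by (simp add: grad0[OF t] sum_distrib_left mult.left_commute)
        also have "(\<Sum>i\<in>J. \<Sum>\<beta>\<in>B0. \<nu> i * (- (w \<beta> / \<nu> (j \<beta>)) * (if i = j \<beta> then of_real (\<beta> t) else 0)))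
            = (\<Sum>\<beta>\<in>B0. \<Sum>i\<in>J. if i = j \<beta> then - (w \<beta> * of_real (\<beta> t)) else 0)"
          by (subst sum.swap, intro sum.cong refl) (use \<nu> in auto)
        also have "\<dots> = (\<Sum>\<beta>\<in>B0. - (w \<beta> * of_real (\<beta> t)))"
          using fin jab(1) by (intro sum.cong refl) simp
        finally show ?thesis by (simp add: sum_negf)
      qed
      finally show ?thesis by simp
    qed
    moreover have "\<nu>' i \<noteq> 0" if "i \<in> J''" for i using that \<nu> s by (auto simp: \<nu>'_def J''_def P_def)
    ultimately show ?thesis unfolding dependent_systems_def using xsV xs_val by blast
  qed
  have "poly_eval F x = 0" if F: "F \<in> polys_on V" "vanishes_on F (dependent_systems J'' I)" for F
  proof -
    have "poly_eval F (xs 0) = 0"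
    proof (rule entire_no_zero_divisors[where f = "\<lambda>s. s" and g = "\<lambda>s. poly_eval F (xs s)" and a = 1])
      show "(\<lambda>s. poly_eval F (xs s)) holomorphic_on UNIV"
        unfolding xs_def by (intro poly_eval_holomorphic holomorphic_intros)
      show "s * poly_eval F (xs s) = 0" for s
        using F(2) mem[of s] by (cases "s = 0") (auto simp: vanishes_on_def)
    qed (auto intro: holomorphic_intros)
    moreover have "xs 0 = x" by (simp add: xs_def fun_eq_iff)
    ultimately show ?thesis by simp
  qed
  then have "x \<in> zariski V closure_of dependent_systems J'' I"
    using xV by (simp add: zariski_closure_of[OF dependent_systems_subset])
  then show ?thesis using JJ'' by blast
qed


lemma val_cong: "(\<And>a. a \<in> A i \<Longrightarrow> x (i, a) = y (i, a)) \<Longrightarrow> val x i \<xi> = val y i \<xi>"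
  by (simp add: val_def)

lemma log_grad_cong: "(\<And>a. a \<in> A i \<Longrightarrow> x (i, a) = y (i, a)) \<Longrightarrow> log_grad x i \<xi> t = log_grad y i \<xi> t"
  by (simp add: log_grad_def)

lemma char_exp_shift:
  "char_exp K a (\<lambda>t. \<xi> t + s * \<eta> t) = char_exp K a \<xi> * exp (s * (\<Sum>t\<in>K. of_int (a t) * \<eta> t))"
  unfolding char_exp_add[of K a \<xi> "\<lambda>t. s * \<eta> t"]
  by (simp add: char_exp_def sum_distrib_left mult.left_commute)

text \<open>Fix a system \<open>x\<close> in \<open>dependent_systems J J\<close>. The systems \<open>p\<close> that agree with \<open>x\<close> on \<open>J\<close> and
  have a common zero \<open>\<xi>\<close> which is also a degenerate zero of \<open>x\<close> are Zariski dense among those that agree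
  with \<open>x\<close> on \<open>J\<close>: if a polynomial vanishes at all these \<open>p\<close>, then so do its partial derivatives.
  Indeed, at \<open>p\<close> the derivatives with index \<open>i \<notin> J\<close> are a multiple \<open>\<mu> i\<close> of the characters at \<open>\<xi>\<close>,
  and moving \<open>\<xi>\<close> in the directions dual to \<open>b i - b' i\<close> gives linear equations for
  \<open>\<mu>\<close>, which are diagonally dominant after adding a large multiple of the binomials to \<open>p\<close>.\<close>

lemma dependent_systems_dense:
  assumes J: "J \<subseteq> I" and A: "\<And>i. i \<in> I \<Longrightarrow> A i \<noteq> {}" "\<And>i. i \<in> I \<Longrightarrow> A i \<subseteq> lattice K"
    and cod: "\<And>J'. J \<subseteq> J' \<Longrightarrow> J' \<subseteq> I \<Longrightarrow> codim A J \<le> codim A J'"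
    and x: "x \<in> dependent_systems J J"
  shows "x \<in> zariski V closure_of dependent_systems J I"
proof -
  define Q where "Q = I - J"
  define D where "D = differences A J"
  have finJ: "finite J" "finite Q" using finite_subset[OF J finite_I] finite_I by (auto simp: Q_def)
  have finD: "finite D" unfolding D_def using finJ J finite_A by (intro finite_differences) auto
  define B where "B i = differences A {i}" for i
  have "\<exists>\<beta>. (\<forall>i\<in>Q. \<beta> i \<in> B i) \<and> dim (D \<union> \<beta> ` Q) \<ge> dim D + card Q"
  proof (rule ex_independent_transversal[OF finD finJ(2)])
    show "finite (B i)" if "i \<in> Q" for i
      unfolding B_def using that finite_A by (intro finite_differences) (auto simp: Q_def)
    fix P assume P: "P \<subseteq> Q"
    have finP: "finite P" using P finJ finite_subset by blast
    have eq: "D \<union> (\<Union>i\<in>P. B i) = differences A (J \<union> P)" by (auto simp: D_def B_def differences_def)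
    have sub: "J \<union> P \<subseteq> I" using J P by (auto simp: Q_def)
    have "codim A J = int (dim D) - int (card J)"
      unfolding D_def using J A finJ by (intro codim_eq) auto
    moreover have "codim A (J \<union> P) = int (dim (D \<union> (\<Union>i\<in>P. B i))) - int (card (J \<union> P))"
      unfolding eq using sub A finJ finP by (intro codim_eq) auto
    moreover have "card (J \<union> P) = card J + card P"
      using finJ finP P by (intro card_Un_disjoint) (auto simp: Q_def)
    ultimately show "dim D + card P \<le> dim (D \<union> (\<Union>i\<in>P. B i))" using cod[of "J \<union> P"] sub by auto
  qed
  then obtain \<beta> where \<beta>: "\<And>i. i \<in> Q \<Longrightarrow> \<beta> i \<in> B i" "dim (D \<union> \<beta> ` Q) \<ge> dim D + card Q" by blast
  have "\<exists>b b'. b \<in> A i \<and> b' \<in> A i \<and> \<beta> i = real_vec b - real_vec b'" if "i \<in> Q" for i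
    using \<beta>(1)[OF that] unfolding B_def differences_def by blast
  then obtain b b' where b: "\<And>i. i \<in> Q \<Longrightarrow> b i \<in> A i" "\<And>i. i \<in> Q \<Longrightarrow> b' i \<in> A i"
    "\<And>i. i \<in> Q \<Longrightarrow> \<beta> i = real_vec (b i) - real_vec (b' i)" by metis
  have "\<exists>g :: ('k \<Rightarrow> real) \<Rightarrow> real. linear g \<and> (\<forall>d\<in>D. g d = 0) \<and> (\<forall>k\<in>Q. g (\<beta> k) = of_bool (k = i))"
    if "i \<in> Q" for i
    by (rule ex_dual_functional[OF finD finJ(2) \<beta>(2) that])
  then obtain g :: "'i \<Rightarrow> ('k \<Rightarrow> real) \<Rightarrow> real" where g: "\<And>i. i \<in> Q \<Longrightarrow> linear (g i)"
    "\<And>i d. i \<in> Q \<Longrightarrow> d \<in> D \<Longrightarrow> g i d = 0" "\<And>i k. i \<in> Q \<Longrightarrow> k \<in> Q \<Longrightarrow> g i (\<beta> k) = of_bool (k = i)" by metis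
  \<comment> \<open>The functional \<open>g i\<close> is 0 on \<open>D\<close>, so moving \<xi>
    along \<open>\<eta> i\<close> scales all monomials of a polynomial with index in
    \<open>J\<close> by one common factor. A degenerate zero stays degenerate.\<close>
  define \<eta> where "\<eta> i t = complex_of_real (g i (\<lambda>u. of_bool (u = t)))" for i t
  define dot where "dot a i = (\<Sum>t\<in>K. of_int (a t) * \<eta> i t)" for a :: "'k \<Rightarrow> int" and i
  have dot: "dot a i = of_real (g i (real_vec a))" if i: "i \<in> Q" and a: "a \<in> A k" "k \<in> I" for a i k
  proof -
    have "real_vec a t = 0" if "t \<notin> K" for t using A(2)[OF a(2)] a(1) that
      by (auto simp: lattice_def real_vec_def)
    then have "g i (real_vec a) = (\<Sum>t\<in>K. real_vec a t * g i (\<lambda>u. of_bool (u = t)))"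
      by (rule linear_functional_coordinates[OF g(1)[OF i] finite_K])
    then show ?thesis by (simp add: dot_def \<eta>_def real_vec_def)
  qed
  have dot_J: "dot a i = dot a' i" if "i \<in> Q" "j \<in> J" "a \<in> A j" "a' \<in> A j" for a a' i j
  proof -
    have "real_vec a - real_vec a' \<in> D" using that unfolding D_def differences_def by blast
    then have "g i (real_vec a) - g i (real_vec a') = 0" using g(2) g(1) that by (metis linear_diff)
    moreover have "j \<in> I" using that J by blast
    ultimately show ?thesis using dot[of i a j] dot[of i a' j] that by simp
  qed
  have dot_Q: "dot (b k) i - dot (b' k) i = of_bool (k = i)" if "i \<in> Q" "k \<in> Q" for i k
  proof -
    have kI: "k \<in> I" using that by (auto simp: Q_def)
    have "g i (real_vec (b k)) - g i (real_vec (b' k)) = of_bool (k = i)"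
      using g(1)[OF that(1)] g(3)[OF that] b(3)[OF that(2)] by (metis linear_diff)
    then have "complex_of_real (g i (real_vec (b k)) - g i (real_vec (b' k)))
        = complex_of_real (of_bool (k = i))" by simp
    then show ?thesis using dot[OF that(1) b(1)[OF that(2)] kI] dot[OF that(1) b(2)[OF that(2)] kI]
      by simp
  qed
  define good where "good p \<xi> \<longleftrightarrow> p \<in> affine_space V \<and> (\<forall>j\<in>J. \<forall>a\<in>A j. p (j, a) = x (j, a)) \<and>
    (\<forall>i\<in>Q. val p i \<xi> = 0) \<and> (\<forall>j\<in>J. val x j \<xi> = 0) \<and>
    (\<exists>\<nu>. (\<forall>j\<in>J. \<nu> j \<noteq> 0) \<and> (\<forall>t\<in>K. (\<Sum>j\<in>J. \<nu> j * log_grad x j \<xi> t) = 0))" for p \<xi>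
  define W where "W = Sigma Q A"
  have WV: "W \<subseteq> V" "finite W" using finJ finite_A by (auto simp: W_def Q_def)
  have good_mem: "p \<in> dependent_systems J I" if p: "good p \<xi>" for p \<xi>
  proof -
    have "val p i \<xi> = 0" if i: "i \<in> I" for i
    proof (cases "i \<in> J")
      case True
      then have "val p i \<xi> = val x i \<xi>" using p by (intro val_cong) (auto simp: good_def)
      then show ?thesis using True p by (simp add: good_def)
    next
      case False
      then show ?thesis using i p by (simp add: good_def Q_def)
    qed
    moreover have lg: "log_grad p j \<xi> t = log_grad x j \<xi> t" if "j \<in> J" for j t
      using p that by (intro log_grad_cong) (auto simp: good_def)
    moreover obtain \<nu> where "\<And>j. j \<in> J \<Longrightarrow> \<nu> j \<noteq> 0" "\<And>t. t \<in> K \<Longrightarrow> (\<Sum>j\<in>J. \<nu> j * log_grad x j \<xi> t) = 0"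
      using p unfolding good_def by blast
    ultimately show ?thesis
      using p unfolding good_def dependent_systems_def
      by (intro CollectI conjI exI[of _ \<xi>] exI[of _ \<nu>]) (auto simp: lg cong: sum.cong)
  qed
  have good_line: "good (\<lambda>v. p v + s * (\<Sum>k\<in>R. c k * binomial \<xi> (f k) (d k) (d' k) v)) \<xi>"
    if p: "good p \<xi>" and R: "\<And>k. k \<in> R \<Longrightarrow> f k \<in> Q" "\<And>k. k \<in> R \<Longrightarrow> d k \<in> A (f k)" "\<And>k. k \<in> R \<Longrightarrow> d' k
        \<in> A (f k)"
    for p \<xi> s c f d d' and R :: "'i set"
  proof -
    have "binomial \<xi> (f k) (d k) (d' k) v = 0" if "k \<in> R" "v \<notin> W" for k v
      using that R by (auto simp: binomial_def W_def)
    then have out: "(\<Sum>k\<in>R. c k * binomial \<xi> (f k) (d k) (d' k) v) = 0" if "v \<notin> W" for v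
      using that by simp
    have "f k \<in> I" if "k \<in> R" for k using R(1)[OF that] by (simp add: Q_def)
    then have "val (\<lambda>v. p v + s * (\<Sum>k\<in>R. c k * binomial \<xi> (f k) (d k) (d' k) v)) i \<xi> = val p i \<xi>" for i
      unfolding val_linear using R by (simp add: val_binomial)
    then show ?thesis
      using p out WV(1) unfolding good_def affine_space_def by (auto simp: W_def Q_def)
  qed
  \<comment> \<open>The coefficients in \<open>W\<close> absorb the change of the characters, which
    keeps the values on \<open>Q\<close>; the common factor \<open>exp (s * \<kappa> j)\<close> on
    \<open>J\<close> is absorbed by the relation.\<close>
  have good_shift: "good (\<lambda>v. if v \<in> W then p v * exp (- (s * dot (snd v) i)) else p v) (\<lambda>t. \<xi> t
      + s * \<eta> i t)"
    (is "good ?p ?\<xi>") if p: "good p \<xi>" and i: "i \<in> Q" for p \<xi> i s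
  proof -
    have sh: "char_exp K a ?\<xi> = char_exp K a \<xi> * exp (s * dot a i)" for a
      unfolding dot_def by (rule char_exp_shift)
    have 1: "val ?p k ?\<xi> = val p k \<xi>" if "k \<in> Q" for k
      unfolding val_def using that by (intro sum.cong refl) (simp add: W_def sh exp_minus)
    define \<kappa> where "\<kappa> j = dot (SOME a. a \<in> A j) i" for j
    have \<kappa>: "dot a i = \<kappa> j" if "j \<in> J" "a \<in> A j" for a j
      unfolding \<kappa>_def by (rule dot_J[OF i that(1) that(2)]) (rule someI[of "\<lambda>a. a \<in> A j", OF that(2)])
    have 2: "val x j ?\<xi> = exp (s * \<kappa> j) * val x j \<xi>" if "j \<in> J" for j
      unfolding val_def sum_distrib_left using that by (intro sum.cong refl) (simp add: sh \<kappa>)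
    have 3: "log_grad x j ?\<xi> t = exp (s * \<kappa> j) * log_grad x j \<xi> t" if "j \<in> J" for j t
      unfolding log_grad_def sum_distrib_left using that by (intro sum.cong refl) (simp add: sh \<kappa>)
    obtain \<nu> where \<nu>: "\<And>j. j \<in> J \<Longrightarrow> \<nu> j \<noteq> 0" "\<And>t. t \<in> K \<Longrightarrow> (\<Sum>j\<in>J. \<nu> j * log_grad x j \<xi> t) = 0"
      using p unfolding good_def by blast
    have "(\<Sum>j\<in>J. (\<nu> j * exp (- (s * \<kappa> j))) * log_grad x j ?\<xi> t) = (\<Sum>j\<in>J. \<nu> j * log_grad x j \<xi> t)" for t
      by (intro sum.cong refl) (simp add: 3 exp_minus)
    then have "\<exists>\<nu>. (\<forall>j\<in>J. \<nu> j \<noteq> 0) \<and> (\<forall>t\<in>K. (\<Sum>j\<in>J. \<nu> j * log_grad x j ?\<xi> t) = 0)"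
      using \<nu> by (intro exI[of _ "\<lambda>j. \<nu> j * exp (- (s * \<kappa> j))"]) auto
    then show ?thesis
      using p 1 2 WV(1) unfolding good_def affine_space_def by (auto simp: W_def Q_def)
  qed
  define Z where "Z = {p. \<exists>\<xi>. good p \<xi>}"
  have Z_closed: "vanishes_on (partial (k, a) H) Z"
    if H: "H \<in> polys_on V" "vanishes_on H Z" and k: "k \<in> Q" "a \<in> A k" for H k a
    unfolding vanishes_on_def
  proof
    fix p assume "p \<in> Z"
    then obtain \<xi> where p: "good p \<xi>" by (auto simp: Z_def)
    \<comment> \<open>The added binomials vanish at \<xi> and have gradients
      \<open>\<beta> i\<close>, dual to the directions \<open>\<eta> i\<close>; they add
      \<open>s\<close> times the identity to the matrix \<open>M\<close>.\<close>
    define ps where "ps s v = p v + s * (\<Sum>i\<in>Q. 1 * binomial \<xi> i (b i) (b' i) v)" for s v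
    have ps: "good (ps s) \<xi>" for s
      unfolding ps_def by (rule good_line[OF p]) (use b in auto)
    define M where "M i i' = (\<Sum>t\<in>K. \<eta> i t * log_grad p i' \<xi> t)" for i i'
    define F where "F s v = poly_eval (partial v H) (ps s)" for s v
    define \<mu> where "\<mu> s i = F s (i, b i) / char_exp K (b i) \<xi>" for s i
    \<comment> \<open>Moving along the binomial with exponents \<open>d\<close> and
      \<open>b i\<close> keeps the zero \<xi>, so \<open>H\<close> stays 0. Its derivative in this
      direction compares the two quotients of \<open>F\<close> by the characters.\<close>
    have F_eq: "F s (i, d) = \<mu> s i * char_exp K d \<xi>" if i: "i \<in> Q" and d: "d \<in> A i" for s i d
    proof -
      have iI: "i \<in> I" using i by (simp add: Q_def)
      define q where "q r v = ps s v + r * binomial \<xi> i d (b i) v" for r v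
      have qr: "good (q r) \<xi>" for r
        using good_line[OF ps[of s], of "{i}" "\<lambda>i. i" "\<lambda>_. d" b r "\<lambda>_. 1"] i d b unfolding q_def by simp
      then have "poly_eval H (q r) = 0" for r using H(2) by (auto simp: vanishes_on_def Z_def)
      then have "((\<lambda>r. poly_eval H (q r)) has_field_derivative 0) (at 0)" by simp
      moreover have "((\<lambda>r. poly_eval H (q r)) has_field_derivative
          (\<Sum>v\<in>V. poly_eval (partial v H) (q 0) * binomial \<xi> i d (b i) v)) (at 0)"
        by (rule poly_eval_chain_rule[OF finite_V H(1)]) (auto simp: q_def intro!: derivative_eq_intros)
      ultimately have "(\<Sum>v\<in>V. poly_eval (partial v H) (q 0) * binomial \<xi> i d (b i) v) = 0"
        using DERIV_unique by blast
      moreover have "q 0 = ps s" by (simp add: q_def fun_eq_iff)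
      then have "poly_eval (partial v H) (q 0) * binomial \<xi> i d (b i) v
          = (if v = (i, d) then F s v / char_exp K d \<xi> else 0)
            - (if v = (i, b i) then F s v / char_exp K (b i) \<xi> else 0)" for v
        by (simp add: binomial_def F_def right_diff_distrib)
      ultimately have "0 = (\<Sum>v\<in>V. (if v = (i, d) then F s v / char_exp K d \<xi> else 0)
          - (if v = (i, b i) then F s v / char_exp K (b i) \<xi> else 0))"
        by simp
      also have "\<dots> = F s (i, d) / char_exp K d \<xi> - F s (i, b i) / char_exp K (b i) \<xi>"
        unfolding sum_subtractf using finite_V iI d b(1)[OF i] by simp
      finally show ?thesis by (simp add: \<mu>_def field_simps)
    qed
    have eqs: "(\<Sum>i'\<in>Q. \<mu> s i' * M i i') + s * \<mu> s i = 0" if i: "i \<in> Q" for s i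
    proof -
      define q where "q r v = (if v \<in> W then ps s v * exp (- (r * dot (snd v) i)) else ps s v)" for r v
      have "good (q r) (\<lambda>t. \<xi> t + r * \<eta> i t)" for r
        unfolding q_def by (rule good_shift[OF ps i])
      then have "poly_eval H (q r) = 0" for r using H(2) by (auto simp: vanishes_on_def Z_def)
      then have "((\<lambda>r. poly_eval H (q r)) has_field_derivative 0) (at 0)" by simp
      moreover have "((\<lambda>r. poly_eval H (q r)) has_field_derivative
          (\<Sum>v\<in>V. poly_eval (partial v H) (q 0) * (if v \<in> W then - (ps s v * dot (snd v) i) else 0)))
              (at 0)"
        by (rule poly_eval_chain_rule[OF finite_V H(1)]) (auto simp: q_def intro!: derivative_eq_intros)
      ultimately have "(\<Sum>v\<in>V. poly_eval (partial v H) (q 0) * (if v \<in> W then - (ps s v * dot (snd v)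
          i) else 0)) = 0"
        using DERIV_unique by blast
      moreover have "q 0 = ps s" by (simp add: q_def fun_eq_iff)
      then have "poly_eval (partial v H) (q 0) * (if v \<in> W then - (ps s v * dot (snd v) i) else 0)
          = (if v \<in> W then - (F s v * ps s v * dot (snd v) i) else 0)" for v
        by (simp add: F_def mult.assoc)
      ultimately have "0 = (\<Sum>v\<in>V. if v \<in> W then - (F s v * ps s v * dot (snd v) i) else 0)"
        by simp
      also have "\<dots> = (\<Sum>v\<in>W. - (F s v * ps s v * dot (snd v) i))"
        using WV finite_V by (simp add: sum.inter_restrict[symmetric] Int_absorb1)
      also have "\<dots> = - (\<Sum>i'\<in>Q. \<Sum>a\<in>A i'. F s (i', a) * ps s (i', a) * dot a i)"
        unfolding sum_negf W_def using finJ finite_A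
        by (subst sum.Sigma) (auto simp: Q_def case_prod_unfold)
      also have "(\<Sum>i'\<in>Q. \<Sum>a\<in>A i'. F s (i', a) * ps s (i', a) * dot a i)
          = (\<Sum>i'\<in>Q. \<mu> s i' * (\<Sum>t\<in>K. \<eta> i t * log_grad (ps s) i' \<xi> t))"
      proof (intro sum.cong refl)
        fix i' assume i': "i' \<in> Q"
        have "(\<Sum>a\<in>A i'. F s (i', a) * ps s (i', a) * dot a i)
            = (\<Sum>a\<in>A i'. \<Sum>t\<in>K. \<mu> s i' * (\<eta> i t * (ps s (i', a) * of_int (a t) * char_exp K a \<xi>)))"
          using i' by (intro sum.cong refl) (simp add: F_eq dot_def sum_distrib_left mult_ac)
        also have "\<dots> = (\<Sum>t\<in>K. \<Sum>a\<in>A i'. \<mu> s i' * (\<eta> i t * (ps s (i', a) * of_int (a t)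
            * char_exp K a \<xi>)))"
          by (rule sum.swap)
        finally show "(\<Sum>a\<in>A i'. F s (i', a) * ps s (i', a) * dot a i)
            = \<mu> s i' * (\<Sum>t\<in>K. \<eta> i t * log_grad (ps s) i' \<xi> t)"
          by (simp add: log_grad_def sum_distrib_left)
      qed
      also have "\<dots> = (\<Sum>i'\<in>Q. \<mu> s i' * (M i i' + s * of_bool (i' = i)))"
      proof (intro sum.cong refl arg_cong2[where f = "(*)"])
        fix i' assume i': "i' \<in> Q"
        have "log_grad (ps s) i' \<xi> t = log_grad p i' \<xi> t + s * (of_int (b i' t) - of_int (b' i' t))"
          for t
        proof -
          have "log_grad (binomial \<xi> k (b k) (b' k)) i' \<xi> t
              = (if i' = k then of_int (b k t) - of_int (b' k t) else 0)" if "k \<in> Q" for k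
            using that b by (intro log_grad_binomial) (auto simp: Q_def)
          then have "(\<Sum>k\<in>Q. 1 * log_grad (binomial \<xi> k (b k) (b' k)) i' \<xi> t)
              = (\<Sum>k\<in>Q. if i' = k then of_int (b k t) - of_int (b' k t) else 0)"
            by (intro sum.cong) auto
          also have "\<dots> = of_int (b i' t) - of_int (b' i' t)" using finJ(2) i' by simp
          finally show ?thesis unfolding ps_def log_grad_linear by simp
        qed
        then have "(\<Sum>t\<in>K. \<eta> i t * log_grad (ps s) i' \<xi> t)
            = M i i' + s * (dot (b i') i - dot (b' i') i)"
          by (simp add: M_def dot_def distrib_left right_diff_distrib sum.distrib sum_subtractf sum_distrib_left mult_ac)
        then show "(\<Sum>t\<in>K. \<eta> i t * log_grad (ps s) i' \<xi> t) = M i i' + s * of_bool (i' = i)"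
          by (simp only: dot_Q[OF i i'])
      qed
      also have "\<dots> = (\<Sum>i'\<in>Q. \<mu> s i' * M i i' + (if i' = i then s * \<mu> s i' else 0))"
        by (intro sum.cong refl) (simp add: distrib_left)
      also have "\<dots> = (\<Sum>i'\<in>Q. \<mu> s i' * M i i') + s * \<mu> s i"
        using finJ(2) i by (simp add: sum.distrib)
      finally have "- ((\<Sum>i'\<in>Q. \<mu> s i' * M i i') + s * \<mu> s i) = 0" by (rule sym)
      then show ?thesis by (simp only: neg_equal_0_iff_equal)
    qed
    define c where "c = (\<Sum>i\<in>Q. \<Sum>i'\<in>Q. norm (M i i'))"
    have large: "F s (k, a) = 0" if "s \<in> - cball 0 c" for s
    proof -
      have "\<mu> s k = 0"
        by (rule diagonally_dominant_kernel[OF finJ(2), of M s]) (use that eqs k in \<open>auto simp: c_def\<close>)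
      then show ?thesis using F_eq[OF k] by simp
    qed
    \<comment> \<open>The vanishing is known only for parameters \<open>s\<close> of norm above
      \<open>c\<close>. As \<open>F\<close> is entire in \<open>s\<close>, it reaches 0, where the
      perturbed point is \<open>p\<close> itself.\<close>
    have "F 0 (k, a) = 0"
    proof (rule analytic_continuation_open[of "- cball 0 c" UNIV "\<lambda>s. F s (k, a)" "\<lambda>_. 0"])
      have "complex_of_real (\<bar>c\<bar> + 1) \<in> - cball 0 c" by (simp add: norm_of_real del: of_real_add)
      then show "- cball (0 :: complex) c \<noteq> {}" by blast
      show "(\<lambda>s. F s (k, a)) holomorphic_on UNIV"
        unfolding F_def ps_def by (intro poly_eval_holomorphic holomorphic_intros)
    qed (use large in auto)
    moreover have "ps 0 = p" by (simp add: ps_def fun_eq_iff)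
    ultimately show "poly_eval (partial (k, a) H) p = 0" by (simp add: F_def)
  qed
  obtain \<xi>0 \<nu>0 where xV: "x \<in> affine_space V" and \<xi>0: "\<And>j. j \<in> J \<Longrightarrow> val x j \<xi>0 = 0"
    "\<And>j. j \<in> J \<Longrightarrow> \<nu>0 j \<noteq> 0" "\<And>t. t \<in> K \<Longrightarrow> (\<Sum>j\<in>J. \<nu>0 j * log_grad x j \<xi>0 t) = 0"
    using x unfolding dependent_systems_def by blast
  \<comment> \<open>A good point to start from: the polynomials outside \<open>J\<close> are erased,
    hence vanish at the degenerate zero of \<open>x\<close>.\<close>
  define p0 where "p0 v = (if v \<in> W then 0 else x v)" for v
  have p0: "good p0 \<xi>0"
    unfolding good_def
  proof (intro conjI ballI)
    show "p0 \<in> affine_space V" using xV by (simp add: affine_space_def p0_def)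
    show "p0 (j, a) = x (j, a)" if "j \<in> J" for j a using that by (simp add: p0_def W_def Q_def)
    show "val p0 i \<xi>0 = 0" if "i \<in> Q" for i using that by (simp add: val_def p0_def W_def)
  qed (use \<xi>0 in auto)
  define u where "u v = x v - p0 v" for v
  define line where "line s v = p0 v + s * u v" for s v
  \<comment> \<open>The derivative along the line from \<open>p0\<close> to \<open>x\<close>. All
    iterates of \<open>L\<close> on \<open>H\<close> vanish at \<open>p0\<close>, so the Taylor
    series of \<open>H\<close> on the line is 0, although intermediate points of the line need not
    be good.\<close>
  define L where "L H = (\<Sum>v\<in>W. const_poly (u v) * partial v H)" for H
  have L: "L H \<in> polys_on V \<and> vanishes_on (L H) Z" if "H \<in> polys_on V" "vanishes_on H Z" for H
  proof
    show "L H \<in> polys_on V" unfolding L_def using that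
      by (intro polys_on_sum polys_on_mult polys_on_const partial_in_polys_on)
    have "vanishes_on (partial v H) Z" if "v \<in> W" for v
      using Z_closed[OF \<open>H \<in> polys_on V\<close> \<open>vanishes_on H Z\<close>, of "fst v" "snd v"] that
        by (auto simp: W_def)
    then show "vanishes_on (L H) Z"
      by (simp add: vanishes_on_def L_def poly_eval_sum poly_eval_mult)
  qed
  have dL: "deriv (\<lambda>s. poly_eval H (line s)) = (\<lambda>s. poly_eval (L H) (line s))" if "H \<in> polys_on V" for H
  proof
    fix s
    have "((\<lambda>s. poly_eval H (line s)) has_field_derivative (\<Sum>v\<in>V. poly_eval (partial v H) (line s)
        * u v)) (at s)"
      by (rule poly_eval_chain_rule[OF finite_V that])
          (auto simp: line_def intro!: derivative_eq_intros)
    also have "(\<Sum>v\<in>V. poly_eval (partial v H) (line s) * u v) = (\<Sum>v\<in>W. poly_eval (partial v H)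
        (line s) * u v)"
      using WV finite_V by (intro sum.mono_neutral_right) (auto simp: u_def p0_def)
    also have "\<dots> = poly_eval (L H) (line s)"
      by (simp add: L_def poly_eval_sum poly_eval_mult mult.commute)
    finally show "deriv (\<lambda>s. poly_eval H (line s)) s = poly_eval (L H) (line s)"
      by (rule DERIV_imp_deriv)
  qed
  have "poly_eval H x = 0" if H: "H \<in> polys_on V" "vanishes_on H (dependent_systems J I)" for H
  proof -
    have "vanishes_on H Z" using H(2) good_mem by (auto simp: vanishes_on_def Z_def)
    then have Ln: "(L ^^ n) H \<in> polys_on V \<and> vanishes_on ((L ^^ n) H) Z" for n
      by (induction n) (use H L in auto)
    have "(deriv ^^ n) (\<lambda>s. poly_eval H (line s)) = (\<lambda>s. poly_eval ((L ^^ n) H) (line s))" for n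
      by (induction n) (use Ln in \<open>auto simp: dL\<close>)
    moreover have "line 0 = p0" by (simp add: line_def fun_eq_iff)
    moreover have "p0 \<in> Z" using p0 by (auto simp: Z_def)
    ultimately have der: "(deriv ^^ n) (\<lambda>s. poly_eval H (line s)) 0 = 0" for n
      using Ln[of n] by (simp add: vanishes_on_def)
    have "poly_eval H (line 1) = 0"
    proof (rule holomorphic_fun_eq_0_on_connected[of "\<lambda>s. poly_eval H (line s)" UNIV 0])
      show "(\<lambda>s. poly_eval H (line s)) holomorphic_on UNIV"
        unfolding line_def by (intro poly_eval_holomorphic holomorphic_intros)
    qed (use der in auto)
    moreover have "line 1 = x" by (simp add: line_def u_def fun_eq_iff)
    ultimately show ?thesis by simp
  qed
  then show ?thesis using xV by (simp add: zariski_closure_of[OF dependent_systems_subset])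
qed

end

section \<open>Changing the ambient variables\<close>

lemma singular_locus_update:
  assumes x: "x \<in> singular_locus V N K e" and w: "w \<in> V" "w \<notin> N"
  shows "x(w := z) \<in> singular_locus V N K e"
proof -
  obtain \<xi> where \<xi>: "x \<in> affine_space V" "singular_at N K e x \<xi>" using x
    by (auto simp: singular_locus_def)
  have "(\<Sum>n\<in>N. (x(w := z)) n * h n) = (\<Sum>n\<in>N. x n * h n)" for h
    by (intro sum.cong) (use w in auto)
  from this[of "\<lambda>n. char_exp K (e n) \<xi>"] this[of "\<lambda>n. of_int (e n t) * char_exp K (e n) \<xi>" for t]
  have "singular_at N K e (x(w := z)) \<xi>" using \<xi>(2) by (simp add: singular_at_def mult.assoc)
  moreover have "x(w := z) \<in> affine_space V" using \<xi>(1) w by (auto simp: affine_space_def)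
  ultimately show ?thesis by (auto simp: singular_locus_def)
qed

text \<open>The locus is invariant under changes of a coordinate outside \<open>N\<close>, so
  vanishing holds coefficient by coefficient in \<open>w\<close>.\<close>

lemma vanishes_on_coeffs:
  assumes F: "vanishes_on F (singular_locus V N K e)" and w: "w \<in> V" "w \<notin> N"
  shows "vanishes_on (coeff (as_poly w F) i) (singular_locus V N K e)"
  unfolding vanishes_on_def
proof
  fix x assume "x \<in> singular_locus V N K e"
  then have "x(w := z) \<in> singular_locus V N K e" for z by (rule singular_locus_update[OF _ w])
  then have "poly_eval (poly (as_poly w F) (poly_var w)) (x(w := z)) = 0" for z
    using F by (simp add: vanishes_on_def)
  then show "poly_eval (coeff (as_poly w F) i) x = 0"
    by (rule poly_eval_coeff_0[OF as_poly_coeff_free])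
qed

text \<open>For \<open>w\<close> outside \<open>N\<close> the leading coefficient of
  \<open>G\<close> in \<open>w\<close> vanishes on the locus too and is therefore a multiple of
  \<open>G\<close>; comparing degrees, \<open>G\<close> is free of \<open>w\<close>.\<close>

lemma hypersurface_vars:
  assumes V: "finite V" "N \<subseteq> V" and G: "hypersurface V (singular_locus V N K e) G"
  shows "G \<in> polys_on N"
proof -
  have Girr: "irreducible G" "G \<in> polys_on V"
    and Gv: "\<And>F. F \<in> polys_on V \<Longrightarrow> vanishes_on F (singular_locus V N K e) \<longleftrightarrow> G dvd F"
    using G by (auto simp: hypersurface_def)
  have G0: "G \<noteq> 0" using Girr by auto
  have "G \<in> polys_on (V - W)" if "finite W" "W \<subseteq> V - N" for W
    using that
  proof (induction W rule: finite_induct)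
    case (insert w W)
    then have w: "w \<in> V" "w \<notin> N" and IH: "G \<in> polys_on (V - W)" by auto
    let ?c = "lead_coeff (as_poly w G)"
    have "vanishes_on G (singular_locus V N K e)" using Gv[OF Girr(2)] by simp
    then have "vanishes_on ?c (singular_locus V N K e)" using w by (rule vanishes_on_coeffs)
    moreover have "?c \<in> polys_on V" using as_poly_coeff[OF Girr(2)] by (auto intro: polys_on_mono)
    ultimately have "G dvd ?c" using Gv by blast
    then obtain h where h: "?c = G * h" by (rule dvdE)
    have "?c \<noteq> 0" using G0 by simp
    then have "h \<noteq> 0" using h by auto
    moreover have "deg_in w ?c = 0" by (intro deg_in_free as_poly_coeff_free)
    ultimately have "deg_in w G = 0" using deg_in_mult[OF G0, of h w] h by simp
    then have "G \<in> polys_on (V - W - {w})" using IH by (rule deg_in_0_imp)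
    then show ?case by (simp add: Diff_insert[symmetric])
  qed (use Girr in simp)
  from this[of "V - N"] show ?thesis using V by (simp add: double_diff)
qed

lemma irreducible_rename:
  assumes G: "irreducible G" "G \<in> polys_on V" and g: "\<And>v. v \<in> V \<Longrightarrow> g (f v) = v"
  shows "irreducible (rename_vars f G)"
proof -
  have gf_p: "rename_vars g (rename_vars f p) = p" if "p \<in> polys_on V" for p
    by (rule rename_vars_rename[OF that]) (rule g)
  have fg_p: "rename_vars f (rename_vars g p) = p" if "p \<in> polys_on (f ` V)" for p
    by (rule rename_vars_rename[OF that]) (use g in auto)
  have r0: "rename_vars g 0 = 0" using rename_vars_const[of g 0] by simp
  have "rename_vars f G \<noteq> 0" using gf_p[OF G(2)] G(1) r0 by auto
  moreover have "\<not> rename_vars f G dvd 1"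
  proof
    assume "rename_vars f G dvd 1"
    then obtain c where "c \<noteq> 0" "rename_vars f G = const_poly c" by (auto simp: mpoly_unit_iff)
    then have "G = const_poly c" using gf_p[OF G(2)] by simp
    then show False using G(1) \<open>c \<noteq> 0\<close> by (auto simp: irreducible_def const_poly_unit)
  qed
  moreover have "a dvd 1 \<or> b dvd 1" if ab: "rename_vars f G = a * b" for a b
  proof -
    have "a * b \<in> polys_on (f ` V)" "b * a \<in> polys_on (f ` V)" "a * b \<noteq> 0" "b * a \<noteq> 0"
      using rename_vars_in_polys_on[OF G(2), of f] ab \<open>rename_vars f G \<noteq> 0\<close> by (auto simp: mult.commute)
    then have mem: "a \<in> polys_on (f ` V)" "b \<in> polys_on (f ` V)" using factor_in_polys_on by blast+
    have "G = rename_vars g a * rename_vars g b"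
      using gf_p[OF G(2)] by (simp add: ab rename_vars_mult)
    then have "rename_vars g a dvd 1 \<or> rename_vars g b dvd 1" using G(1) by (auto simp: irreducible_def)
    moreover have "p dvd 1" if p: "rename_vars g p dvd 1" "p \<in> polys_on (f ` V)" for p
    proof -
      obtain c where "c \<noteq> 0" "rename_vars g p = const_poly c" using p(1) by (auto simp: mpoly_unit_iff)
      then have "p = const_poly c" using fg_p[OF p(2)] by simp
      then show ?thesis using \<open>c \<noteq> 0\<close> by (simp add: const_poly_unit)
    qed
    ultimately show ?thesis using mem by blast
  qed
  ultimately show ?thesis by (auto simp: irreducible_def)
qed

context
  fixes V N :: "'a set" and V1 :: "'b set" and f :: "'b \<Rightarrow> 'a" and g :: "'a \<Rightarrow> 'b"
    and K :: "'k set" and e :: "'a \<Rightarrow> 'k \<Rightarrow> int" and e1 :: "'b \<Rightarrow> 'k \<Rightarrow> int"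
  assumes V: "finite V" "N \<subseteq> V"
    and fg: "f ` V1 = N" "\<And>v. v \<in> V1 \<Longrightarrow> g (f v) = v" and e: "\<And>v. v \<in> V1 \<Longrightarrow> e (f v) = e1 v"
begin

lemma vanishes_on_rename:
  assumes F: "F \<in> polys_on V1"
  shows "vanishes_on (rename_vars f F) (singular_locus V N K e)
      \<longleftrightarrow> vanishes_on F (singular_locus V1 V1 K e1)"
proof -
  have inj: "inj_on f V1" using fg(2) by (metis inj_onI)
  have sum: "(\<Sum>n\<in>N. h n) = (\<Sum>v\<in>V1. h (f v))" for h :: "'a \<Rightarrow> complex"
    unfolding fg(1)[symmetric] by (simp add: sum.reindex[OF inj])
  have sing: "singular_at N K e x \<xi> \<longleftrightarrow> singular_at V1 K e1 y \<xi>" if "\<And>v. v \<in> V1 \<Longrightarrow> x (f v) = y v" for x y \<xi>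
    unfolding singular_at_def sum using that e by (simp cong: sum.cong)
  show ?thesis
  proof
    assume L: "vanishes_on (rename_vars f F) (singular_locus V N K e)"
    show "vanishes_on F (singular_locus V1 V1 K e1)"
      unfolding vanishes_on_def
    proof
      fix y assume "y \<in> singular_locus V1 V1 K e1"
      then obtain \<xi> where y: "singular_at V1 K e1 y \<xi>" by (auto simp: singular_locus_def)
      define x where "x v = (if v \<in> N then y (g v) else 0)" for v
      have xy: "x (f v) = y v" if "v \<in> V1" for v using that fg by (auto simp: x_def)
      then have "singular_at N K e x \<xi>" using sing y by blast
      moreover have "x \<in> affine_space V" using V by (auto simp: affine_space_def x_def)
      ultimately have "poly_eval (rename_vars f F) x = 0" using L
        by (auto simp: vanishes_on_def singular_locus_def)
      moreover have "poly_eval F (x \<circ> f) = poly_eval F y" by (rule poly_eval_cong[OF F]) (simp add: xy)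
      ultimately show "poly_eval F y = 0" by (simp add: poly_eval_rename)
    qed
  next
    assume R: "vanishes_on F (singular_locus V1 V1 K e1)"
    show "vanishes_on (rename_vars f F) (singular_locus V N K e)"
      unfolding vanishes_on_def
    proof
      fix x assume "x \<in> singular_locus V N K e"
      then obtain \<xi> where x: "singular_at N K e x \<xi>" by (auto simp: singular_locus_def)
      have "singular_at V1 K e1 (truncate V1 (x \<circ> f)) \<xi>"
        using x sing[of x "truncate V1 (x \<circ> f)" \<xi>] by (simp add: truncate_def)
      then have "truncate V1 (x \<circ> f) \<in> singular_locus V1 V1 K e1" unfolding singular_locus_def by auto
      then have "poly_eval F (truncate V1 (x \<circ> f)) = 0" using R by (simp add: vanishes_on_def)
      then show "poly_eval (rename_vars f F) x = 0"
        by (simp add: poly_eval_rename poly_eval_truncate[OF F])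
    qed
  qed
qed

lemma rename_forth: "p \<in> polys_on N \<Longrightarrow> rename_vars f (rename_vars g p) = p"
  by (rule rename_vars_rename) (use fg in auto)

lemma rename_back: "p \<in> polys_on V1 \<Longrightarrow> rename_vars g (rename_vars f p) = p"
  by (rule rename_vars_rename) (use fg in auto)

lemma g_image: "g ` N = V1"
  using fg by (auto simp: image_iff)

text \<open>Variables outside \<open>N\<close> are free on the locus, so a vanishing polynomial is
  split into its coefficients in these variables one after another, until it involves only
  \<open>N\<close> and can be renamed to \<open>V1\<close>.\<close>

lemma hypersurface_rename:
  assumes G: "hypersurface V1 (singular_locus V1 V1 K e1) G"
  shows "hypersurface V (singular_locus V N K e) (rename_vars f G)"
proof -
  let ?S = "singular_locus V N K e" and ?G = "rename_vars f G"
  have Girr: "irreducible G" "G \<in> polys_on V1" using G by (auto simp: hypersurface_def)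
  have GN: "?G \<in> polys_on N" using rename_vars_in_polys_on[OF Girr(2), of f] fg(1) by simp
  have dvd: "?G dvd F" if "finite W" "W \<subseteq> V - N" "F \<in> polys_on (N \<union> W)" "vanishes_on F ?S" for F W
    using that
  proof (induction W arbitrary: F rule: finite_induct)
    case empty
    then have FN: "F \<in> polys_on N" by simp
    have F1: "rename_vars g F \<in> polys_on V1" using rename_vars_in_polys_on[OF FN, of g] g_image by simp
    have "vanishes_on (rename_vars g F) (singular_locus V1 V1 K e1)"
      using vanishes_on_rename[OF F1] rename_forth[OF FN] empty.prems by simp
    then have "G dvd rename_vars g F" using G F1 by (auto simp: hypersurface_def)
    then obtain h where "rename_vars g F = G * h" by (rule dvdE)
    then have "F = ?G * rename_vars f h" using rename_forth[OF FN] by (metis rename_vars_mult)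
    then show ?case by (rule dvdI)
  next
    case (insert w W)
    have w: "w \<in> V" "w \<notin> N" using insert by auto
    have "?G dvd coeff (as_poly w F) i" for i
    proof (rule insert.IH)
      have "N \<union> insert w W - {w} = N \<union> W" using insert w by auto
      then show "coeff (as_poly w F) i \<in> polys_on (N \<union> W)"
        using as_poly_coeff[OF insert.prems(2), of w i] by simp
      show "vanishes_on (coeff (as_poly w F) i) ?S" by (rule vanishes_on_coeffs[OF insert.prems(3) w])
    qed (use insert in auto)
    moreover have "?G \<in> polys_on (- {w})" using GN w by (auto intro: polys_on_mono)
    ultimately show ?case using free_dvd_iff[of ?G w F] by metis
  qed
  have vG: "vanishes_on ?G ?S" using vanishes_on_rename[OF Girr(2)] G by (auto simp: hypersurface_def)
  have "vanishes_on F ?S \<longleftrightarrow> ?G dvd F" if F: "F \<in> polys_on V" for F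
  proof
    have "F \<in> polys_on (N \<union> (V - N))" using F V(2) by (simp add: Un_absorb1)
    then show "?G dvd F" if "vanishes_on F ?S" using dvd[of "V - N" F] that V(1) by simp
    show "vanishes_on F ?S" if "?G dvd F" using vanishes_on_dvd[OF vG that] .
  qed
  then show ?thesis
    using irreducible_rename[OF Girr, of g f] fg(2) GN V(2)
      by (auto simp: hypersurface_def intro: polys_on_mono)
qed

text \<open>Possible because a generator involves only variables in \<open>N\<close>, where
  \<open>g\<close> inverts \<open>f\<close>.\<close>

lemma hypersurface_rename_back:
  assumes G: "hypersurface V (singular_locus V N K e) G"
  shows "hypersurface V1 (singular_locus V1 V1 K e1) (rename_vars g G)"
proof -
  have Girr: "irreducible G" using G by (auto simp: hypersurface_def)
  have GN: "G \<in> polys_on N" by (rule hypersurface_vars[OF V G])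
  have "irreducible (rename_vars g G)"
    by (rule irreducible_rename[OF Girr GN, of f]) (use fg in auto)
  moreover have "rename_vars g G \<in> polys_on V1" using rename_vars_in_polys_on[OF GN, of g] g_image
    by simp
  moreover have "vanishes_on F (singular_locus V1 V1 K e1) \<longleftrightarrow> rename_vars g G dvd F"
    if F: "F \<in> polys_on V1" for F
  proof -
    have "rename_vars f F \<in> polys_on V"
      using rename_vars_in_polys_on[OF F, of f] fg(1) V(2) by (auto intro: polys_on_mono)
    then have "vanishes_on F (singular_locus V1 V1 K e1) \<longleftrightarrow> G dvd rename_vars f F"
      using vanishes_on_rename[OF F] G by (auto simp: hypersurface_def)
    also have "\<dots> \<longleftrightarrow> rename_vars g G dvd F"
    proof
      assume "G dvd rename_vars f F"
      then obtain h where "rename_vars f F = G * h" by (rule dvdE)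
      then have "F = rename_vars g G * rename_vars g h" using rename_back[OF F]
        by (metis rename_vars_mult)
      then show "rename_vars g G dvd F" by (rule dvdI)
    next
      assume "rename_vars g G dvd F"
      then obtain h where "F = rename_vars g G * h" by (rule dvdE)
      then have "rename_vars f F = G * rename_vars f h" using rename_forth[OF GN]
        by (simp add: rename_vars_mult)
      then show "G dvd rename_vars f F" by (rule dvdI)
    qed
    finally show ?thesis .
  qed
  ultimately show ?thesis by (simp add: hypersurface_def)
qed

end

section \<open>The product formula\<close>

text \<open>For one polynomial the relation has a single non-zero coefficient, which
  cancels.\<close>

lemma singular_systems_single:
  assumes "finite K" "finite B"
  shows "singular_systems K {()} (\<lambda>_. B) = singular_locus ({()} \<times> B) ({()} \<times> B) K snd"
proof -
  interpret supports "{()}" K "\<lambda>_. B" by unfold_locales (use assms in auto)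
  have sum: "(\<Sum>n\<in>{()} \<times> B. h n) = (\<Sum>b\<in>B. h ((), b))" for h :: "unit \<times> ('a \<Rightarrow> int) \<Rightarrow> complex"
    by (rule sum.reindex_bij_witness[of _ "\<lambda>b. ((), b)" snd]) auto
  have sing: "singular_at ({()} \<times> B) K snd x \<xi> \<longleftrightarrow> val x () \<xi> = 0 \<and> (\<forall>t\<in>K. log_grad x () \<xi> t = 0)" for x \<xi>
    unfolding singular_at_def sum by (simp add: val_def log_grad_def)
  have "Pow {()} - {{}} = {{()}}" by auto
  then have "singular_systems K {()} (\<lambda>_. B) = dependent_systems {()} {()}"
    unfolding singular_systems_eq by simp
  also have "\<dots> = singular_locus ({()} \<times> B) ({()} \<times> B) K snd"
    unfolding dependent_systems_def singular_locus_def sing by (auto intro: exI[of _ "\<lambda>_. 1"])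
  finally show ?thesis .
qed

lemma const_poly_prod: "const_poly (\<Prod>s\<in>S. c s) = (\<Prod>s\<in>S. const_poly (c s))"
  by (induction S rule: infinite_finite_induct) (auto simp: const_poly_mult)

lemma reduced_discriminant_discriminant_of:
  assumes "discriminant_of (Sigma I A) (singular_systems K I A) D"
  shows "discriminant_of (Sigma I A) (singular_systems K I A) (reduced_discriminant K I A)"
  unfolding reduced_discriminant_def is_reduced_discriminant_iff using assms by (rule someI)

context supports
begin

text \<open>The description of discriminants for unions, applied to a single irreducible set: the
  index set \<open>H\<close> is \<open>{()}\<close> if its closure is a hypersurface and empty
  otherwise, when the empty product provides the value 1. Renaming identifies the variables of the
  Cayley set with the coefficients with index in \<open>J\<close>.\<close>

lemma cayley_discriminant_eq:
  assumes J: "J \<subseteq> I" "J \<noteq> {}" and A: "\<And>i. i \<in> I \<Longrightarrow> A i \<noteq> {}"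
    and G: "\<exists>G. hypersurface V (dependent_systems J J) G \<Longrightarrow> hypersurface V (dependent_systems J J) G"
  shows "\<exists>c. c \<noteq> 0 \<and> cayley_discriminant K I A J
    = const_poly c * (if \<exists>G. hypersurface V (dependent_systems J J) G then G else 1)"
proof -
  define B where "B = cayley_set A J"
  define f :: "unit \<times> ('k + 'i \<Rightarrow> int) \<Rightarrow> 'i \<times> ('k \<Rightarrow> int)" where "f = (\<lambda>(_, b). inv cayley_point b)"
  define g :: "'i \<times> ('k \<Rightarrow> int) \<Rightarrow> unit \<times> ('k + 'i \<Rightarrow> int)" where "g n = ((), cayley_point n)" for n
  define V1 where "V1 = {()} \<times> B"
  define S where "S = singular_systems (K <+> I) {()} (\<lambda>_. B)"
  define T where "T = singular_locus V1 V1 (K <+> I) snd"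
  have inv: "inv cayley_point (cayley_point n) = n" for n :: "'i \<times> ('k \<Rightarrow> int)"
    by (rule inv_f_f[OF inj_cayley_point])
  have finB: "finite B" unfolding B_def cayley_set_def using J(1) finite_I finite_A
    by (intro finite_imageI finite_SigmaI) (auto dest: finite_subset)
  have finK: "finite (K <+> I)" using finite_K finite_I by simp
  have B_ne: "B \<noteq> {}" unfolding B_def cayley_set_def using J A by (auto simp del: cayley_point.simps)
  have ST: "S = T" unfolding S_def T_def V1_def by (rule singular_systems_single[OF finK finB])
  have V1: "finite V1" "V1 \<noteq> {}" using finB B_ne by (auto simp: V1_def)
  have NV: "Sigma J A \<subseteq> V" using J by auto
  have fV1: "f ` V1 = Sigma J A"
  proof -
    have "V1 = g ` Sigma J A"
        by (auto simp: V1_def B_def cayley_set_def g_def simp del: cayley_point.simps)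
    moreover have "f (g n) = n" for n by (simp add: f_def g_def inv del: cayley_point.simps)
    ultimately show ?thesis by (simp add: image_image)
  qed
  have gf: "g (f v) = v" if "v \<in> V1" for v
    using that by (auto simp: V1_def B_def cayley_set_def f_def g_def inv simp del: cayley_point.simps)
  have e: "cayley_point (f v) = snd v" if "v \<in> V1" for v
    using gf[OF that] by (metis g_def snd_conv)
  note T_eq = dependent_systems_eq_singular_locus[OF J(1)]
  note to_V = hypersurface_rename[where f = f and g = g and K = "K <+> I" and e = cayley_point
    and ?e1.0 = snd,
      OF finite_V NV fV1 gf e, folded T_eq T_def]
  note to_V1 = hypersurface_rename_back[where f = f and g = g and K = "K <+> I" and e = cayley_point
    and ?e1.0 = snd,
      OF finite_V NV fV1 gf e, folded T_eq T_def]
  define H where "H = {u \<in> {()}. \<exists>G. hypersurface V1 T G}"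
  define G1 where "G1 = rename_vars g G"
  have ex: "(\<exists>G. hypersurface V1 T G) \<longleftrightarrow> (\<exists>G. hypersurface V (dependent_systems J J) G)"
    using to_V to_V1 by blast
  have irr: "irreducible_set V1 T" unfolding T_def by (rule irreducible_singular_locus) simp
  have proper: "\<exists>F\<in>polys_on V1. F \<noteq> 0 \<and> vanishes_on F T"
    unfolding T_def using V1 finK by (intro singular_locus_proper) auto
  have cl: "zariski V1 closure_of S = (\<Union>j\<in>{()}. zariski V1 closure_of T)" by (simp add: ST)
  have hyp: "hypersurface V1 T G1" if "j \<in> H" for j
    unfolding G1_def using that ex G by (intro to_V1) (auto simp: H_def)
  have V1_Sigma: "V1 = Sigma {()} (\<lambda>_. B)" by (simp add: V1_def)
  have "discriminant_of V1 S (\<Prod>j\<in>H. G1)"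
    by (rule discriminant_of_prod[where I = "{()}"
      and T = "\<lambda>_. T"]) (use irr proper cl hyp in \<open>auto simp: H_def\<close>)
  then have "discriminant_of V1 S (reduced_discriminant (K <+> I) {()} (\<lambda>_. B))"
    unfolding S_def V1_Sigma by (rule reduced_discriminant_discriminant_of)
  then have "\<exists>c. c \<noteq> 0 \<and> reduced_discriminant (K <+> I) {()} (\<lambda>_. B) = const_poly c * (\<Prod>j\<in>H. G1)"
    by (intro discriminant_of_unique[where I = "{()}" and T = "\<lambda>_. T" and V = V1 and S = S])
      (use irr proper cl hyp in \<open>auto simp: H_def\<close>)
  then obtain c where c: "c \<noteq> 0" "reduced_discriminant (K <+> I) {()} (\<lambda>_. B)
      = const_poly c * (\<Prod>j\<in>H. G1)" by blast
  have "cayley_discriminant K I A J = rename_vars f (const_poly c * (\<Prod>j\<in>H. G1))"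
    unfolding cayley_discriminant_def f_def B_def[symmetric] c(2) ..
  also have "\<dots> = const_poly c * rename_vars f (\<Prod>j\<in>H. G1)" by (simp add: rename_vars_mult)
  also have "rename_vars f (\<Prod>j\<in>H. G1) = (if \<exists>G. hypersurface V (dependent_systems J J) G then G else 1)"
  proof (cases "\<exists>G. hypersurface V (dependent_systems J J) G")
    case True
    then have "H = {()}" using ex by (auto simp: H_def)
    moreover have "G \<in> polys_on (Sigma J A)"
      using G[OF True] unfolding T_eq by (rule hypersurface_vars[OF finite_V NV])
    then have "rename_vars f G1 = G"
      unfolding G1_def by (rule rename_vars_rename) (simp add: f_def g_def inv del: cayley_point.simps)
    ultimately show ?thesis using True by simp
  next
    case False
    then have "H = {}" using ex by (auto simp: H_def)
    then show ?thesis using False rename_vars_const[of f 1] by simp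
  qed
  finally show ?thesis using c(1) by blast
qed

lemma reduced_discriminant_product:
  assumes A: "\<And>i. i \<in> I \<Longrightarrow> A i \<noteq> {}" "\<And>i. i \<in> I \<Longrightarrow> A i \<subseteq> lattice K"
  shows "\<exists>c. c \<noteq> 0 \<and> reduced_discriminant K I A = const_poly c *
    (\<Prod>J \<in> {J. J \<noteq> {} \<and> J \<subseteq> I \<and> (\<forall>J'. J \<subseteq> J' \<and> J' \<subseteq> I \<longrightarrow> codim A J
        \<le> codim A J')}. cayley_discriminant K I A J)"
proof -
  define \<G> where "\<G> = {J. J \<noteq> {} \<and> J \<subseteq> I \<and> (\<forall>J'. J \<subseteq> J' \<and> J' \<subseteq> I \<longrightarrow> codim A J \<le> codim A J')}"
  define T where "T J = dependent_systems J J" for J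
  have fin: "finite \<G>" using finite_I by (auto simp: \<G>_def intro: finite_subset[of _ "Pow I"])
  have sub: "J \<subseteq> I" "J \<noteq> {}" if "J \<in> \<G>" for J using that by (auto simp: \<G>_def)
  have T_eq: "T J = singular_locus V (Sigma J A) (K <+> I) cayley_point" if "J \<in> \<G>" for J
    unfolding T_def by (rule dependent_systems_eq_singular_locus[OF sub(1)[OF that]])
  have NV: "Sigma J A \<subseteq> V" "Sigma J A \<noteq> {}" if "J \<in> \<G>" for J
    using sub[OF that] A(1) by blast+
  have finK: "finite (K <+> I)" using finite_K finite_I by simp
  define U where "U = (\<Union>J\<in>\<G>. zariski V closure_of T J)"
  have U_closed: "closedin (zariski V) U" unfolding U_def using fin by (intro closedin_Union) auto
  have T_U: "T J \<subseteq> U" if "J \<in> \<G>" for J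
    unfolding U_def T_def using that closure_of_subset[of "dependent_systems J J" "zariski V"]
        dependent_systems_subset
    by auto
  \<comment> \<open>Every degeneration strictly enlarges \<open>J\<close>, so the complement in
    \<open>I\<close> serves as measure; it ends in a member of \<open>\<G>\<close>, at the latest in
    \<open>I\<close> itself.\<close>
  have in_U: "dependent_systems J I \<subseteq> U" if "J \<subseteq> I" "J \<noteq> {}" for J
    using that
  proof (induction "card (I - J)" arbitrary: J rule: less_induct)
    case less
    show ?case
    proof (cases "J \<in> \<G>")
      case True
      have "dependent_systems J I \<subseteq> T J"
        unfolding T_def dependent_systems_def using less.prems by blast
      then show ?thesis using T_U[OF True] by blast
    next
      case False
      then have "\<not> (\<forall>J'. J \<subseteq> J' \<and> J' \<subseteq> I \<longrightarrow> codim A J \<le> codim A J')"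
        using less.prems by (simp add: \<G>_def)
      then obtain J' where J': "J \<subseteq> J'" "J' \<subseteq> I" "codim A J' < codim A J"
        by (auto simp: not_le)
      show ?thesis
      proof
        fix x assume "x \<in> dependent_systems J I"
        then obtain J'' where J'': "J \<subset> J''" "J'' \<subseteq> I" "x
            \<in> zariski V closure_of dependent_systems J'' I"
          using dependent_systems_degenerate[OF J'(1,2) A(1) J'(3)] by blast
        have "card (I - J'') < card (I - J)" using J'' finite_I by (intro psubset_card_mono) auto
        then have "dependent_systems J'' I \<subseteq> U" using less.hyps J'' by blast
        then have "zariski V closure_of dependent_systems J'' I \<subseteq> U" using U_closed
          by (rule closure_of_minimal)
        then show "x \<in> U" using J''(3) by blast
      qed
    qed
  qed
  have cl: "zariski V closure_of singular_systems K I A = (\<Union>J\<in>\<G>. zariski V closure_of T J)"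
  proof
    have "singular_systems K I A \<subseteq> U" unfolding singular_systems_eq using in_U by blast
    then show "zariski V closure_of singular_systems K I A \<subseteq> (\<Union>J\<in>\<G>. zariski V closure_of T J)"
      unfolding U_def[symmetric] using U_closed by (rule closure_of_minimal)
    have "T J \<subseteq> zariski V closure_of singular_systems K I A" if J: "J \<in> \<G>" for J
    proof
      fix x assume "x \<in> T J"
      then have "x \<in> zariski V closure_of dependent_systems J I"
        unfolding T_def using sub[OF J] A J by (intro dependent_systems_dense) (auto simp: \<G>_def)
      moreover have "dependent_systems J I \<subseteq> singular_systems K I A"
        unfolding singular_systems_eq using sub[OF J] by blast
      ultimately show "x \<in> zariski V closure_of singular_systems K I A" using closure_of_mono by blast
    qed
    then show "(\<Union>J\<in>\<G>. zariski V closure_of T J) \<subseteq> zariski V closure_of singular_systems K I A"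
      by (intro UN_least closure_of_minimal) auto
  qed
  define H where "H = {J \<in> \<G>. \<exists>G. hypersurface V (T J) G}"
  define G where "G J = (SOME G. hypersurface V (T J) G)" for J
  have G: "hypersurface V (T J) (G J)" if "\<exists>G. hypersurface V (T J) G" for J
    unfolding G_def using that by (rule someI_ex)
  have GH: "hypersurface V (T J) (G J)" if "J \<in> H" for J using that G by (simp add: H_def)
  have irr: "irreducible_set V (T J)" if "J \<in> \<G>" for J
    unfolding T_eq[OF that] by (rule irreducible_singular_locus[OF NV(1)[OF that]])
  have proper: "\<exists>F\<in>polys_on V. F \<noteq> 0 \<and> vanishes_on F (T J)" if "J \<in> \<G>" for J
    unfolding T_eq[OF that] by (rule singular_locus_proper[OF finite_V finK NV[OF that]])
  have sub_if_dvd: "J2 \<subseteq> J1" if J: "J1 \<in> H" "J2 \<in> H" and dvd: "G J2 dvd G J1" for J1 J2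
  proof
    have J12: "J1 \<in> \<G>" "J2 \<in> \<G>" using J by (auto simp: H_def)
    fix j assume j: "j \<in> J2"
    show "j \<in> J1"
    proof (rule ccontr)
      assume nj: "j \<notin> J1"
      have jI: "j \<in> I" using j sub[OF J12(2)] by auto
      then obtain a where a: "a \<in> A j" using A by blast
      have "G J1 \<in> polys_on (Sigma J1 A)"
        using GH[OF J(1)] unfolding T_eq[OF J12(1)]
          by (rule hypersurface_vars[OF finite_V NV(1)[OF J12(1)]])
      then have "G J1 \<in> polys_on (V - {(j, a)})"
        by (rule polys_on_mono) (use nj sub[OF J12(1)] in auto)
      moreover have "G J1 \<noteq> 0" using GH[OF J(1)] by (auto simp: hypersurface_def)
      ultimately have "G J2 \<in> polys_on (V - {(j, a)})" using dvd dvd_in_polys_on by blast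
      moreover have "G J2 \<notin> polys_on (V - {(j, a)})"
        using hypersurface_involves[OF finite_V finK NV(1)[OF J12(2)], of "(j, a)"] j a GH[OF J(2)]
            T_eq[OF J12(2)]
        by auto
      ultimately show False by blast
    qed
  qed
  have distinct: "J1 = J2" if "J1 \<in> H" "J2 \<in> H" "G J1 dvd G J2" for J1 J2
  proof -
    have "G J2 dvd G J1"
      using irreducible_dvd_sym[OF _ _ that(3)] GH[OF that(1)] GH[OF that(2)]
        by (auto simp: hypersurface_def)
    then show ?thesis using sub_if_dvd that by blast
  qed
  have "discriminant_of V (singular_systems K I A) (prod G H)"
    by (rule discriminant_of_prod[OF fin irr proper cl H_def GH distinct])
  then have "discriminant_of V (singular_systems K I A) (reduced_discriminant K I A)"
    by (rule reduced_discriminant_discriminant_of)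
  then obtain c where c: "c \<noteq> 0" "reduced_discriminant K I A = const_poly c * prod G H"
    using discriminant_of_unique[OF fin irr proper cl H_def GH distinct] by blast
  have "\<exists>d. d \<noteq> 0 \<and> cayley_discriminant K I A J = const_poly d * (if \<exists>G. hypersurface V (T J)
      G then G J else 1)"
    if "J \<in> \<G>" for J
    unfolding T_def by (rule cayley_discriminant_eq[OF sub[OF that] A(1) G[unfolded T_def]])
  then obtain d where d: "\<And>J. J \<in> \<G> \<Longrightarrow> d J \<noteq> 0" "\<And>J. J \<in> \<G> \<Longrightarrow> cayley_discriminant K I A J
      = const_poly (d J) * (if \<exists>G. hypersurface V (T J) G then G J else 1)" by metis
  have "(\<Prod>J\<in>\<G>. cayley_discriminant K I A J) = const_poly (\<Prod>J\<in>\<G>. d J) * (\<Prod>J\<in>\<G>.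
      if \<exists>G. hypersurface V (T J) G then G J else 1)"
    unfolding const_poly_prod prod.distrib[symmetric] by (intro prod.cong refl d)
  also have "(\<Prod>J\<in>\<G>. if \<exists>G. hypersurface V (T J) G then G J else 1) = prod G H"
    unfolding H_def using fin by (rule prod.inter_filter[symmetric])
  finally have prod: "(\<Prod>J\<in>\<G>. cayley_discriminant K I A J) = const_poly (\<Prod>J\<in>\<G>. d J) * prod G H" .
  have d0: "(\<Prod>J\<in>\<G>. d J) \<noteq> 0" using fin d(1) by simp
  have "reduced_discriminant K I A = const_poly (c / (\<Prod>J\<in>\<G>. d J)) * (\<Prod>J\<in>\<G>. cayley_discriminant K I A J)"
    unfolding prod c(2) mult.assoc[symmetric] const_poly_mult[symmetric] using d0 by simp
  moreover have "c / (\<Prod>J\<in>\<G>. d J) \<noteq> 0" using c(1) d0 by simp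
  ultimately show ?thesis unfolding \<G>_def[symmetric] by blast
qed

end

theorem theorem2p31:
  fixes k l :: nat and A :: "nat \<Rightarrow> (nat \<Rightarrow> int) set"
  assumes "l \<le> k"
    and "\<And>j. j \<le> l \<Longrightarrow> finite (A j)"
    and "\<And>j. j \<le> l \<Longrightarrow> A j \<noteq> {}"
    and "\<And>j. j \<le> l \<Longrightarrow> A j \<subseteq> lattice {..<k}"
  shows "\<exists>c. c \<noteq> 0 \<and>
    reduced_discriminant {..<k} {..l} A =
      const_poly c *
      (\<Prod>J \<in> {J. J \<noteq> {} \<and> J \<subseteq> {..l} \<and> (\<forall>J'. J \<subseteq> J' \<and> J' \<subseteq> {..l} \<longrightarrow> codim A J \<le> codim A J')}.
        cayley_discriminant {..<k} {..l} A J)"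
proof -
  interpret supports "{..l}" "{..<k}" A by unfold_locales (use assms(2) in auto)
  show ?thesis by (rule reduced_discriminant_product) (use assms(3,4) in auto)
qed

end
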